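(* Let $\Omega\subset\mathbb{R}^N$ be a bounded $\mathcal{C}^2$ domain, $\alpha\ge0$, $\beta\in(\alpha+1,\alpha+2]$, and let $F$ satisfy the structural assumptions described in the context. Let $b$ be continuous and bounded on $\Omega$, and let $f$ be continuous; assume that either $\alpha=0$, or $\alpha\ne0$ and $f\le -m<0$ for some constant $m>0$. Suppose $u$ and $v$ are respectively a viscosity sub-solution and a viscosity super-solution of $$-F(\nabla w,D^2w)+b(x)|\nabla w|^\beta=f\quad\text{in }\Omega,$$ that $u$ or $v$ is Lipschitz, that both are bounded on $\overline\Omega$, and that $u\le v$ on $\partial\Omega$. Then $u\le v$ in $\Omega$.
   Context: $S$ is the space of real symmetric $N\times N$ matrices. $F:S\to\mathbb{R}$ satisfies: there are $0<a<A$ with $a\,\mathrm{tr}(N)\le F(M+N)-F(M)\le A\,\mathrm{tr}(N)$ for all $M,N\in S$, $N\ge0$; and $F(tM)=tF(M)$ for $t>0$. For $p\in\mathbb{R}^N$, $\Theta_\alpha(p)=\mathrm{Diag}(|p_i|^{\alpha/2})$ and $F(p,M):=F(\Theta_\alpha(p)M\Theta_\alpha(p))$. $|\cdot|$ is the Euclidean norm.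
   Formalization: The sub-solution u is assumed upper semicontinuous and the super-solution v lower semicontinuous on the closure of Ω, not only in Ω; without this the boundary inequality would not constrain the interior values. *)

theory Defs
  imports "HOL-Analysis.Analysis"
begin

definition symmetric_mat :: "real^'n^'n \<Rightarrow> bool" where
  "symmetric_mat M \<longleftrightarrow> transpose M = M"

definition psd_mat :: "real^'n^'n \<Rightarrow> bool" where
  "psd_mat M \<longleftrightarrow> (\<forall>x. 0 \<le> x \<bullet> (M *v x))"

definition structural_F :: "(real^'n^'n \<Rightarrow> real) \<Rightarrow> real \<Rightarrow> real \<Rightarrow> bool" where
  "structural_F F a A \<longleftrightarrow> 0 < a \<and> a < A \<and>
     (\<forall>M N. symmetric_mat M \<longrightarrow> symmetric_mat N \<longrightarrow> psd_mat N \<longrightarrow>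
        a * trace N \<le> F (M + N) - F M \<and> F (M + N) - F M \<le> A * trace N) \<and>
     (\<forall>t M. t > 0 \<longrightarrow> symmetric_mat M \<longrightarrow> F (t *\<^sub>R M) = t * F M)"

text \<open>|s|^e with the convention |s|^0 = 1 (also for s = 0).\<close>
definition abs_pow :: "real \<Rightarrow> real \<Rightarrow> real" where
  "abs_pow s e = (if e = 0 then 1 else \<bar>s\<bar> powr e)"

definition Theta :: "real \<Rightarrow> real^'n \<Rightarrow> real^'n^'n" where
  "Theta \<alpha> p = (\<chi> i j. if i = j then abs_pow (p $ i) (\<alpha> / 2) else 0)"

definition Fp :: "(real^'n^'n \<Rightarrow> real) \<Rightarrow> real \<Rightarrow> real^'n \<Rightarrow> real^'n^'n \<Rightarrow> real" where
  "Fp F \<alpha> p M = F (Theta \<alpha> p ** M ** Theta \<alpha> p)"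

definition C2_with :: "(real^'n \<Rightarrow> real) \<Rightarrow> (real^'n \<Rightarrow> real^'n) \<Rightarrow> (real^'n \<Rightarrow> real^'n^'n)
    \<Rightarrow> (real^'n) set \<Rightarrow> bool" where
  "C2_with \<phi> g H S \<longleftrightarrow>
     (\<forall>x\<in>S. (\<phi> has_derivative (\<lambda>h. g x \<bullet> h)) (at x)) \<and>
     (\<forall>x\<in>S. (g has_derivative (\<lambda>h. H x *v h)) (at x)) \<and>
     continuous_on S H"

definition C2_domain :: "(real^'n) set \<Rightarrow> bool" where
  "C2_domain \<Omega> \<longleftrightarrow> open \<Omega> \<and> connected \<Omega> \<and> \<Omega> \<noteq> {} \<and>
     (\<forall>x0\<in>frontier \<Omega>. \<exists>r>0. \<exists>\<rho> g H. C2_with \<rho> g H (ball x0 r) \<and>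
        (\<forall>x\<in>ball x0 r. g x \<noteq> 0) \<and>
        \<Omega> \<inter> ball x0 r = {x \<in> ball x0 r. \<rho> x < 0})"

definition usc_on :: "'a::metric_space set \<Rightarrow> ('a \<Rightarrow> real) \<Rightarrow> bool" where
  "usc_on S u \<longleftrightarrow> (\<forall>x\<in>S. \<forall>e>0. \<exists>d>0. \<forall>y\<in>S. dist y x < d \<longrightarrow> u y < u x + e)"

definition lsc_on :: "'a::metric_space set \<Rightarrow> ('a \<Rightarrow> real) \<Rightarrow> bool" where
  "lsc_on S u \<longleftrightarrow> (\<forall>x\<in>S. \<forall>e>0. \<exists>d>0. \<forall>y\<in>S. dist y x < d \<longrightarrow> u x - e < u y)"

definition visc_sub :: "(real^'n^'n \<Rightarrow> real) \<Rightarrow> real \<Rightarrow> real \<Rightarrow> (real^'n \<Rightarrow> real)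
    \<Rightarrow> (real^'n \<Rightarrow> real) \<Rightarrow> (real^'n) set \<Rightarrow> (real^'n \<Rightarrow> real) \<Rightarrow> bool" where
  "visc_sub F \<alpha> \<beta> b f \<Omega> u \<longleftrightarrow> usc_on \<Omega> u \<and>
     (\<forall>x0\<in>\<Omega>. \<forall>r \<phi> g H. r > 0 \<longrightarrow> ball x0 r \<subseteq> \<Omega> \<longrightarrow> C2_with \<phi> g H (ball x0 r) \<longrightarrow>
        (\<forall>x\<in>ball x0 r. u x - \<phi> x \<le> u x0 - \<phi> x0) \<longrightarrow>
        - Fp F \<alpha> (g x0) (H x0) + b x0 * norm (g x0) powr \<beta> \<le> f x0)"

definition visc_super :: "(real^'n^'n \<Rightarrow> real) \<Rightarrow> real \<Rightarrow> real \<Rightarrow> (real^'n \<Rightarrow> real)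
    \<Rightarrow> (real^'n \<Rightarrow> real) \<Rightarrow> (real^'n) set \<Rightarrow> (real^'n \<Rightarrow> real) \<Rightarrow> bool" where
  "visc_super F \<alpha> \<beta> b f \<Omega> v \<longleftrightarrow> lsc_on \<Omega> v \<and>
     (\<forall>x0\<in>\<Omega>. \<forall>r \<phi> g H. r > 0 \<longrightarrow> ball x0 r \<subseteq> \<Omega> \<longrightarrow> C2_with \<phi> g H (ball x0 r) \<longrightarrow>
        (\<forall>x\<in>ball x0 r. v x - \<phi> x \<ge> v x0 - \<phi> x0) \<longrightarrow>
        - Fp F \<alpha> (g x0) (H x0) + b x0 * norm (g x0) powr \<beta> \<ge> f x0)"

end

theory Submission
  imports Defs
begin

text \<open>
The subsolution is perturbed to a strict one, and the strict one is compared with \<open>v\<close> by doubling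
variables.

If \<open>\<alpha> = 0\<close>, adding \<open>\<epsilon> exp (\<lambda> e \<bullet> x)\<close> with \<open>\<lambda>\<close> large makes \<open>u\<close> strict, because gradients are bounded
and \<open>p \<mapsto> |p|\<^sup>\<beta>\<close> is locally Lipschitz. If \<open>\<alpha> > 0\<close>, put \<open>exp (- K z) = exp (- K u) - \<delta>\<close>. The
second-order term produced by this change of unknown dominates a multiple of \<open>K |p|\<^bsup>\<alpha> + 2\<^esup>\<close>, which together with \<open>f \<le> - m\<close> absorbs the perturbation of the \<open>|p|\<^sup>\<beta>\<close> term, as \<open>\<beta> \<le> \<alpha> + 2\<close>.

At a maximum of \<open>z(x) - v(y) - k |x - y|\<^sup>2 / 4\<close> both jets have the same matrix part, since the second-order
part of the equation does not depend on the point. To obtain these jets, perturb linearly by all small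
\<open>q\<close>. The regularisations of \<open>z\<close> and \<open>v\<close> are then separated by one \<open>C\<^sup>1\<^sup>,\<^sup>1\<close> function, which touches both
at the contact points. The contact point determines \<open>q\<close> in a Lipschitz way, so the contact points form a
non-negligible set, and by Rademacher's theorem the gradient of the separating function is differentiable
at one of them. This replaces Alexandrov's theorem and Jensen's lemma. The Lipschitz hypothesis bounds the
gradients, which makes the continuity of \<open>b\<close> and \<open>f\<close> sufficient.
\<close>

text \<open>Inserting one \<open>W\<close> for the whole family of tilts \<open>q\<close>, rather
  than one for each, lets Rademacher's theorem be used once: its exceptional set is then fixed and
  cannot follow the contact points. The Hessian found this way is bounded only in terms of the
  penalty \<open>k\<close>, which is large. This is harmless: the two jets share the matrix and
  their gradients differ by \<open>q\<close> alone, so the modulus of continuity of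
  \<open>Fp\<close> is taken after \<open>k\<close> is fixed and \<open>q\<close> is chosen last.
  The gradient terms allow no such delay. The difference \<open>b x - b y\<close> is multiplied by
  \<open>norm p powr \<beta>\<close> and is made small only through \<open>k\<close>, so a gradient
  bound independent of \<open>k\<close> has to come first. A bound on either of \<open>p\<close> and
  \<open>p - q\<close> gives one for both; hence one Lipschitz function is enough. For \<alpha> > 0,
  a slope \<open>\<tau>\<close> of the change of unknown scales the second-order term by
  \<open>\<tau> powr (\<alpha> + 1)\<close> and the gradient term by
  \<open>\<tau> powr \<beta>\<close>. The mismatch is of order \<open>1 - \<tau>\<close>, and so is
  the second-order gain \<open>K * (1 - \<tau>)\<close>; hence a fixed \<open>K\<close> works for
  all small \<delta>.\<close>

section \<open>Almost everywhere differentiability of Lipschitz functions\<close>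

lemma right_difference_quotient_AE:
  fixes r g :: "real \<Rightarrow> real"
  assumes int: "\<And>a b. a \<le> b \<Longrightarrow> (r has_integral (g b - g a)) {a..b}"
  obtains N where "negligible N"
    "\<And>x e. \<lbrakk>x \<notin> N; 0 < e\<rbrakk> \<Longrightarrow> \<exists>d>0. \<forall>h. 0 < h \<and> h < d \<longrightarrow> \<bar>(g (x + h) - g x) / h - r x\<bar> < e"
proof -
  have "r integrable_on cbox a b" for a b :: real
    using int[of a b] by (cases "a \<le> b") (auto simp: integrable_on_def)
  then obtain N where N: "negligible N" and
    lim: "\<And>x e. \<lbrakk>x \<notin> N; 0 < e\<rbrakk> \<Longrightarrow> \<exists>d>0. \<forall>h. 0 < h \<and> h < d \<longrightarrow>
        norm (integral (cbox x (x + h *\<^sub>R One)) r /\<^sub>R h ^ DIM(real) - r x) < e"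
    using integrable_ccontinuous_explicit[of r] by metis
  have eq: "integral (cbox x (x + h *\<^sub>R One)) r /\<^sub>R h ^ DIM(real) = (g (x + h) - g x) / h" if "h > 0" for x h
    using int[of x "x + h"] that by (simp add: integral_unique divide_inverse_commute)
  show ?thesis
  proof (rule that[OF N])
    fix x e :: real assume "x \<notin> N" "0 < e"
    from lim[OF this] obtain d where "d > 0"
      "\<forall>h. 0 < h \<and> h < d \<longrightarrow> norm (integral (cbox x (x + h *\<^sub>R One)) r /\<^sub>R h ^ DIM(real) - r x) < e"
      by blast
    then show "\<exists>d>0. \<forall>h. 0 < h \<and> h < d \<longrightarrow> \<bar>(g (x + h) - g x) / h - r x\<bar> < e"
      using eq by (metis real_norm_def)
  qed
qed

lemma indefinite_integral_AE_differentiable: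
  fixes r g :: "real \<Rightarrow> real"
  assumes int: "\<And>a b. a \<le> b \<Longrightarrow> (r has_integral (g b - g a)) {a..b}"
  obtains N where "negligible N"
    "\<And>x. x \<notin> N \<Longrightarrow> (g has_real_derivative r x) (at x)"
proof -
  obtain N1 where N1: "negligible N1" and
    R: "\<And>x e. \<lbrakk>x \<notin> N1; 0 < e\<rbrakk> \<Longrightarrow> \<exists>d>0. \<forall>h. 0 < h \<and> h < d \<longrightarrow> \<bar>(g (x + h) - g x) / h - r x\<bar> < e"
    using right_difference_quotient_AE[of r g] int by metis
  \<comment> \<open>Left difference quotients of \<open>g\<close> at \<open>x\<close> are right
    difference quotients of the reflected function at \<open>- x\<close>.\<close>
  have "((\<lambda>x. r (- x)) has_integral ((- g (- b)) - (- g (- a)))) {a..b}" if "a \<le> b" for a b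
    using int[of "-b" "-a"] that has_integral_reflect_real[where f = "\<lambda>x. r (- x)" and a = a and b = b] by simp
  then obtain N2 where N2: "negligible N2" and
    L: "\<And>x e. \<lbrakk>x \<notin> N2; 0 < e\<rbrakk> \<Longrightarrow> \<exists>d>0. \<forall>h. 0 < h \<and> h < d \<longrightarrow>
          \<bar>(- g (- (x + h)) - - g (- x)) / h - r (- x)\<bar> < e"
    using right_difference_quotient_AE[of "\<lambda>x. r (- x)" "\<lambda>x. - g (- x)"] by metis
  have neg: "negligible (uminus ` N2)"
    using N2 by (rule negligible_locally_Lipschitz_image[rotated])
      (auto intro!: exI[of _ UNIV] exI[of _ "1::real"] simp: abs_minus_commute)
  show ?thesis
  proof (rule that[of "N1 \<union> uminus ` N2"])
    show "negligible (N1 \<union> uminus ` N2)" using N1 neg by (rule negligible_Un)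
    fix x assume "x \<notin> N1 \<union> uminus ` N2"
    then have x: "x \<notin> N1" "- x \<notin> N2" by (auto simp: image_iff)
    show "(g has_real_derivative r x) (at x)"
      unfolding DERIV_def LIM_def
    proof (intro allI impI)
      fix e :: real assume "e > 0"
      obtain d1 where d1: "d1 > 0" "\<And>h. 0 < h \<Longrightarrow> h < d1 \<Longrightarrow> \<bar>(g (x + h) - g x) / h - r x\<bar> < e"
        using R[OF x(1) \<open>e > 0\<close>] by blast
      obtain d2 where d2: "d2 > 0" "\<And>h. 0 < h \<Longrightarrow> h < d2 \<Longrightarrow>
          \<bar>(- g (- (- x + h)) - - g (- (- x))) / h - r (- (- x))\<bar> < e"
        using L[OF x(2) \<open>e > 0\<close>] by blast
      have "dist ((g (x + h) - g x) / h) (r x) < e" if "h \<noteq> 0" "\<bar>h\<bar> < min d1 d2" for h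
      proof (cases "h > 0")
        case True
        then show ?thesis using d1(2)[of h] that by (auto simp: dist_real_def)
      next
        case False
        then have "(g (x + h) - g x) / h = (- g (- (- x + - h)) - - g (- (- x))) / (- h)"
          using that by (simp add: field_simps)
        then show ?thesis using d2(2)[of "-h"] that False by (auto simp: dist_real_def)
      qed
      then show "\<exists>s>0. \<forall>xa. xa \<noteq> 0 \<and> dist xa 0 < s \<longrightarrow> dist ((g (x + xa) - g x) / xa) (r x) < e"
        using d1(1) d2(1) by (intro exI[of _ "min d1 d2"]) (auto simp: dist_real_def)
    qed
  qed
qed

text \<open>The measure of \<open>g ` A\<close> is absolutely continuous in \<open>A\<close>; its Radon-Nikodym density is the derivative.\<close>
lemma bilipschitz_increasing_AE_differentiable:
  fixes g :: "real \<Rightarrow> real"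
  assumes lo: "\<And>x y. x \<le> y \<Longrightarrow> y - x \<le> g y - g x"
    and up: "\<And>x y. x \<le> y \<Longrightarrow> g y - g x \<le> M * (y - x)"
  obtains N where "negligible N"
    "\<And>x. x \<notin> N \<Longrightarrow> \<exists>c. (g has_real_derivative c) (at x)"
proof -
  have lip: "\<bar>g x - g y\<bar> \<le> M * \<bar>x - y\<bar>" for x y
    using lo[of x y] lo[of y x] up[of x y] up[of y x] by (cases "x \<le> y") (auto simp: abs_if)
  have mono: "x < y \<Longrightarrow> g x < g y" for x y using lo[of x y] by auto
  have le_iff: "g x \<le> g y \<longleftrightarrow> x \<le> y" for x y
    using mono[of x y] mono[of y x] by (cases x y rule: linorder_cases) auto
  have "M \<ge> 1" using lo[of 0 1] up[of 0 1] by auto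
  have "M-lipschitz_on UNIV g"
    using lip \<open>M \<ge> 1\<close> by (intro lipschitz_onI) (auto simp: dist_real_def)
  then have contg: "continuous_on S g" for S
    using continuous_on_subset lipschitz_on_continuous_on by blast
  have injg: "inj g" by (rule injI) (metis le_iff order_antisym order_refl)
  have surjg: "\<exists>x. g x = y" for y
  proof -
    define t where "t = \<bar>y - g 0\<bar>"
    have "g (- t) \<le> y" "y \<le> g t" "- t \<le> t"
      using lo[of 0 t] lo[of "- t" 0] by (auto simp: t_def)
    then show ?thesis using IVT'[of g "-t" y t] contg by blast
  qed
  have "surj g" unfolding surj_def using surjg by metis
  then have "bij g" using injg by (rule bijI[rotated])
  define gi where "gi = inv g"
  have ggi: "g (gi y) = y" "gi (g x) = x" for x y
    using \<open>bij g\<close> by (auto simp: gi_def bij_is_inj bij_is_surj surj_f_inv_f)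
  have "\<bar>gi x - gi y\<bar> \<le> 1 * \<bar>x - y\<bar>" for x y
    using lo[of "gi x" "gi y"] lo[of "gi y" "gi x"] by (cases "gi x \<le> gi y") (auto simp: ggi)
  then have "1-lipschitz_on UNIV gi" by (intro lipschitz_onI) (auto simp: dist_real_def)
  then have meas: "gi \<in> borel_measurable borel"
    by (intro borel_measurable_continuous_onI lipschitz_on_continuous_on)
  define \<nu> where "\<nu> = distr lborel borel gi"
  have vim: "gi -` A = g ` A" for A
  proof
    show "gi -` A \<subseteq> g ` A" using ggi(1) by (metis image_eqI subsetI vimageE)
    show "g ` A \<subseteq> gi -` A" using ggi(2) by auto
  qed
  have em: "emeasure \<nu> A = emeasure lborel (g ` A)" if "A \<in> sets borel" for A
    using that meas by (simp add: \<nu>_def emeasure_distr vim)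
  have "absolutely_continuous lborel \<nu>"
    unfolding absolutely_continuous_def
  proof
    fix A :: "real set" assume A: "A \<in> null_sets lborel"
    then have [simp]: "A \<in> sets borel" by auto
    have "negligible A" using A by (simp add: negligible_iff_null_sets null_sets_completion_iff)
    then have "negligible (g ` A)"
    proof (rule negligible_locally_Lipschitz_image[rotated])
      fix x
      show "\<exists>T B. open T \<and> x \<in> T \<and> (\<forall>y\<in>A \<inter> T. norm (g y - g x) \<le> B * norm (y - x))"
        using lip by (intro exI[of _ UNIV] exI[of _ M]) auto
    qed simp
    moreover have "g ` A \<in> sets borel"
      using measurable_sets[OF meas \<open>A \<in> sets borel\<close>] by (simp add: vim)
    ultimately have "emeasure lborel (g ` A) = 0"
      by (metis negligible_iff_null_sets null_setsD1 null_sets_completion_iff sets_lborel)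
    then show "A \<in> null_sets \<nu>" using em[of A] by (auto simp: null_sets_def \<nu>_def)
  qed
  then obtain \<rho> where \<rho>: "\<rho> \<in> borel_measurable lborel" "density lborel \<rho> = \<nu>"
    using sigma_finite_measure.Radon_Nikodym[OF sigma_finite_lborel, of \<nu>] by (auto simp: \<nu>_def)
  define r where "r = (\<lambda>x. enn2real (\<rho> x))"
  have "(r has_integral (g b - g a)) {a..b}" if "a \<le> b" for a b
  proof -
    have "g ` {a..b} = {g a..g b}"
    proof
      show "g ` {a..b} \<subseteq> {g a..g b}" using le_iff by auto
      show "{g a..g b} \<subseteq> g ` {a..b}"
      proof
        fix y assume "y \<in> {g a..g b}"
        then show "y \<in> g ` {a..b}"
          using ggi(1) le_iff[of a "gi y"] le_iff[of "gi y" b] by (intro image_eqI[of _ _ "gi y"]) auto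
      qed
    qed
    then have "emeasure \<nu> {a..b} = ennreal (g b - g a)"
      using em[of "{a..b}"] le_iff[of a b] that by simp
    then have I: "(\<integral>\<^sup>+x. \<rho> x * indicator {a..b} x \<partial>lborel) = ennreal (g b - g a)"
      using \<rho>(1) by (simp add: \<rho>(2)[symmetric] emeasure_density)
    \<comment> \<open>The density may be infinite on a null set; the finite integral shows that
      \<open>enn2real\<close> changes it only there.\<close>
    then have "AE x in lborel. \<rho> x * indicator {a..b} x \<noteq> \<infinity>"
      using \<rho>(1) by (intro nn_integral_PInf_AE) auto
    then have "AE x in lborel. ennreal (r x * indicator {a..b} x) = \<rho> x * indicator {a..b} x"
      by eventually_elim (auto simp: r_def indicator_def top.not_eq_extremum)
    then have "(\<integral>\<^sup>+x. ennreal (r x * indicator {a..b} x) \<partial>lborel) = ennreal (g b - g a)"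
      using I by (simp cong: nn_integral_cong_AE)
    then have "((\<lambda>x. r x * indicator {a..b} x) has_integral (g b - g a)) UNIV"
      using \<rho>(1) le_iff[of a b] that
      by (intro nn_integral_has_integral) (auto simp: r_def)
    moreover have "(\<lambda>x. r x * indicator {a..b} x) = (\<lambda>x. if x \<in> {a..b} then r x else 0)"
      by (auto simp: indicator_def)
    ultimately show ?thesis using has_integral_restrict_UNIV[of "{a..b}" r] by simp
  qed
  then show ?thesis
    using indefinite_integral_AE_differentiable[of r g] that by metis
qed

text \<open>Adding a linear function of slope \<open>L + 1\<close> puts all difference quotients
  between \<open>1\<close> and \<open>2 * L + 1\<close>.\<close>

lemma lipschitz_real_AE_differentiable:
  fixes f :: "real \<Rightarrow> real"
  assumes lip: "\<And>x y. \<bar>f x - f y\<bar> \<le> L * \<bar>x - y\<bar>"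
  obtains N where "negligible N"
    "\<And>x. x \<notin> N \<Longrightarrow> \<exists>c. (f has_real_derivative c) (at x)"
proof -
  obtain N where N: "negligible N" and
    d: "\<And>x. x \<notin> N \<Longrightarrow> \<exists>c. ((\<lambda>x. f x + (L + 1) * x) has_real_derivative c) (at x)"
  proof (rule bilipschitz_increasing_AE_differentiable[of "\<lambda>x. f x + (L + 1) * x" "2 * L + 1"])
    fix x y :: real assume "x \<le> y"
    then show "y - x \<le> f y + (L + 1) * y - (f x + (L + 1) * x)"
      "f y + (L + 1) * y - (f x + (L + 1) * x) \<le> (2 * L + 1) * (y - x)"
      using lip[of x y] by (auto simp: abs_le_iff algebra_simps)
  qed blast
  show ?thesis
  proof (rule that[OF N])
    fix x assume "x \<notin> N"
    then obtain c where "((\<lambda>x. f x + (L + 1) * x) has_real_derivative c) (at x)" using d by blast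
    then have "((\<lambda>x. f x + (L + 1) * x - (L + 1) * x) has_real_derivative (c - (L + 1))) (at x)"
      by (rule DERIV_diff) (rule DERIV_cmult_Id)
    then show "\<exists>c. (f has_real_derivative c) (at x)" by auto
  qed
qed

section \<open>Rademacher's theorem, one coordinate direction at a time\<close>

definition linear_approx_set ::
    "('a::euclidean_space \<Rightarrow> real) \<Rightarrow> 'a set \<Rightarrow> 'a \<Rightarrow> real \<Rightarrow> real \<Rightarrow> 'a set" where
  "linear_approx_set f S c r e =
     {z. \<forall>h\<in>span S. norm h < r \<longrightarrow> \<bar>f (z + h) - f z - c \<bullet> h\<bar> \<le> e * norm h}"

text \<open>The slope \<open>c\<close> may depend on \<open>e\<close>. It can therefore be taken
  from a countable dense set, and convergence of the slopes is postponed to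
  \<open>linear_approx_at_imp_differentiable\<close>.\<close>

definition linear_approx_at :: "('a::euclidean_space \<Rightarrow> real) \<Rightarrow> 'a set \<Rightarrow> 'a \<Rightarrow> bool" where
  "linear_approx_at f S z \<longleftrightarrow> (\<forall>e>0. \<exists>c. \<exists>r>0. z \<in> linear_approx_set f S c r e)"

lemma closed_linear_approx_set:
  assumes "continuous_on UNIV f"
  shows "closed (linear_approx_set f S c r e)"
proof -
  have f: "continuous_on UNIV (\<lambda>z. f (z + h))" for h
    by (rule continuous_on_compose2[OF assms]) (auto intro!: continuous_intros)
  have "closed {z. \<bar>f (z + h) - f z - c \<bullet> h\<bar> \<le> e * norm h}" for h
    by (intro closed_Collect_le continuous_intros f assms)
  moreover have "linear_approx_set f S c r e =
      (\<Inter>h \<in> {h \<in> span S. norm h < r}. {z. \<bar>f (z + h) - f z - c \<bullet> h\<bar> \<le> e * norm h})"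
    by (auto simp: linear_approx_set_def)
  ultimately show ?thesis by auto
qed

text \<open>Half of the error pays for moving \<open>c\<close> to a point of \<open>D\<close>.
  Countable quantifiers give Borel measurability, and later a countable family of sets on which the
  approximation is uniform.\<close>

lemma linear_approx_at_iff:
  assumes dense: "\<And>X. open X \<Longrightarrow> X \<noteq> {} \<Longrightarrow> \<exists>d\<in>D. d \<in> X"
  shows "linear_approx_at f S z \<longleftrightarrow>
    (\<forall>m. \<exists>c\<in>D. \<exists>k. z \<in> linear_approx_set f S c (1 / real (Suc k)) (1 / real (Suc m)))"
    (is "_ \<longleftrightarrow> ?R")
proof
  assume L: "linear_approx_at f S z"
  show ?R
  proof
    fix m
    define e where "e = 1 / real (Suc m) / 2"
    have "e > 0" by (simp add: e_def)
    then obtain c r where cr: "r > 0" "z \<in> linear_approx_set f S c r e"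
      using L by (auto simp: linear_approx_at_def)
    obtain d where d: "d \<in> D" "dist c d < e"
      using dense[of "ball c e"] \<open>e > 0\<close> by auto
    obtain k where k: "inverse (real (Suc k)) < r" using reals_Archimedean cr(1) by blast
    have "\<bar>f (z + h) - f z - d \<bullet> h\<bar> \<le> 1 / real (Suc m) * norm h"
      if h: "h \<in> span S" "norm h < 1 / real (Suc k)" for h
    proof -
      have "\<bar>f (z + h) - f z - c \<bullet> h\<bar> \<le> e * norm h"
        using cr(2) h k by (auto simp: linear_approx_set_def inverse_eq_divide)
      moreover have "\<bar>(c - d) \<bullet> h\<bar> \<le> e * norm h"
        by (rule order_trans[OF Cauchy_Schwarz_ineq2])
          (use d in \<open>auto intro!: mult_right_mono simp: dist_norm\<close>)
      moreover have "1 / real (Suc m) = e + e" unfolding e_def by (rule field_sum_of_halves[symmetric])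
      then have "1 / real (Suc m) * norm h = e * norm h + e * norm h" by (simp only: distrib_right)
      ultimately show ?thesis by (simp add: inner_diff_left abs_le_iff) 
    qed
    then show "\<exists>c\<in>D. \<exists>k. z \<in> linear_approx_set f S c (1 / real (Suc k)) (1 / real (Suc m))"
      using d(1) by (auto simp: linear_approx_set_def)
  qed
next
  assume R: ?R
  show "linear_approx_at f S z"
    unfolding linear_approx_at_def
  proof (intro allI impI)
    fix e :: real assume "e > 0"
    then obtain m where m: "inverse (real (Suc m)) < e" using reals_Archimedean by blast
    obtain c k where c: "z \<in> linear_approx_set f S c (1 / real (Suc k)) (1 / real (Suc m))"
      using R by blast
    have "\<bar>f (z + h) - f z - c \<bullet> h\<bar> \<le> e * norm h" if "h \<in> span S" "norm h < 1 / real (Suc k)" for h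
    proof -
      have "\<bar>f (z + h) - f z - c \<bullet> h\<bar> \<le> 1 / real (Suc m) * norm h"
        using c that by (auto simp: linear_approx_set_def)
      also have "\<dots> \<le> e * norm h"
        using m by (intro mult_right_mono) (auto simp: inverse_eq_divide)
      finally show ?thesis .
    qed
    then show "\<exists>c. \<exists>r>0. z \<in> linear_approx_set f S c r e"
      by (intro exI[of _ c] exI[of _ "1 / real (Suc k)"]) (auto simp: linear_approx_set_def)
  qed
qed

lemma sets_linear_approx_at:
  assumes "continuous_on UNIV f"
  shows "{z. linear_approx_at f S z} \<in> sets borel"
proof -
  obtain D :: "'a set" where D: "countable D" "\<And>X. open X \<Longrightarrow> X \<noteq> {} \<Longrightarrow> \<exists>d\<in>D. d \<in> X"
    using countable_dense_setE by blast
  have "{z. linear_approx_at f S z} =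
      (\<Inter>m. \<Union>c\<in>D. \<Union>k. linear_approx_set f S c (1 / real (Suc k)) (1 / real (Suc m)))"
    using linear_approx_at_iff[OF D(2)] by auto
  also have "\<dots> \<in> sets borel"
    using D(1) closed_linear_approx_set[OF assms]
    by (intro sets.countable_INT'' sets.countable_UN' sets.countable_UN) auto
  finally show ?thesis .
qed

text \<open>Fubini without a change of coordinates: on each line in direction \<open>b\<close> almost every point is good, so
  some translate of the bad set, and hence the bad set itself, is negligible.\<close>
lemma lipschitz_axis_AE:
  fixes f :: "'a::euclidean_space \<Rightarrow> real"
  assumes lip: "\<And>x y. \<bar>f x - f y\<bar> \<le> L * norm (x - y)" and b: "norm b = 1"
  shows "negligible {z. \<not> linear_approx_at f {b} z}"
proof -
  have "L \<ge> 0" using lip[of b 0] b by auto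
  then have "L-lipschitz_on UNIV f" using lip by (intro lipschitz_onI) (auto simp: dist_norm)
  then have cont: "continuous_on UNIV f" by (rule lipschitz_on_continuous_on)
  note sets = sets_linear_approx_at[OF cont, of "{b}"]
  have line: "AE s in lborel. linear_approx_at f {b} (z + s *\<^sub>R b)" for z
  proof -
    have "\<bar>f (z + x *\<^sub>R b) - f (z + y *\<^sub>R b)\<bar> \<le> L * \<bar>x - y\<bar>" for x y
      using lip[of "z + x *\<^sub>R b" "z + y *\<^sub>R b"] b
      by (simp add: scaleR_diff_left[symmetric])
    then obtain N where N: "negligible N" and
      d: "\<And>s. s \<notin> N \<Longrightarrow> \<exists>c. ((\<lambda>s. f (z + s *\<^sub>R b)) has_real_derivative c) (at s)"
      using lipschitz_real_AE_differentiable[of "\<lambda>s. f (z + s *\<^sub>R b)" L] by metis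
    have "linear_approx_at f {b} (z + s *\<^sub>R b)" if s: "s \<notin> N" for s
      unfolding linear_approx_at_def
    proof (intro allI impI)
      fix e :: real assume "e > 0"
      obtain c where "((\<lambda>s. f (z + s *\<^sub>R b)) has_derivative (*) c) (at s)"
        using d[OF s] by (auto simp: has_field_derivative_def)
      then obtain r where r: "r > 0" "\<And>t. norm (t - s) < r \<Longrightarrow>
          norm (f (z + t *\<^sub>R b) - f (z + s *\<^sub>R b) - c * (t - s)) \<le> e * norm (t - s)"
        using \<open>e > 0\<close> by (auto simp: has_derivative_at_alt)
      have "z + s *\<^sub>R b \<in> linear_approx_set f {b} (c *\<^sub>R b) r e"
        unfolding linear_approx_set_def
      proof (safe)
        fix h assume "h \<in> span {b}" "norm h < r"
        then obtain t where t: "h = t *\<^sub>R b" by (auto simp: span_singleton)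
        then show "\<bar>f (z + s *\<^sub>R b + h) - f (z + s *\<^sub>R b) - c *\<^sub>R b \<bullet> h\<bar> \<le> e * norm h"
          using r(2)[of "s + t"] \<open>norm h < r\<close> b
          by (simp add: algebra_simps norm_eq_1[THEN iffD1])
      qed
      then show "\<exists>c. \<exists>r>0. z + s *\<^sub>R b \<in> linear_approx_set f {b} c r e" using r(1) by blast
    qed
    then have "{s. \<not> linear_approx_at f {b} (z + s *\<^sub>R b)} \<subseteq> N" by auto
    then have neg: "negligible {s. \<not> linear_approx_at f {b} (z + s *\<^sub>R b)}"
      using N negligible_subset by blast
    have "(\<lambda>s. z + s *\<^sub>R b) \<in> borel_measurable borel" by measurable
    from measurable_sets[OF this sets]
    have "{s. linear_approx_at f {b} (z + s *\<^sub>R b)} \<in> sets borel" by (simp add: vimage_def)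
    from sets.compl_sets[OF this]
    have "{s. \<not> linear_approx_at f {b} (z + s *\<^sub>R b)} \<in> sets borel"
      by (simp add: Compl_eq_Diff_UNIV[symmetric] Collect_neg_eq)
    with neg have "{s. \<not> linear_approx_at f {b} (z + s *\<^sub>R b)} \<in> null_sets lborel"
      by (simp add: negligible_iff_null_sets null_sets_completion_iff)
    then show ?thesis by (auto dest: AE_not_in)
  qed
  \<comment> \<open>So far almost every \<open>s\<close> is good for each fixed \<open>z\<close>;
    measurability in the pair allows the quantifiers to be exchanged.\<close>
  have "(\<lambda>x::'a \<times> real. fst x + snd x *\<^sub>R b) \<in> borel_measurable (lborel \<Otimes>\<^sub>M lborel)"
    by measurable
  from measurable_sets[OF this sets]
  have "{x \<in> space (lborel \<Otimes>\<^sub>M lborel). linear_approx_at f {b} (fst x + snd x *\<^sub>R b)}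
      \<in> sets (lborel \<Otimes>\<^sub>M lborel)"
    by (simp add: vimage_def Collect_conj_eq Int_commute)
  from lborel_pair.AE_commute[OF this] line
  have ae: "AE s in lborel. AE z in lborel. linear_approx_at f {b} (z + s *\<^sub>R b)" by simp
  have "\<exists>s. AE z in lborel. linear_approx_at f {b} (z + s *\<^sub>R b)"
  proof (rule ccontr)
    assume "\<not> ?thesis"
    then have "AE s in lborel :: real measure. False" using ae by simp
    then obtain X :: "real set" where "X \<in> null_sets lborel" "UNIV \<subseteq> X"
      by (auto simp: eventually_ae_filter)
    then have "emeasure lborel (UNIV :: real set) = 0"
      by (metis null_setsD1 top.extremum_uniqueI)
    then show False by simp
  qed
  then obtain s where "AE z in lborel. linear_approx_at f {b} (z + s *\<^sub>R b)" by blast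
  then have "AE z in lebesgue. linear_approx_at f {b} (z + s *\<^sub>R b)"
    by (rule AE_completion)
  then obtain N where N: "negligible N" "{z. \<not> linear_approx_at f {b} (z + s *\<^sub>R b)} \<subseteq> N"
    by (auto simp: eventually_ae_filter_negligible)
  have "{z. \<not> linear_approx_at f {b} z} \<subseteq> (+) (s *\<^sub>R b) ` N"
  proof safe
    fix z assume "\<not> linear_approx_at f {b} z"
    then have "z - s *\<^sub>R b \<in> N" using N(2) by auto
    then show "z \<in> (+) (s *\<^sub>R b) ` N" by (intro image_eqI[of _ _ "z - s *\<^sub>R b"]) auto
  qed
  then show ?thesis using negligible_translation[OF N(1)] negligible_subset by blast
qed

text \<open>If \<open>A\<close> is a set on which the approximation along \<open>span S\<close> is uniform, then at almost every point of
  \<open>A\<close> the distance to \<open>A\<close> has derivative \<open>0\<close> along \<open>b\<close>, because it attains its minimum there. So the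
  endpoint of a step along \<open>b\<close> is close to a point of \<open>A\<close>, from which one can continue along
  \<open>span S\<close>. No density theorem in several dimensions is needed.\<close>
lemma linear_approx_at_insert_AE:
  fixes f :: "'a::euclidean_space \<Rightarrow> real"
  assumes lip: "\<And>x y. \<bar>f x - f y\<bar> \<le> L * norm (x - y)"
    and S: "S \<subseteq> Basis" and b: "b \<in> Basis" "b \<notin> S"
    and neg: "negligible {z. \<not> linear_approx_at f S z}"
  shows "negligible {z. \<not> linear_approx_at f (insert b S) z}"
proof -
  have nb: "norm b = 1" using b by simp
  have "L \<ge> 0" using lip[of b 0] nb by auto
  then have "L-lipschitz_on UNIV f" using lip by (intro lipschitz_onI) (auto simp: dist_norm)
  then have cont: "continuous_on UNIV f" by (rule lipschitz_on_continuous_on)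
  obtain D :: "'a set" where D: "countable D" "\<And>X. open X \<Longrightarrow> X \<noteq> {} \<Longrightarrow> \<exists>d\<in>D. d \<in> X"
    using countable_dense_setE by blast
  define E where "E = (\<lambda>(c, k::nat, m::nat). linear_approx_set f S c (1 / real (Suc k)) (1 / real (Suc m)))"
  define I where "I = D \<times> (UNIV :: nat set) \<times> (UNIV :: nat set)"
  define N where "N = {z. \<not> linear_approx_at f S z} \<union> {z. \<not> linear_approx_at f {b} z} \<union>
      (\<Union>i\<in>I. {z. \<not> linear_approx_at (\<lambda>x. infdist x (E i)) {b} z})"
  have "countable I" using D(1) by (auto simp: I_def)
  have "\<bar>infdist x A - infdist y A\<bar> \<le> 1 * norm (x - y)" for x y :: 'a and A
    using infdist_triangle_abs[of x A y] by (simp add: dist_norm)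
  then have "negligible {z. \<not> linear_approx_at (\<lambda>x. infdist x A) {b} z}" for A
    using nb by (rule lipschitz_axis_AE)
  then have "negligible (\<Union>((\<lambda>i. {z. \<not> linear_approx_at (\<lambda>x. infdist x (E i)) {b} z}) ` I))"
    using \<open>countable I\<close> by (intro negligible_countable_Union) auto
  then have "negligible N"
    unfolding N_def using neg lipschitz_axis_AE[OF lip nb] by (intro negligible_Un) auto
  moreover have "linear_approx_at f (insert b S) z" if z: "z \<notin> N" for z
    unfolding linear_approx_at_def
  proof (intro allI impI)
    fix e :: real assume "e > 0"
    \<comment> \<open>Replacing \<open>z + t *\<^sub>R b\<close> by a point of \<open>A\<close> at
      distance at most \<open>2 * e2 * \<bar>t\<bar>\<close>, once before and once after the step
      \<open>h'\<close>, costs \<open>4 * L * e2 * \<bar>t\<bar>\<close>; the step along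
      \<open>b\<close> itself costs \<open>e2 * \<bar>t\<bar>\<close>.\<close>
    define w where "w = 4 * L + 1"
    define e2 where "e2 = e / (2 * w)"
    have "w > 0" using \<open>L \<ge> 0\<close> by (simp add: w_def)
    then have e2: "e2 > 0" and "w * e2 = e / 2" using \<open>e > 0\<close> by (simp_all add: e2_def)
    then have e2': "(4 * L + 1) * e2 = e / 2" by (simp add: w_def)
    obtain m where m: "inverse (real (Suc m)) < e / 2" using reals_Archimedean \<open>e > 0\<close> half_gt_zero by blast
    have "linear_approx_at f S z" using z by (auto simp: N_def)
    then obtain c k where c: "c \<in> D" "z \<in> linear_approx_set f S c (1 / real (Suc k)) (1 / real (Suc m))"
      using linear_approx_at_iff[OF D(2)] by metis
    define A where "A = E (c, k, m)"
    have zA: "z \<in> A" "closed A" using c closed_linear_approx_set[OF cont] by (auto simp: A_def E_def)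
    have "(c, k, m) \<in> I" using c(1) by (auto simp: I_def)
    then have "linear_approx_at (\<lambda>x. infdist x A) {b} z" using z by (auto simp: N_def A_def)
    then obtain c1 r1 where r1: "r1 > 0" "z \<in> linear_approx_set (\<lambda>x. infdist x A) {b} c1 r1 e2"
      using e2 by (auto simp: linear_approx_at_def)
    have "linear_approx_at f {b} z" using z by (auto simp: N_def)
    then obtain c2 r2 where r2: "r2 > 0" "z \<in> linear_approx_set f {b} c2 r2 e2"
      using e2 by (auto simp: linear_approx_at_def)
    define r where "r = min (1 / real (Suc k)) (min r1 r2)"
    \<comment> \<open>This vector acts like \<open>c\<close> on \<open>span S\<close>, which is
      orthogonal to \<open>b\<close>, and like \<open>c2\<close> along \<open>b\<close>.\<close>
    define c' where "c' = c + ((c2 - c) \<bullet> b) *\<^sub>R b"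
    have "\<bar>f (z + h) - f z - c' \<bullet> h\<bar> \<le> e * norm h" if h: "h \<in> span (insert b S)" "norm h < r" for h
    proof -
      obtain t where "h - t *\<^sub>R b \<in> span S" using h(1) by (auto simp: span_breakdown_eq)
      define h' where "h' = h - t *\<^sub>R b"
      have h': "h' \<in> span S" "h = t *\<^sub>R b + h'" using \<open>h - t *\<^sub>R b \<in> span S\<close> by (auto simp: h'_def)
      have "orthogonal b h'"
      proof (rule orthogonal_to_span[OF h'(1)])
        fix x assume "x \<in> S"
        then show "orthogonal b x" using S b by (auto simp: orthogonal_def inner_Basis)
      qed
      then have bh: "b \<bullet> h' = 0" "h' \<bullet> b = 0" by (auto simp: orthogonal_def inner_commute)
      have bb: "b \<bullet> b = 1" using b by simp
      have "h \<bullet> b = t" using h'(2) bh bb by (simp add: inner_add_left)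
      then have t: "\<bar>t\<bar> \<le> norm h" using Cauchy_Schwarz_ineq2[of h b] nb by auto
      have "(t *\<^sub>R b + h') \<bullet> (t *\<^sub>R b + h') = t * t + h' \<bullet> h'"
        by (simp add: inner_add_left inner_add_right bh bb)
      then have "(norm h)\<^sup>2 = t\<^sup>2 + (norm h')\<^sup>2"
        unfolding power2_norm_eq_inner power2_eq_square[of t] h'(2)[symmetric] .
      then have nh': "norm h' \<le> norm h" by (auto intro: power2_le_imp_le[of "norm h'" "norm h"])
      have tb: "norm (t *\<^sub>R b) = \<bar>t\<bar>" "norm ((- t) *\<^sub>R b) = \<bar>t\<bar>" using nb by auto
      have sp: "s *\<^sub>R b \<in> span {b}" for s by (auto simp: span_singleton)
      have small: "\<bar>t\<bar> < r1" "\<bar>t\<bar> < r2" "norm h' < 1 / real (Suc k)"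
        using h(2) t nh' by (auto simp: r_def)
      have id: "\<bar>infdist (z + s *\<^sub>R b) A - c1 \<bullet> (s *\<^sub>R b)\<bar> \<le> e2 * \<bar>s\<bar>" if "\<bar>s\<bar> < r1" for s
        using r1(2) sp[of s] nb that zA(1) unfolding linear_approx_set_def by auto
      \<comment> \<open>The distance is nonnegative also after the opposite step, which bounds the
        linear term \<open>c1 \<bullet> (t *\<^sub>R b)\<close> by
        \<open>e2 * \<bar>t\<bar>\<close>; so the distance after the step itself is at most twice
        that.\<close>
      have "\<bar>infdist (z + t *\<^sub>R b) A - c1 \<bullet> (t *\<^sub>R b)\<bar> \<le> e2 * \<bar>t\<bar>"
        "\<bar>infdist (z + (-t) *\<^sub>R b) A - c1 \<bullet> ((-t) *\<^sub>R b)\<bar> \<le> e2 * \<bar>t\<bar>"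
        using id[of t] id[of "-t"] small(1) by auto
      then have "infdist (z + t *\<^sub>R b) A \<le> 2 * e2 * \<bar>t\<bar>"
        using infdist_nonneg[of "z + (-t) *\<^sub>R b" A] by (auto simp: abs_le_iff)
      moreover obtain x where x: "x \<in> A" "infdist (z + t *\<^sub>R b) A = dist (z + t *\<^sub>R b) x"
        using infdist_attains_inf[OF zA(2)] zA(1) by blast
      ultimately have nx: "norm (z + t *\<^sub>R b - x) \<le> 2 * e2 * \<bar>t\<bar>" by (simp add: dist_norm)
      have "\<bar>f (z + t *\<^sub>R b + h') - f (x + h')\<bar> \<le> L * (2 * e2 * \<bar>t\<bar>)"
        using lip[of "z + t *\<^sub>R b + h'" "x + h'"] nx mult_left_mono[OF nx \<open>L \<ge> 0\<close>]
        by (simp add: algebra_simps)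
      moreover have "\<bar>f x - f (z + t *\<^sub>R b)\<bar> \<le> L * (2 * e2 * \<bar>t\<bar>)"
        using lip[of "z + t *\<^sub>R b" x] nx mult_left_mono[OF nx \<open>L \<ge> 0\<close>]
        by (simp add: abs_minus_commute)
      moreover have "\<bar>f (x + h') - f x - c \<bullet> h'\<bar> \<le> 1 / real (Suc m) * norm h'"
        using x(1) h'(1) small(3) by (auto simp: A_def E_def linear_approx_set_def)
      moreover have "\<bar>f (z + t *\<^sub>R b) - f z - c2 \<bullet> (t *\<^sub>R b)\<bar> \<le> e2 * \<bar>t\<bar>"
        using r2(2) sp[of t] small tb unfolding linear_approx_set_def by auto
      moreover have "c' \<bullet> h = c \<bullet> h' + c2 \<bullet> (t *\<^sub>R b)"
        unfolding h'(2) c'_def using bh bb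
        by (simp add: inner_add_left inner_add_right inner_diff_left algebra_simps)
      moreover have "f (z + h) = f (z + t *\<^sub>R b + h')" using h'(2) by (simp add: add.assoc)
      ultimately have "\<bar>f (z + h) - f z - c' \<bullet> h\<bar> \<le>
          L * (2 * e2 * \<bar>t\<bar>) + L * (2 * e2 * \<bar>t\<bar>) + 1 / real (Suc m) * norm h' + e2 * \<bar>t\<bar>"
        by linarith
      also have "\<dots> = (4 * L + 1) * e2 * \<bar>t\<bar> + inverse (real (Suc m)) * norm h'"
        by (simp add: algebra_simps inverse_eq_divide)
      also have "\<dots> \<le> e / 2 * norm h + e / 2 * norm h"
        unfolding e2' using t nh' m \<open>e > 0\<close> by (intro add_mono mult_mono) auto
      finally show ?thesis by simp
    qed
    then show "\<exists>c. \<exists>r>0. z \<in> linear_approx_set f (insert b S) c r e"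
      using r1(1) r2(1) by (intro exI[of _ c'] exI[of _ r]) (auto simp: linear_approx_set_def r_def)
  qed
  ultimately show ?thesis by (metis (mono_tags, lifting) mem_Collect_eq negligible_subset subsetI)
qed

text \<open>Two slopes valid up to errors \<open>e\<close> and \<open>e'\<close> on a common ball
  differ by at most \<open>e + e'\<close>: test both with an increment along their difference. So
  the slopes for errors tending to 0 form a Cauchy sequence, and the limit is the gradient.\<close>

lemma linear_approx_at_imp_differentiable:
  fixes f :: "'a::euclidean_space \<Rightarrow> real"
  assumes "linear_approx_at f Basis z"
  shows "f differentiable (at z)"
proof -
  have "\<exists>c r. r > 0 \<and> (\<forall>h. norm h < r \<longrightarrow> \<bar>f (z + h) - f z - c \<bullet> h\<bar> \<le> inverse (real (Suc n)) * norm h)" for n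
    using assms unfolding linear_approx_at_def linear_approx_set_def span_Basis
    by (auto dest!: spec[of _ "inverse (real (Suc n))"])
  then obtain c r where r: "\<And>n. r n > 0" and
    c: "\<And>n h. norm h < r n \<Longrightarrow> \<bar>f (z + h) - f z - c n \<bullet> h\<bar> \<le> inverse (real (Suc n)) * norm h"
    by metis
  have diff: "norm (c m - c n) \<le> inverse (real (Suc m)) + inverse (real (Suc n))" for m n
  proof (cases "c m = c n")
    case False
    define s where "s = min (r m) (r n) / 2 / norm (c m - c n)"
    define h where "h = s *\<^sub>R (c m - c n)"
    have "s > 0" using r[of m] r[of n] False by (simp add: s_def)
    have nh: "norm h = min (r m) (r n) / 2" using False r[of m] r[of n] by (simp add: h_def s_def)
    then have "norm h < r m" "norm h < r n" "norm h > 0" using r[of m] r[of n] by auto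
    then have "\<bar>(c m - c n) \<bullet> h\<bar> \<le> (inverse (real (Suc m)) + inverse (real (Suc n))) * norm h"
      using c[of h m] c[of h n] by (simp add: inner_diff_left abs_le_iff algebra_simps)
    moreover have "(c m - c n) \<bullet> h = norm (c m - c n) * norm h"
      using \<open>s > 0\<close> by (simp add: h_def dot_square_norm power2_eq_square)
    ultimately show ?thesis using \<open>norm h > 0\<close> by simp
  qed simp
  have "Cauchy c"
  proof (rule metric_CauchyI)
    fix e :: real assume "e > 0"
    then obtain M where M: "inverse (real (Suc M)) < e / 2" using reals_Archimedean half_gt_zero by blast
    have "dist (c m) (c n) < e" if "m \<ge> M" "n \<ge> M" for m n
    proof -
      have "inverse (real (Suc m)) \<le> inverse (real (Suc M))" "inverse (real (Suc n)) \<le> inverse (real (Suc M))"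
        using that by (auto simp: field_simps)
      then show ?thesis using diff[of m n] M unfolding dist_norm by linarith
    qed
    then show "\<exists>M. \<forall>m\<ge>M. \<forall>n\<ge>M. dist (c m) (c n) < e" by blast
  qed
  then obtain l where l: "c \<longlonglongrightarrow> l" using Cauchy_convergent convergent_def by blast
  have "(f has_derivative (\<lambda>h. l \<bullet> h)) (at z)"
    unfolding has_derivative_at_alt
  proof (intro conjI allI impI)
    show "bounded_linear ((\<bullet>) l)" by (rule bounded_linear_inner_right)
    fix e :: real assume "e > 0"
    have "\<forall>\<^sub>F n in sequentially. dist (c n) l < e / 2"
      using l \<open>e > 0\<close> by (intro tendstoD) auto
    moreover have "\<forall>\<^sub>F n in sequentially. inverse (real (Suc n)) < e / 2"
      using order_tendstoD(2)[OF LIMSEQ_inverse_real_of_nat, of "e / 2"] \<open>e > 0\<close> by simp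
    ultimately have "\<forall>\<^sub>F n in sequentially. dist (c n) l < e / 2 \<and> inverse (real (Suc n)) < e / 2"
      by (rule eventually_conj)
    then obtain n where n: "dist (c n) l < e / 2" "inverse (real (Suc n)) < e / 2"
      by (auto simp: eventually_sequentially)
    have "norm (f y - f z - l \<bullet> (y - z)) \<le> e * norm (y - z)" if y: "norm (y - z) < r n" for y
    proof -
      have "\<bar>f y - f z - c n \<bullet> (y - z)\<bar> \<le> inverse (real (Suc n)) * norm (y - z)"
        using c[OF y] by simp
      also have "\<dots> \<le> e / 2 * norm (y - z)" using n(2) by (intro mult_right_mono) auto
      finally have 1: "\<bar>f y - f z - c n \<bullet> (y - z)\<bar> \<le> e / 2 * norm (y - z)" .
      have "norm (c n - l) \<le> e / 2" using n(1) by (simp add: dist_norm)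
      then have 2: "\<bar>(c n - l) \<bullet> (y - z)\<bar> \<le> e / 2 * norm (y - z)"
        by (intro order_trans[OF Cauchy_Schwarz_ineq2] mult_right_mono) auto
      have "e * norm (y - z) = e / 2 * norm (y - z) + e / 2 * norm (y - z)" by simp
      with 1 2 show ?thesis unfolding real_norm_def inner_diff_left by linarith
    qed
    then show "\<exists>d>0. \<forall>y. norm (y - z) < d \<longrightarrow> norm (f y - f z - l \<bullet> (y - z)) \<le> e * norm (y - z)"
      using r by blast
  qed
  then show ?thesis by (auto simp: differentiable_def)
qed

theorem Rademacher:
  fixes f :: "'a::euclidean_space \<Rightarrow> 'b::euclidean_space"
  assumes lip: "\<And>x y. norm (f x - f y) \<le> L * norm (x - y)"
  shows "negligible {z. \<not> f differentiable (at z)}"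
proof -
  have real: "negligible {z. \<not> (\<lambda>x. f x \<bullet> i) differentiable (at z)}" if i: "i \<in> Basis" for i
  proof -
    have lip': "\<bar>f x \<bullet> i - f y \<bullet> i\<bar> \<le> L * norm (x - y)" for x y
      using lip[of x y] Basis_le_norm[OF i, of "f x - f y"] by (simp add: inner_diff_left)
    have "negligible {z. \<not> linear_approx_at (\<lambda>x. f x \<bullet> i) S z}" if "S \<subseteq> Basis" for S
    proof -
      have "finite S" using that finite_Basis finite_subset by blast
      then show ?thesis using that
      proof induction
        case empty
        have "linear_approx_at (\<lambda>x. f x \<bullet> i) {} z" for z
          by (auto simp: linear_approx_at_def linear_approx_set_def intro!: exI[of _ "1::real"])
        then show ?case by simp
      next
        case (insert b S)
        then show ?case using linear_approx_at_insert_AE[OF lip', of S b] by auto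
      qed
    qed
    from this[OF order_refl] show ?thesis
      by (rule negligible_subset) (use linear_approx_at_imp_differentiable in blast)
  qed
  have "{z. \<not> f differentiable (at z)} = (\<Union>i\<in>Basis. {z. \<not> (\<lambda>x. f x \<bullet> i) differentiable (at z)})"
    by (auto simp: differentiable_componentwise_within[of f _ UNIV])
  then show ?thesis using real by (auto intro!: negligible_Union)
qed

section \<open>A maximum principle for sums of semicontinuous functions\<close>

text \<open>Take \<open>s\<close> along \<open>d\<close> with length \<open>r\<close>; if
  \<open>r = 0\<close>, let the length tend to 0. Both the Lipschitz bound for the gradient
  \<open>G\<close> and the one for the inverse of the contact map \<open>Z\<close> rest on
  this.\<close>

lemma norm_le_if_inner_le_quadratic:
  fixes d :: "'a::real_inner"
  assumes le: "\<And>s. d \<bullet> s \<le> C * (r + norm s)\<^sup>2" and "r \<ge> 0" "C \<ge> 0"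
  shows "norm d \<le> 4 * C * r"
proof (cases "d = 0")
  case True
  then show ?thesis using \<open>r \<ge> 0\<close> \<open>C \<ge> 0\<close> by simp
next
  case False
  have *: "norm d * \<rho> \<le> C * (r + \<rho>)\<^sup>2" if "\<rho> > 0" for \<rho>
  proof -
    have "d \<bullet> ((\<rho> / norm d) *\<^sub>R d) = norm d * \<rho>"
      using False by (simp add: power2_norm_eq_inner[symmetric] power2_eq_square)
    moreover have "norm ((\<rho> / norm d) *\<^sub>R d) = \<rho>" using False that by simp
    ultimately show ?thesis using le[of "(\<rho> / norm d) *\<^sub>R d"] by simp
  qed
  show ?thesis
  proof (cases "r = 0")
    case False
    then have "r > 0" using \<open>r \<ge> 0\<close> by simp
    have "norm d * r \<le> (4 * C * r) * r" using *[OF \<open>r > 0\<close>] by (simp add: power2_eq_square)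
    then show ?thesis using \<open>r > 0\<close> by simp
  next
    case True
    have le2: "norm d \<le> C * \<rho>" if "\<rho> > 0" for \<rho>
    proof -
      have "norm d * \<rho> \<le> (C * \<rho>) * \<rho>" using *[OF that] True by (simp add: power2_eq_square)
      then show ?thesis using that by simp
    qed
    have "C > 0" using le2[of 1] \<open>d \<noteq> 0\<close> by (simp add: less_le_trans[of 0 "norm d"])
    have "norm d \<le> 0"
    proof (rule field_le_epsilon)
      fix e :: real assume "e > 0"
      then show "norm d \<le> 0 + e" using le2[of "e / C"] \<open>C > 0\<close> by simp
    qed
    then show ?thesis using True by simp
  qed
qed

text \<open>\<open>W\<close> is the convex envelope of the paraboloids given by \<open>B\<close>, written as the supremum of all affine
  functions \<open>(P, c)\<close>, meaning \<open>c + P \<bullet> z\<close>, below them. Averaging the affine functions optimal at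
  \<open>z + h\<close> and \<open>z - h\<close>, shifted by \<open>\<plusminus>h\<close> and lowered by \<open>k |h|\<^sup>2\<close>, gives a competitor at \<open>z\<close>;
  hence \<open>W\<close> inherits the one-sided curvature bound of the paraboloids.\<close>
lemma C11_insertion:
  fixes A B :: "('a::euclidean_space \<times> real) set"
  assumes "A \<noteq> {}" "B \<noteq> {}" "k \<ge> 0"
    and le: "\<And>P c b d z. (P, c) \<in> A \<Longrightarrow> (b, d) \<in> B \<Longrightarrow> c + P \<bullet> z \<le> k * (norm z)\<^sup>2 + b \<bullet> z + d"
  obtains W G where
    "\<And>P c z. (P, c) \<in> A \<Longrightarrow> c + P \<bullet> z \<le> W z"
    "\<And>b d z. (b, d) \<in> B \<Longrightarrow> W z \<le> k * (norm z)\<^sup>2 + b \<bullet> z + d"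
    "\<And>y z. W z + G z \<bullet> (y - z) \<le> W y"
    "\<And>y z. W y \<le> W z + G z \<bullet> (y - z) + 2 * k * (norm (y - z))\<^sup>2"
proof -
  define Adm where "Adm = {Pc. \<forall>bd\<in>B. \<forall>z. snd Pc + fst Pc \<bullet> z \<le> k * (norm z)\<^sup>2 + fst bd \<bullet> z + snd bd}"
  have A_Adm: "A \<subseteq> Adm" using le by (auto simp: Adm_def)
  obtain a0 where a0: "a0 \<in> A" using \<open>A \<noteq> {}\<close> by blast
  obtain b0 where b0: "b0 \<in> B" using \<open>B \<noteq> {}\<close> by blast
  have "closed Adm"
  proof -
    have "closed {Pc :: 'a \<times> real. snd Pc + fst Pc \<bullet> z \<le> k * (norm z)\<^sup>2 + fst bd \<bullet> z + snd bd}" for z and bd :: "'a \<times> real"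
      by (intro closed_Collect_le continuous_intros)
    moreover have "Adm = (\<Inter>bd\<in>B. \<Inter>z. {Pc. snd Pc + fst Pc \<bullet> z \<le> k * (norm z)\<^sup>2 + fst bd \<bullet> z + snd bd})"
      by (auto simp: Adm_def)
    ultimately show ?thesis by (auto intro!: closed_INT)
  qed
  \<comment> \<open>The admissible affine functions at least as high as \<open>a0\<close> at
    \<open>z\<close> form a compact set: the paraboloid \<open>b0\<close> bounds them from above on
    the unit ball around \<open>z\<close>, and a steep one would exceed this bound one unit along
    its slope.\<close>
  have attained: "\<exists>Pc\<in>Adm. \<forall>Pc'\<in>Adm. snd Pc' + fst Pc' \<bullet> z \<le> snd Pc + fst Pc \<bullet> z" for z
  proof -
    define w0 where "w0 = snd a0 + fst a0 \<bullet> z"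
    define K where "K = Adm \<inter> {Pc. w0 \<le> snd Pc + fst Pc \<bullet> z}"
    define M where "M = k * (norm z + 1)\<^sup>2 + norm (fst b0) * (norm z + 1) + snd b0"
    have upper: "snd Pc + fst Pc \<bullet> y \<le> M" if "Pc \<in> Adm" "norm (y - z) \<le> 1" for Pc y
    proof -
      have ny: "norm y \<le> norm z + 1" using that(2) norm_triangle_ineq[of "y - z" z] by simp
      have "snd Pc + fst Pc \<bullet> y \<le> k * (norm y)\<^sup>2 + fst b0 \<bullet> y + snd b0"
        using that(1) b0 by (auto simp: Adm_def)
      also have "\<dots> \<le> k * (norm y)\<^sup>2 + norm (fst b0) * norm y + snd b0"
        using norm_cauchy_schwarz by auto
      also have "\<dots> \<le> M"
        unfolding M_def using ny \<open>k \<ge> 0\<close> by (intro add_mono mult_left_mono power_mono) auto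
      finally show ?thesis .
    qed
    have P_bound: "norm (fst Pc) \<le> M - w0" if "Pc \<in> K" for Pc
    proof (cases "fst Pc = 0")
      case True
      then show ?thesis using upper[of Pc z] that by (auto simp: K_def)
    next
      case False
      define y where "y = z + (1 / norm (fst Pc)) *\<^sub>R fst Pc"
      have "fst Pc \<bullet> y = fst Pc \<bullet> z + norm (fst Pc)"
        using False by (simp add: y_def inner_add_right power2_norm_eq_inner[symmetric] power2_eq_square)
      moreover have "norm (y - z) \<le> 1" using False by (simp add: y_def)
      ultimately show ?thesis using upper[of Pc y] that by (auto simp: K_def)
    qed
    have "norm Pc \<le> (M - w0) + (\<bar>M\<bar> + \<bar>w0\<bar> + (M - w0) * norm z)" if Pc: "Pc \<in> K" for Pc
    proof -
      have "\<bar>fst Pc \<bullet> z\<bar> \<le> (M - w0) * norm z"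
        using Cauchy_Schwarz_ineq2[of "fst Pc" z] mult_right_mono[OF P_bound[OF Pc], of "norm z"] by simp
      then have "\<bar>snd Pc\<bar> \<le> \<bar>M\<bar> + \<bar>w0\<bar> + (M - w0) * norm z"
        using upper[of Pc z] Pc by (auto simp: K_def)
      then show ?thesis using norm_Pair_le[of "fst Pc" "snd Pc"] P_bound[OF Pc] by simp
    qed
    then have "bounded K" unfolding bounded_iff by blast
    moreover have "closed K"
      unfolding K_def by (intro closed_Int \<open>closed Adm\<close> closed_Collect_le continuous_intros)
    ultimately have "compact K" by (simp add: compact_eq_bounded_closed)
    moreover have "a0 \<in> K" using a0 A_Adm by (auto simp: K_def w0_def)
    moreover have "continuous_on K (\<lambda>Pc. snd Pc + fst Pc \<bullet> z)" by (intro continuous_intros)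
    ultimately obtain Pc where Pc: "Pc \<in> K" "\<And>Pc'. Pc' \<in> K \<Longrightarrow> snd Pc' + fst Pc' \<bullet> z \<le> snd Pc + fst Pc \<bullet> z"
      using continuous_attains_sup[of K "\<lambda>Pc. snd Pc + fst Pc \<bullet> z"] by blast
    have "snd Pc' + fst Pc' \<bullet> z \<le> snd Pc + fst Pc \<bullet> z" if "Pc' \<in> Adm" for Pc'
    proof (cases "Pc' \<in> K")
      case False
      then show ?thesis using that Pc(1) by (auto simp: K_def)
    qed (use Pc in auto)
    moreover have "Pc \<in> Adm" using Pc(1) by (simp add: K_def)
    ultimately show ?thesis by blast
  qed
  then obtain sel where sel: "\<And>z. sel z \<in> Adm"
    "\<And>z Pc. Pc \<in> Adm \<Longrightarrow> snd Pc + fst Pc \<bullet> z \<le> snd (sel z) + fst (sel z) \<bullet> z"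
    by metis
  define G where "G = (\<lambda>z. fst (sel z))"
  define W where "W = (\<lambda>z. snd (sel z) + G z \<bullet> z)"
  have lower: "W z + G z \<bullet> (y - z) \<le> W y" for y z
    using sel(2)[OF sel(1)[of z], of y] by (simp add: W_def G_def inner_diff_right)
  have second: "W (z + h) + W (z - h) \<le> 2 * W z + 2 * k * (norm h)\<^sup>2" for z h
  proof -
    define P1 c1 P2 c2 where "P1 = G (z + h)" "c1 = snd (sel (z + h))" "P2 = G (z - h)" "c2 = snd (sel (z - h))"
    note defs = this
    define Pc where "Pc = ((1 / 2) *\<^sub>R (P1 + P2), (c1 + c2) / 2 + (P1 \<bullet> h - P2 \<bullet> h) / 2 - k * (norm h)\<^sup>2)"
    have "Pc \<in> Adm"
      unfolding Adm_def
    proof (intro CollectI ballI allI)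
      fix bd y assume bd: "bd \<in> B"
      have "c1 + P1 \<bullet> (y + h) \<le> k * (norm (y + h))\<^sup>2 + fst bd \<bullet> (y + h) + snd bd"
        using sel(1)[of "z + h"] bd unfolding Adm_def by (auto simp: defs G_def)
      moreover have "c2 + P2 \<bullet> (y - h) \<le> k * (norm (y - h))\<^sup>2 + fst bd \<bullet> (y - h) + snd bd"
        using sel(1)[of "z - h"] bd unfolding Adm_def by (auto simp: defs G_def)
      \<comment> \<open>By the parallelogram identity the mean of the two shifted paraboloids
        exceeds the original one by exactly \<open>k * (norm h)\<^sup>2\<close>, the amount
        subtracted in \<open>Pc\<close>.\<close>
      moreover have "k * (norm (y + h))\<^sup>2 + k * (norm (y - h))\<^sup>2 = 2 * (k * (norm y)\<^sup>2) + 2 * (k * (norm h)\<^sup>2)"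
        by (simp add: power2_norm_eq_inner inner_add_left inner_add_right inner_diff_left inner_diff_right algebra_simps)
      ultimately show "snd Pc + fst Pc \<bullet> y \<le> k * (norm y)\<^sup>2 + fst bd \<bullet> y + snd bd"
        by (simp add: Pc_def inner_add_left inner_add_right inner_diff_right field_simps)
    qed
    from sel(2)[OF this, of z]
    have "(c1 + P1 \<bullet> (z + h)) + (c2 + P2 \<bullet> (z - h)) \<le> 2 * W z + 2 * k * (norm h)\<^sup>2"
      by (simp add: W_def G_def Pc_def inner_add_left inner_add_right inner_diff_right field_simps)
    then show ?thesis unfolding defs by (simp add: W_def)
  qed
  show ?thesis
  proof (rule that[of W G])
    show "c + P \<bullet> z \<le> W z" if "(P, c) \<in> A" for P c z
      using sel(2)[of "(P, c)" z] that A_Adm by (auto simp: W_def G_def)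
    show "W z \<le> k * (norm z)\<^sup>2 + b \<bullet> z + d" if "(b, d) \<in> B" for b d z
      using sel(1)[of z] that by (force simp: W_def G_def Adm_def)
    show "W z + G z \<bullet> (y - z) \<le> W y" for y z by (rule lower)
    \<comment> \<open>The reflected point \<open>z - (y - z)\<close> in the second difference is
      estimated from below by the tangent at \<open>z\<close>.\<close>
    show "W y \<le> W z + G z \<bullet> (y - z) + 2 * k * (norm (y - z))\<^sup>2" for y z
      using second[of z "y - z"] lower[of z "z - (y - z)"] by (simp add: inner_diff_right)
  qed
qed

text \<open>At \<open>y + s\<close> the tangent plane from \<open>z\<close> lies below the upper
  paraboloid with vertex data at \<open>y\<close>. Estimating \<open>W y\<close> by the upper
  paraboloid from \<open>z\<close> then bounds \<open>(G z - G y) \<bullet> s\<close> by two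
  squares.\<close>

lemma gradient_lipschitz:
  fixes W :: "'a::real_inner \<Rightarrow> real"
  assumes lower: "\<And>y z. W z + G z \<bullet> (y - z) \<le> W y"
    and upper: "\<And>y z. W y \<le> W z + G z \<bullet> (y - z) + C * (norm (y - z))\<^sup>2"
    and "C \<ge> 0"
  shows "norm (G y - G z) \<le> 4 * C * norm (y - z)"
proof -
  have "norm (G z - G y) \<le> 4 * C * norm (y - z)"
  proof (rule norm_le_if_inner_le_quadratic)
    fix s
    have "(G z - G y) \<bullet> s \<le> C * (norm (y - z))\<^sup>2 + C * (norm s)\<^sup>2"
      using lower[of z "y + s"] upper[of "y + s" y] upper[of y z]
      by (simp add: inner_diff_left inner_diff_right inner_add_right)
    also have "\<dots> \<le> C * (norm (y - z) + norm s)\<^sup>2"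
      using \<open>C \<ge> 0\<close> by (simp add: power2_sum distrib_left)
    finally show "(G z - G y) \<bullet> s \<le> C * (norm (y - z) + norm s)\<^sup>2" .
  qed (use \<open>C \<ge> 0\<close> in auto)
  then show ?thesis by (simp add: norm_minus_commute)
qed

text \<open>\<open>G\<close> is differentiable at the single point \<open>z\<close>, so
  \<open>W\<close> need not be \<open>C^2\<close> near it. The mean value theorem is applied to the
  remainder along a segment, whose derivative is controlled by the linearisation of \<open>G\<close>
  at \<open>z\<close>.\<close>

lemma second_order_expansion:
  fixes W :: "'a::real_inner \<Rightarrow> real" and G D :: "'a \<Rightarrow> 'a"
  assumes deriv: "\<And>y. (W has_derivative (\<lambda>h. G y \<bullet> h)) (at y)"
    and D: "(G has_derivative D) (at z)" and "e > 0"
  obtains r where "r > 0"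
    "\<And>h. norm h < r \<Longrightarrow> \<bar>W (z + h) - W z - G z \<bullet> h - (D h \<bullet> h) / 2\<bar> \<le> e * (norm h)\<^sup>2"
proof -
  interpret D: bounded_linear D using D by (rule has_derivative_bounded_linear)
  obtain r where r: "r > 0" "\<And>y. norm (y - z) < r \<Longrightarrow> norm (G y - G z - D (y - z)) \<le> e * norm (y - z)"
    using D \<open>e > 0\<close> by (auto simp: has_derivative_at_alt)
  show ?thesis
  proof (rule that[OF r(1)])
    fix h :: 'a assume h: "norm h < r"
    define \<phi> where "\<phi> = (\<lambda>s. W (z + s *\<^sub>R h) - s * (G z \<bullet> h) - s\<^sup>2 * (D h \<bullet> h) / 2)"
    have "((\<lambda>s. W (z + s *\<^sub>R h)) has_derivative (\<lambda>t. G (z + s *\<^sub>R h) \<bullet> (t *\<^sub>R h))) (at s)" for s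
      by (rule has_derivative_compose[of "\<lambda>s. z + s *\<^sub>R h" "\<lambda>t. t *\<^sub>R h", OF _ deriv])
        (auto intro!: derivative_eq_intros)
    then have "((\<lambda>s. W (z + s *\<^sub>R h)) has_real_derivative G (z + s *\<^sub>R h) \<bullet> h) (at s)" for s
      unfolding has_field_derivative_def by (rule has_derivative_eq_rhs) (auto simp: fun_eq_iff)
    then have d: "(\<phi> has_real_derivative (G (z + s *\<^sub>R h) - G z - s *\<^sub>R D h) \<bullet> h) (at s)" for s
      unfolding \<phi>_def by (auto intro!: derivative_eq_intros simp: inner_diff_left)
    obtain s where s: "0 < s" "s < 1" "\<phi> 1 - \<phi> 0 = (1 - 0) * ((G (z + s *\<^sub>R h) - G z - s *\<^sub>R D h) \<bullet> h)"
      using MVT2[of 0 1 \<phi> "\<lambda>s. (G (z + s *\<^sub>R h) - G z - s *\<^sub>R D h) \<bullet> h"] d by auto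
    have "norm (s *\<^sub>R h) \<le> norm h" using s by (simp add: mult_left_le_one_le)
    then have "norm (G (z + s *\<^sub>R h) - G z - s *\<^sub>R D h) \<le> e * norm (s *\<^sub>R h)"
      using r(2)[of "z + s *\<^sub>R h"] h by (simp add: D.scaleR)
    also have "\<dots> \<le> e * norm h" using \<open>norm (s *\<^sub>R h) \<le> norm h\<close> \<open>e > 0\<close> by (intro mult_left_mono) auto
    finally have "norm (G (z + s *\<^sub>R h) - G z - s *\<^sub>R D h) \<le> e * norm h" .
    then have "\<bar>(G (z + s *\<^sub>R h) - G z - s *\<^sub>R D h) \<bullet> h\<bar> \<le> e * norm h * norm h"
      by (intro order_trans[OF Cauchy_Schwarz_ineq2] mult_right_mono) auto
    then show "\<bar>W (z + h) - W z - G z \<bullet> h - (D h \<bullet> h) / 2\<bar> \<le> e * (norm h)\<^sup>2"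
      using s(3) by (simp add: \<phi>_def power2_eq_square algebra_simps)
  qed
qed

section \<open>Semicontinuous functions and doubling of variables\<close>

lemma usc_on_attains_sup:
  fixes f :: "'a::metric_space \<Rightarrow> real"
  assumes "compact S" "S \<noteq> {}" "usc_on S f"
  obtains x where "x \<in> S" "\<And>y. y \<in> S \<Longrightarrow> f y \<le> f x"
proof -
  have "\<exists>x\<in>S. \<forall>y\<in>S. f y \<le> f x"
  proof (rule ccontr)
    assume no: "\<not> ?thesis"
    have "\<exists>d>0. \<exists>w\<in>S. \<forall>y\<in>S. dist y x < d \<longrightarrow> f y < f w" if x: "x \<in> S" for x
    proof -
      obtain w where w: "w \<in> S" "f x < f w" using no x by (force simp: not_le)
      then obtain d where "d > 0" "\<forall>y\<in>S. dist y x < d \<longrightarrow> f y < f x + (f w - f x)"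
        using \<open>usc_on S f\<close> x unfolding usc_on_def by (metis diff_gt_0_iff_gt)
      then show ?thesis using w(1) by (intro exI[of _ d]) auto
    qed
    then obtain d w where dw: "\<And>x. x \<in> S \<Longrightarrow> d x > 0 \<and> w x \<in> S \<and> (\<forall>y\<in>S. dist y x < d x \<longrightarrow> f y < f (w x))"
      by metis
    have "S \<subseteq> \<Union>((\<lambda>x. ball x (d x)) ` S)" using dw by force
    then obtain T where T: "T \<subseteq> S" "finite T" "S \<subseteq> \<Union>((\<lambda>x. ball x (d x)) ` T)"
      using compactE_image[OF \<open>compact S\<close>, of S "\<lambda>x. ball x (d x)"] by auto
    then have "T \<noteq> {}" using \<open>S \<noteq> {}\<close> by auto
    define M where "M = Max ((\<lambda>x. f (w x)) ` T)"
    have "M \<in> (\<lambda>x. f (w x)) ` T" unfolding M_def using T(2) \<open>T \<noteq> {}\<close> by (intro Max_in) auto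
    then obtain t where t: "t \<in> T" "M = f (w t)" by auto
    then have "w t \<in> S" using dw T(1) by auto
    then obtain s where s: "s \<in> T" "dist s (w t) < d s" using T(3) by auto
    then have "f (w t) < f (w s)" using dw[of s] T(1) \<open>w t \<in> S\<close> by (auto simp: dist_commute)
    moreover have "f (w s) \<le> M" unfolding M_def using T(2) s(1) by auto
    ultimately show False using t by simp
  qed
  then show ?thesis using that by blast
qed

lemma usc_on_add:
  assumes "usc_on S f" "usc_on S g" shows "usc_on S (\<lambda>x. f x + g x)"
  unfolding usc_on_def
proof (intro ballI allI impI)
  fix x e assume "x \<in> S" "(e::real) > 0"
  obtain d1 where d1: "d1 > 0" "\<forall>y\<in>S. dist y x < d1 \<longrightarrow> f y < f x + e / 2"
    using assms(1) \<open>x \<in> S\<close> \<open>e > 0\<close> unfolding usc_on_def by (meson half_gt_zero)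
  obtain d2 where d2: "d2 > 0" "\<forall>y\<in>S. dist y x < d2 \<longrightarrow> g y < g x + e / 2"
    using assms(2) \<open>x \<in> S\<close> \<open>e > 0\<close> unfolding usc_on_def by (meson half_gt_zero)
  show "\<exists>d>0. \<forall>y\<in>S. dist y x < d \<longrightarrow> f y + g y < f x + g x + e"
    using d1 d2 by (intro exI[of _ "min d1 d2"]) fastforce
qed

lemma usc_on_continuous:
  fixes f :: "'a::metric_space \<Rightarrow> real"
  assumes "continuous_on S f" shows "usc_on S f"
  unfolding usc_on_def
proof (intro ballI allI impI)
  fix x e assume "x \<in> S" "(e::real) > 0"
  then obtain d where "d > 0" "\<And>y. y \<in> S \<Longrightarrow> dist y x < d \<Longrightarrow> dist (f y) (f x) < e"
    using assms unfolding continuous_on_iff by blast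
  then show "\<exists>d>0. \<forall>y\<in>S. dist y x < d \<longrightarrow> f y < f x + e"
    by (intro exI[of _ d]) (auto simp: dist_real_def abs_less_iff algebra_simps)
qed

lemma usc_on_compose_nonexpansive:
  assumes "usc_on S f" "\<And>x. x \<in> T \<Longrightarrow> g x \<in> S" "\<And>x y. dist (g x) (g y) \<le> dist x y"
  shows "usc_on T (\<lambda>x. f (g x))"
  unfolding usc_on_def
proof (intro ballI allI impI)
  fix x e assume "x \<in> T" "(e::real) > 0"
  then obtain d where "d > 0" "\<And>y. y \<in> S \<Longrightarrow> dist y (g x) < d \<Longrightarrow> f y < f (g x) + e"
    using assms(1,2) unfolding usc_on_def by blast
  moreover have "dist (g y) (g x) < d" if "dist y x < d" for y
    using assms(3)[of y x] that by simp
  ultimately show "\<exists>d>0. \<forall>y\<in>T. dist y x < d \<longrightarrow> f (g y) < f (g x) + e"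
    using assms(2) by (intro exI[of _ d]) auto
qed

lemma usc_on_uminus: "lsc_on S f \<Longrightarrow> usc_on S (\<lambda>x. - f x)"
  unfolding usc_on_def lsc_on_def by fastforce

text \<open>The maximum over \<open>z\<close> of the left hand side is attained at \<open>z = (x + y) / 2 - q / (2 * k)\<close>;
  this eliminates the non-compact variable \<open>z\<close>.\<close>
lemma doubling_identity:
  fixes x y z q :: "'a::real_inner"
  assumes "k > 0"
  shows "k / 2 * (norm (x - z))\<^sup>2 + k / 2 * (norm (y - z))\<^sup>2 + q \<bullet> z =
    k / 4 * (norm (x - y))\<^sup>2 + q \<bullet> (x + y) / 2 - (norm q)\<^sup>2 / (4 * k)
      + k * (norm (z - ((1 / 2) *\<^sub>R (x + y) - (1 / (2 * k)) *\<^sub>R q)))\<^sup>2"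
proof -
  define w where "w = z - (1 / 2) *\<^sub>R (x + y)"
  have z: "z = w + (1 / 2) *\<^sub>R (x + y)" by (simp add: w_def)
  have "(norm (x - z))\<^sup>2 + (norm (y - z))\<^sup>2 = (norm (x - y))\<^sup>2 / 2 + 2 * (norm w)\<^sup>2"
    unfolding z power2_norm_eq_inner by (simp add: inner_simps inner_commute field_simps)
  then have "k / 2 * ((norm (x - z))\<^sup>2 + (norm (y - z))\<^sup>2) = k / 2 * ((norm (x - y))\<^sup>2 / 2 + 2 * (norm w)\<^sup>2)"
    by (rule arg_cong)
  then have e1: "k / 2 * (norm (x - z))\<^sup>2 + k / 2 * (norm (y - z))\<^sup>2 = k / 4 * (norm (x - y))\<^sup>2 + k * (norm w)\<^sup>2"
    by (simp add: algebra_simps)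
  have e2: "z - ((1 / 2) *\<^sub>R (x + y) - (1 / (2 * k)) *\<^sub>R q) = w + (1 / (2 * k)) *\<^sub>R q"
    by (simp add: w_def)
  have "(norm (w + (1 / (2 * k)) *\<^sub>R q))\<^sup>2 = (norm w)\<^sup>2 + (q \<bullet> w) / k + (norm q)\<^sup>2 / (2 * k)\<^sup>2"
    unfolding power2_norm_eq_inner
    by (simp add: inner_add_left inner_add_right inner_commute[of w q] power2_eq_square add_divide_distrib)
  then have e3: "k * (norm (w + (1 / (2 * k)) *\<^sub>R q))\<^sup>2 = k * (norm w)\<^sup>2 + q \<bullet> w + (norm q)\<^sup>2 / (4 * k)"
    using assms by (simp add: distrib_left power2_eq_square)
  have e4: "q \<bullet> z = q \<bullet> w + q \<bullet> (x + y) / 2" unfolding z by (simp add: inner_add_right)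
  show ?thesis unfolding e2 e3 e4 using e1 by linarith
qed

lemma Lipschitz_imp_derivative_bound:
  fixes G :: "'a::real_normed_vector \<Rightarrow> 'b::real_normed_vector"
  assumes lip: "\<And>x y. norm (G x - G y) \<le> L * norm (x - y)" and D: "(G has_derivative D) (at z)"
  shows "norm (D h) \<le> L * norm h"
proof (cases "h = 0")
  case True
  then show ?thesis using D has_derivative_bounded_linear linear_simps(3) by fastforce
next
  case False
  interpret D: bounded_linear D using D by (rule has_derivative_bounded_linear)
  have le: "norm (D h) \<le> L * norm h + e * norm h" if "e > 0" for e
  proof -
    obtain r where r: "r > 0" "\<And>y. norm (y - z) < r \<Longrightarrow> norm (G y - G z - D (y - z)) \<le> e * norm (y - z)"
      using D \<open>e > 0\<close> by (auto simp: has_derivative_at_alt)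
    define t where "t = r / (2 * norm h)"
    have t: "t > 0" "norm (t *\<^sub>R h) < r" using r(1) False by (auto simp: t_def)
    have "norm (D (t *\<^sub>R h)) \<le> norm (G (z + t *\<^sub>R h) - G z) + norm (G (z + t *\<^sub>R h) - G z - D (t *\<^sub>R h))"
      using norm_triangle_ineq4[of "G (z + t *\<^sub>R h) - G z" "G (z + t *\<^sub>R h) - G z - D (t *\<^sub>R h)"] by simp
    also have "\<dots> \<le> L * norm (t *\<^sub>R h) + e * norm (t *\<^sub>R h)"
      using lip[of "z + t *\<^sub>R h" z] r(2)[of "z + t *\<^sub>R h"] t(2) by simp
    finally have "t * norm (D h) \<le> t * (L * norm h + e * norm h)"
      using t(1) by (simp add: D.scaleR algebra_simps)
    then show ?thesis using t(1) by simp
  qed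
  show ?thesis
  proof (rule field_le_epsilon)
    fix e :: real assume "e > 0"
    then show "norm (D h) \<le> L * norm h + e" using le[of "e / norm h"] False by simp
  qed
qed

text \<open>Instead of two ordered matrices both expansions contain the same \<open>D\<close>; the
  price is the tilt \<open>q\<close>, by which the gradients differ. The coefficient
  \<open>k / 4\<close> is what optimisation over \<open>z\<close> leaves of two penalties with
  \<open>k / 2\<close>. The bound \<open>9 * k\<close> is the Lipschitz constant
  \<open>8 * k\<close> of the gradient of \<open>W\<close>, plus \<open>k\<close> for the quadratic
  that was added to make the lower regularisation convex.\<close>

theorem theorem_on_sums:
  fixes u v :: "'a::euclidean_space \<Rightarrow> real"
  assumes Q: "compact Q" "Q \<noteq> {}" and u: "usc_on Q u" and v: "lsc_on Q v"
    and "k > 0" "\<theta> > 0"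
  obtains x y p q D where "x \<in> Q" "y \<in> Q" "norm q < \<theta>" "linear D" "\<And>h. norm (D h) \<le> 9 * k * norm h"
    "\<And>e. e > 0 \<Longrightarrow> \<exists>r>0. \<forall>h. norm h < r \<longrightarrow> x + h \<in> Q \<longrightarrow>
        u (x + h) \<le> u x + p \<bullet> h + (D h \<bullet> h) / 2 + e * (norm h)\<^sup>2"
    "\<And>e. e > 0 \<Longrightarrow> \<exists>r>0. \<forall>h. norm h < r \<longrightarrow> y + h \<in> Q \<longrightarrow>
        v (y + h) \<ge> v y + (p - q) \<bullet> h + (D h \<bullet> h) / 2 - e * (norm h)\<^sup>2"
    "\<And>x' y'. x' \<in> Q \<Longrightarrow> y' \<in> Q \<Longrightarrow>
        u x' - v y' - k / 4 * (norm (x' - y'))\<^sup>2 - q \<bullet> (x' + y') / 2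
        \<le> u x - v y - k / 4 * (norm (x - y))\<^sup>2 - q \<bullet> (x + y) / 2"
proof -
  define \<Psi> where "\<Psi> = (\<lambda>q x y. u x - v y - k / 4 * (norm (x - y))\<^sup>2 - q \<bullet> (x + y) / 2)"
  have "\<exists>x y. x \<in> Q \<and> y \<in> Q \<and> (\<forall>x'\<in>Q. \<forall>y'\<in>Q. \<Psi> q x' y' \<le> \<Psi> q x y)" for q
  proof -
    have "usc_on (Q \<times> Q) (\<lambda>w. u (fst w))"
      by (rule usc_on_compose_nonexpansive[OF u]) (auto intro: dist_fst_le)
    moreover have "usc_on (Q \<times> Q) (\<lambda>w. - v (snd w))"
      by (rule usc_on_compose_nonexpansive[OF usc_on_uminus[OF v]]) (auto intro: dist_snd_le)
    moreover have "continuous_on (Q \<times> Q) (\<lambda>w. - (k / 4 * (norm (fst w - snd w))\<^sup>2) - q \<bullet> (fst w + snd w) / 2)"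
      by (intro continuous_intros) auto
    ultimately have "usc_on (Q \<times> Q) (\<lambda>w. u (fst w) + - v (snd w) +
        (- (k / 4 * (norm (fst w - snd w))\<^sup>2) - q \<bullet> (fst w + snd w) / 2))"
      by (rule usc_on_add[OF usc_on_add usc_on_continuous])
    then have "usc_on (Q \<times> Q) (\<lambda>w. \<Psi> q (fst w) (snd w))" by (simp add: \<Psi>_def algebra_simps)
    from usc_on_attains_sup[OF compact_Times[OF Q(1) Q(1)] _ this] obtain w where
      "w \<in> Q \<times> Q" "\<And>w'. w' \<in> Q \<times> Q \<Longrightarrow> \<Psi> q (fst w') (snd w') \<le> \<Psi> q (fst w) (snd w)"
      using Q(2) by blast
    then show ?thesis by (intro exI[of _ "fst w"] exI[of _ "snd w"]) auto
  qed
  then obtain X Y where X: "\<And>q. X q \<in> Q" and Y: "\<And>q. Y q \<in> Q"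
    and max: "\<And>q x' y'. x' \<in> Q \<Longrightarrow> y' \<in> Q \<Longrightarrow> \<Psi> q x' y' \<le> \<Psi> q (X q) (Y q)"
    by metis
  define Z where "Z = (\<lambda>q. (1 / 2) *\<^sub>R (X q + Y q) - (1 / (2 * k)) *\<^sub>R q)"
  \<comment> \<open>By \<open>\<omega>_le\<close> and \<open>\<omega>_eq\<close>, \<open>m q\<close>
    is the maximum of \<open>\<omega> x y z - q \<bullet> z\<close> over \<open>x\<close>,
    \<open>y\<close> in \<open>Q\<close> and all \<open>z\<close>, attained at \<open>X q\<close>,
    \<open>Y q\<close>, \<open>Z q\<close>.\<close>
  define m where "m = (\<lambda>q. \<Psi> q (X q) (Y q) + (norm q)\<^sup>2 / (4 * k))"
  define \<omega> where "\<omega> = (\<lambda>x y z. u x - v y - (k / 2 * (norm (x - z))\<^sup>2 + k / 2 * (norm (y - z))\<^sup>2))"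
  have \<omega>_le: "\<omega> x y z \<le> m q + q \<bullet> z" if "x \<in> Q" "y \<in> Q" for x y z q
  proof -
    have "0 \<le> k * (norm (z - ((1 / 2) *\<^sub>R (x + y) - (1 / (2 * k)) *\<^sub>R q)))\<^sup>2" using \<open>k > 0\<close> by simp
    then show ?thesis
      using doubling_identity[OF \<open>k > 0\<close>, of x z y q] max[OF that, of q]
      unfolding m_def \<omega>_def \<Psi>_def by linarith
  qed
  have \<omega>_eq: "\<omega> (X q) (Y q) (Z q) = m q + q \<bullet> Z q" for q
    using doubling_identity[OF \<open>k > 0\<close>, of "X q" "Z q" "Y q" q]
    unfolding m_def \<omega>_def \<Psi>_def Z_def by simp
  have Zq: "(1 / 2) *\<^sub>R (X q + Y q) - (1 / (2 * k)) *\<^sub>R q = Z q" for q by (simp add: Z_def)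
  have \<omega>_shift: "\<omega> (X q) (Y q) t = \<omega> (X q) (Y q) (Z q) + q \<bullet> (t - Z q) - k * (norm (t - Z q))\<^sup>2" for q t
    using doubling_identity[OF \<open>k > 0\<close>, of "X q" "Z q" "Y q" q] doubling_identity[OF \<open>k > 0\<close>, of "X q" t "Y q" q]
    unfolding \<omega>_def Zq by (simp add: inner_diff_right)
  \<comment> \<open>With \<open>X q\<close>, \<open>Y q\<close> fixed, \<open>\<omega>\<close> is a
    paraboloid of slope \<open>q\<close> at \<open>Z q\<close>. It lies below the affine function of
    slope \<open>q'\<close>, which at \<open>Z q'\<close> is in turn below the one of slope
    \<open>q\<close>. Nearby contact points therefore force nearby slopes.\<close>
  have inj_bound: "norm (q - q') \<le> 4 * k * norm (Z q - Z q')" for q q'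
  proof (rule norm_le_if_inner_le_quadratic)
    fix s
    have "\<omega> (X q) (Y q) (Z q' + s) \<le> m q' + q' \<bullet> (Z q' + s)" using \<omega>_le X Y by blast
    moreover have "m q' + q' \<bullet> Z q' \<le> m q + q \<bullet> Z q'" using \<omega>_le[OF X Y, of q' q' "Z q'" q] \<omega>_eq[of q'] by simp
    ultimately have "(q - q') \<bullet> s \<le> k * (norm (Z q' + s - Z q))\<^sup>2"
      using \<omega>_shift[of q "Z q' + s"] \<omega>_eq[of q]
      by (simp add: inner_diff_left inner_diff_right inner_add_right)
    also have "norm (Z q' + s - Z q) \<le> norm (Z q - Z q') + norm s"
      using norm_triangle_ineq[of "Z q' - Z q" s] by (simp add: norm_minus_commute algebra_simps)
    then have "k * (norm (Z q' + s - Z q))\<^sup>2 \<le> k * (norm (Z q - Z q') + norm s)\<^sup>2"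
      using \<open>k > 0\<close> by (intro mult_left_mono power_mono) auto
    finally show "(q - q') \<bullet> s \<le> k * (norm (Z q - Z q') + norm s)\<^sup>2" .
  qed (use \<open>k > 0\<close> in auto)
  \<comment> \<open>After adding \<open>k / 2 * (norm z)\<^sup>2\<close>, the sup-convolution of
    \<open>u\<close> is the supremum of the affine functions in \<open>A\<close>, and the
    inf-convolution of \<open>v\<close> plus \<open>m q + q \<bullet> z\<close> is the infimum of
    the paraboloids in \<open>B\<close> for that \<open>q\<close>. All small \<open>q\<close> enter
    \<open>B\<close> together.\<close>
  define A where "A = {(k *\<^sub>R x, u x - k / 2 * (norm x)\<^sup>2) |x. x \<in> Q}"
  define B where "B = {(q - k *\<^sub>R y, v y + k / 2 * (norm y)\<^sup>2 + m q) |y q. y \<in> Q \<and> norm q < \<theta>}"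
  have sq: "k / 2 * (norm (x - z))\<^sup>2 = k / 2 * (norm x)\<^sup>2 - k * (x \<bullet> z) + k / 2 * (norm z)\<^sup>2" for x z :: 'a
    unfolding power2_norm_eq_inner by (simp add: inner_simps inner_commute algebra_simps)
  have "A \<noteq> {}" using Q(2) by (auto simp: A_def)
  moreover have "(0 - k *\<^sub>R X 0, v (X 0) + k / 2 * (norm (X 0))\<^sup>2 + m 0) \<in> B"
    unfolding B_def by (intro CollectI exI[of _ "X 0"] exI[of _ "0::'a"]) (use X \<open>\<theta> > 0\<close> in auto)
  then have "B \<noteq> {}" by auto
  moreover have "c + P \<bullet> z \<le> k * (norm z)\<^sup>2 + b \<bullet> z + d" if A': "(P, c) \<in> A" and B': "(b, d) \<in> B" for P c b d z
  proof -
    obtain x where x: "x \<in> Q" "P = k *\<^sub>R x" "c = u x - k / 2 * (norm x)\<^sup>2" using A' by (auto simp: A_def)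
    obtain y q where y: "y \<in> Q" "b = q - k *\<^sub>R y" "d = v y + k / 2 * (norm y)\<^sup>2 + m q"
      using B' by (auto simp: B_def)
    have "\<omega> x y z \<le> m q + q \<bullet> z" using \<omega>_le x(1) y(1) by blast
    then show ?thesis unfolding \<omega>_def sq x y by (simp add: inner_diff_left)
  qed
  ultimately obtain W G where
    WA: "\<And>P c z. (P, c) \<in> A \<Longrightarrow> c + P \<bullet> z \<le> W z" and
    WB: "\<And>b d z. (b, d) \<in> B \<Longrightarrow> W z \<le> k * (norm z)\<^sup>2 + b \<bullet> z + d" and
    lower: "\<And>y z. W z + G z \<bullet> (y - z) \<le> W y" and
    upper: "\<And>y z. W y \<le> W z + G z \<bullet> (y - z) + 2 * k * (norm (y - z))\<^sup>2"
    using C11_insertion[of A B k] \<open>k > 0\<close> by (metis less_imp_le)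
  have W_low: "u x - k / 2 * (norm (x - z))\<^sup>2 + k / 2 * (norm z)\<^sup>2 \<le> W z" if "x \<in> Q" for x z
  proof -
    have "(k *\<^sub>R x, u x - k / 2 * (norm x)\<^sup>2) \<in> A" using that by (auto simp: A_def)
    from WA[OF this, of z] show ?thesis unfolding sq by simp
  qed
  have W_up: "W z \<le> v y + k / 2 * (norm (y - z))\<^sup>2 + k / 2 * (norm z)\<^sup>2 + m q + q \<bullet> z"
    if "y \<in> Q" "norm q < \<theta>" for y z q
  proof -
    have "(q - k *\<^sub>R y, v y + k / 2 * (norm y)\<^sup>2 + m q) \<in> B" using that by (auto simp: B_def)
    from WB[OF this, of z] show ?thesis unfolding sq by (simp add: inner_diff_left)
  qed
  have G_lip: "norm (G x - G y) \<le> 8 * k * norm (x - y)" for x y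
    using gradient_lipschitz[OF lower upper, of x y] \<open>k > 0\<close> by simp
  have W_deriv: "(W has_derivative (\<lambda>h. G z \<bullet> h)) (at z)" for z
    unfolding has_derivative_at_alt
  proof (intro conjI allI impI)
    show "bounded_linear ((\<bullet>) (G z))" by (rule bounded_linear_inner_right)
    fix e :: real assume "e > 0"
    have "norm (W y - W z - G z \<bullet> (y - z)) \<le> e * norm (y - z)" if y: "norm (y - z) < e / (2 * k)" for y
    proof -
      have "2 * k * norm (y - z) \<le> e" using y \<open>k > 0\<close> by (simp add: field_simps)
      then have "2 * k * norm (y - z) * norm (y - z) \<le> e * norm (y - z)" by (intro mult_right_mono) auto
      then show ?thesis using lower[of z y] upper[of y z] by (simp add: power2_eq_square)
    qed
    then show "\<exists>d>0. \<forall>y. norm (y - z) < d \<longrightarrow> norm (W y - W z - G z \<bullet> (y - z)) \<le> e * norm (y - z)"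
      using \<open>e > 0\<close> \<open>k > 0\<close> by (intro exI[of _ "e / (2 * k)"]) auto
  qed
  \<comment> \<open>The contact points fill a non-negligible set, because \<open>Z\<close> has a Lipschitz left inverse;
    hence \<open>G\<close> is differentiable at one of them.\<close>
  have "\<not> negligible (Z ` ball 0 \<theta>)"
  proof
    assume neg: "negligible (Z ` ball 0 \<theta>)"
    have "inj Z" using inj_bound by (metis diff_self injI mult_zero_right norm_le_zero_iff norm_zero right_minus_eq)
    have "negligible (inv Z ` Z ` ball 0 \<theta>)"
    proof (rule negligible_locally_Lipschitz_image[OF _ neg])
      fix z assume "z \<in> Z ` ball 0 \<theta>"
      show "\<exists>T B. open T \<and> z \<in> T \<and>
          (\<forall>y\<in>Z ` ball 0 \<theta> \<inter> T. norm (inv Z y - inv Z z) \<le> B * norm (y - z))"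
        using \<open>z \<in> _\<close> inj_bound \<open>inj Z\<close> by (intro exI[of _ UNIV] exI[of _ "4 * k"]) auto
    qed simp
    then have "negligible (ball (0::'a) \<theta>)" using \<open>inj Z\<close> by (simp add: image_inv_f_f)
    then show False using \<open>\<theta> > 0\<close> open_not_negligible[of "ball (0::'a) \<theta>"] by auto
  qed
  then obtain q where q: "norm q < \<theta>" "G differentiable (at (Z q))"
    using Rademacher[OF G_lip] by (metis (mono_tags, lifting) imageE mem_Collect_eq mem_ball_0 negligible_subset subsetI)
  then obtain D0 where D0: "(G has_derivative D0) (at (Z q))" by (auto simp: differentiable_def)
  interpret D0: bounded_linear D0 using D0 by (rule has_derivative_bounded_linear)
  define z x y where "z = Z q" "x = X q" "y = Y q"
  note zxy = this
  have xy: "x \<in> Q" "y \<in> Q" using X Y by (auto simp: zxy)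
  define p where "p = G z - k *\<^sub>R z"
  define D where "D = (\<lambda>h. D0 h - k *\<^sub>R h)"
  \<comment> \<open>At a contact point the lower and the upper bound of \<open>W\<close> coincide,
    so \<open>W\<close> touches both.\<close>
  have "\<omega> x y z = m q + q \<bullet> z" using \<omega>_eq by (simp add: zxy)
  then have Wz: "W z = u x - k / 2 * (norm (x - z))\<^sup>2 + k / 2 * (norm z)\<^sup>2"
    "W z = v y + k / 2 * (norm (y - z))\<^sup>2 + k / 2 * (norm z)\<^sup>2 + m q + q \<bullet> z"
    using W_low[OF xy(1), of z] W_up[OF xy(2) q(1), of z] unfolding \<omega>_def by linarith+
  have expand: "\<exists>r>0. \<forall>h. norm h < r \<longrightarrow>
      \<bar>W (z + h) - k / 2 * (norm (z + h))\<^sup>2 - (W z - k / 2 * (norm z)\<^sup>2 + p \<bullet> h + (D h \<bullet> h) / 2)\<bar> \<le> e * (norm h)\<^sup>2"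
    if e: "e > 0" for e
  proof -
    obtain r where r: "r > 0"
      "\<And>h. norm h < r \<Longrightarrow> \<bar>W (z + h) - W z - G z \<bullet> h - (D0 h \<bullet> h) / 2\<bar> \<le> e * (norm h)\<^sup>2"
      using second_order_expansion[OF W_deriv D0 e] unfolding zxy by blast
    have eq: "W (z + h) - k / 2 * (norm (z + h))\<^sup>2 - (W z - k / 2 * (norm z)\<^sup>2 + p \<bullet> h + (D h \<bullet> h) / 2)
        = W (z + h) - W z - G z \<bullet> h - (D0 h \<bullet> h) / 2" for h
      unfolding p_def D_def power2_norm_eq_inner by (simp add: inner_simps inner_commute field_simps)
    show ?thesis unfolding eq using r by blast
  qed
  show ?thesis
  proof (rule that[of x y q D p])
    show "x \<in> Q" "y \<in> Q" "norm q < \<theta>" using xy q by auto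
    show "linear D"
      unfolding D_def
      by (intro linear_compose_sub D0.linear_axioms linear_compose_scale_right linear_id[unfolded id_def])
    show "norm (D h) \<le> 9 * k * norm h" for h
    proof -
      have "norm (D h) \<le> norm (D0 h) + norm (k *\<^sub>R h)" unfolding D_def by (rule norm_triangle_ineq4)
      then show ?thesis using Lipschitz_imp_derivative_bound[OF G_lip D0, of h] \<open>k > 0\<close> by simp
    qed
    show "\<exists>r>0. \<forall>h. norm h < r \<longrightarrow> x + h \<in> Q \<longrightarrow> u (x + h) \<le> u x + p \<bullet> h + (D h \<bullet> h) / 2 + e * (norm h)\<^sup>2"
      if e: "e > 0" for e
    proof -
      \<comment> \<open>Moving \<open>x\<close> and \<open>z\<close> by the same \<open>h\<close>
        leaves the penalty \<open>norm (x - z)\<close> unchanged, so the expansion of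
        \<open>W\<close> at \<open>z\<close> becomes one of \<open>u\<close> at
        \<open>x\<close>.\<close>
      have "u (x + h) \<le> u x + p \<bullet> h + (D h \<bullet> h) / 2 + e * (norm h)\<^sup>2"
        if "x + h \<in> Q" "\<bar>W (z + h) - k / 2 * (norm (z + h))\<^sup>2
            - (W z - k / 2 * (norm z)\<^sup>2 + p \<bullet> h + (D h \<bullet> h) / 2)\<bar> \<le> e * (norm h)\<^sup>2" for h
        using W_low[OF that(1), of "z + h"] Wz(1) that(2) by simp
      then show ?thesis using expand[OF e] by blast
    qed
    show "\<exists>r>0. \<forall>h. norm h < r \<longrightarrow> y + h \<in> Q \<longrightarrow> v (y + h) \<ge> v y + (p - q) \<bullet> h + (D h \<bullet> h) / 2 - e * (norm h)\<^sup>2"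
      if e: "e > 0" for e
    proof -
      have "v (y + h) \<ge> v y + (p - q) \<bullet> h + (D h \<bullet> h) / 2 - e * (norm h)\<^sup>2"
        if "y + h \<in> Q" "\<bar>W (z + h) - k / 2 * (norm (z + h))\<^sup>2
            - (W z - k / 2 * (norm z)\<^sup>2 + p \<bullet> h + (D h \<bullet> h) / 2)\<bar> \<le> e * (norm h)\<^sup>2" for h
        using W_up[OF that(1) q(1), of "z + h"] Wz(2) that(2) by (simp add: inner_diff_left inner_add_right)
      then show ?thesis using expand[OF e] by blast
    qed
    show "u x' - v y' - k / 4 * (norm (x' - y'))\<^sup>2 - q \<bullet> (x' + y') / 2
        \<le> u x - v y - k / 4 * (norm (x - y))\<^sup>2 - q \<bullet> (x + y) / 2" if "x' \<in> Q" "y' \<in> Q" for x' y'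
      using max[OF that, of q] by (simp add: \<Psi>_def zxy)
  qed
qed

section \<open>Structure of the operator and test functions\<close>

definition outer_mat :: "real^'n \<Rightarrow> real^'n \<Rightarrow> real^'n^'n" where
  "outer_mat p q = (\<chi> i j. p $ i * q $ j)"

lemma outer_mat_vector_mult: "outer_mat p q *v h = (q \<bullet> h) *\<^sub>R p"
  by (simp add: vec_eq_iff outer_mat_def matrix_vector_mult_def inner_vec_def sum_distrib_left mult_ac)

lemma symmetric_mat_iff: "symmetric_mat M \<longleftrightarrow> (\<forall>i j. M $ i $ j = M $ j $ i)"
  unfolding symmetric_mat_def transpose_def vec_eq_iff vec_lambda_beta by metis

lemma symmetric_mat_inner: "symmetric_mat M \<Longrightarrow> (M *v x) \<bullet> y = x \<bullet> (M *v y)"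
  unfolding symmetric_mat_def by (metis dot_lmul_matrix transpose_matrix_vector)

lemma symmetric_mat_outer: "symmetric_mat (outer_mat p p)"
  by (simp add: symmetric_mat_iff outer_mat_def)

lemma psd_mat_outer: "psd_mat (outer_mat p p)"
  by (simp add: psd_mat_def outer_mat_vector_mult inner_commute)

lemma trace_outer: "trace (outer_mat p p) = p \<bullet> p"
  by (simp add: trace_def outer_mat_def inner_vec_def)

lemma trace_nonneg_if_psd:
  assumes "psd_mat M" shows "0 \<le> trace M"
proof -
  have "M $ i $ i = axis i 1 \<bullet> (M *v axis i 1)" for i
    by (simp add: inner_axis' matrix_vector_mul_component inner_axis)
  then have "0 \<le> M $ i $ i" for i using assms by (simp add: psd_mat_def)
  then show ?thesis unfolding trace_def by (intro sum_nonneg) auto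
qed

lemma norm_matrix_vector_mult_le:
  fixes E :: "real^'n^'m" shows "norm (E *v x) \<le> norm E * norm x"
proof -
  have "norm (E *v x) = L2_set (\<lambda>i. \<bar>(E $ i) \<bullet> x\<bar>) UNIV"
    by (simp add: norm_vec_def matrix_vector_mul_component)
  also have "\<dots> \<le> L2_set (\<lambda>i. norm (E $ i) * norm x) UNIV"
    by (intro L2_set_mono Cauchy_Schwarz_ineq2) auto
  also have "\<dots> = norm E * norm x"
    by (simp add: norm_vec_def L2_set_left_distrib)
  finally show ?thesis .
qed

text \<open>In the order of quadratic forms, \<open>M\<close> is at most \<open>N\<close> plus
  \<open>norm (M - N)\<close> times the identity. The lower structural inequality makes
  \<open>F\<close> monotone, and the upper one bounds the increment along the identity.\<close>

lemma structural_F_lipschitz: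
  fixes F :: "real^'n^'n \<Rightarrow> real"
  assumes F: "structural_F F a A" and sym: "symmetric_mat M" "symmetric_mat N"
  shows "\<bar>F M - F N\<bar> \<le> A * CARD('n) * norm (M - N)"
proof -
  have le: "F M - F N \<le> A * CARD('n) * norm (M - N)"
    if sym: "symmetric_mat M" "symmetric_mat N" for M N
  proof -
    define s where "s = norm (M - N)"
    define P where "P = s *\<^sub>R (mat 1 :: real^'n^'n)"
    have P: "symmetric_mat P" "psd_mat P" "trace P = CARD('n) * s"
      by (auto simp: P_def s_def symmetric_mat_iff psd_mat_def mat_def trace_def
          scaleR_matrix_vector_assoc[symmetric] matrix_vector_mul_lid[unfolded mat_def])
    have psd: "psd_mat (P - (M - N))"
      unfolding psd_mat_def
    proof
      fix x
      have "x \<bullet> ((M - N) *v x) \<le> norm x * (s * norm x)"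
        unfolding s_def
        by (intro order_trans[OF norm_cauchy_schwarz] mult_left_mono norm_matrix_vector_mult_le) auto
      also have "\<dots> = x \<bullet> (P *v x)"
        by (simp add: P_def scaleR_matrix_vector_assoc[symmetric] power2_norm_eq_inner[symmetric] power2_eq_square)
      finally show "0 \<le> x \<bullet> ((P - (M - N)) *v x)"
        by (simp add: matrix_vector_mult_diff_rdistrib inner_diff_right)
    qed
    have "symmetric_mat (P - (M - N))" using P(1) sym by (auto simp: symmetric_mat_iff)
    with psd have "a * trace (P - (M - N)) \<le> F (M + (P - (M - N))) - F M"
      using F sym(1) unfolding structural_F_def by blast
    moreover have "0 \<le> a * trace (P - (M - N))"
      using F trace_nonneg_if_psd[OF psd] by (auto simp: structural_F_def)
    ultimately have "0 \<le> F (M + (P - (M - N))) - F M" by linarith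
    then have "F M \<le> F (N + P)" by (simp add: algebra_simps)
    moreover have "F (N + P) - F N \<le> A * trace P"
      using F sym(2) P unfolding structural_F_def by blast
    ultimately show ?thesis using P(3) by (simp add: s_def mult.assoc)
  qed
  show ?thesis using le[OF sym] le[OF sym(2,1)] by (simp add: norm_minus_commute abs_le_iff)
qed

lemma Theta_conj: "Theta \<alpha> p ** M ** Theta \<alpha> p =
    (\<chi> i j. abs_pow (p $ i) (\<alpha> / 2) * M $ i $ j * abs_pow (p $ j) (\<alpha> / 2))"
proof -
  have l: "(Theta \<alpha> p ** B) $ i $ j = abs_pow (p $ i) (\<alpha> / 2) * B $ i $ j" for B i j
  proof -
    have "(Theta \<alpha> p ** B) $ i $ j = (\<Sum>k\<in>UNIV. if i = k then abs_pow (p $ i) (\<alpha> / 2) * B $ k $ j else 0)"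
      unfolding Theta_def matrix_matrix_mult_def by (simp only: vec_lambda_beta, rule sum.cong) auto
    then show ?thesis by (simp add: sum.delta)
  qed
  have r: "(B ** Theta \<alpha> p) $ i $ j = B $ i $ j * abs_pow (p $ j) (\<alpha> / 2)" for B i j
  proof -
    have "(B ** Theta \<alpha> p) $ i $ j = (\<Sum>k\<in>UNIV. if k = j then B $ i $ k * abs_pow (p $ j) (\<alpha> / 2) else 0)"
      unfolding Theta_def matrix_matrix_mult_def by (simp only: vec_lambda_beta, rule sum.cong) auto
    then show ?thesis by (simp add: sum.delta)
  qed
  show ?thesis by (simp add: vec_eq_iff l r)
qed

lemma symmetric_mat_Theta_conj: "symmetric_mat M \<Longrightarrow> symmetric_mat (Theta \<alpha> p ** M ** Theta \<alpha> p)"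
  unfolding Theta_conj symmetric_mat_iff vec_lambda_beta by (metis mult.assoc mult.commute)

lemma continuous_on_abs_pow: "e \<ge> 0 \<Longrightarrow> continuous_on S (\<lambda>s. abs_pow s e)"
  unfolding abs_pow_def
proof (cases "e = 0")
  assume "0 \<le> e" "e \<noteq> 0"
  then have "continuous_on S (\<lambda>s. \<bar>s\<bar> powr e)"
    by (intro continuous_on_powr' continuous_intros) auto
  then show "continuous_on S (\<lambda>s. if e = 0 then 1 else \<bar>s\<bar> powr e)" using \<open>e \<noteq> 0\<close> by simp
qed simp

lemma continuous_on_Fp:
  fixes F :: "real^'n^'n \<Rightarrow> real"
  assumes F: "structural_F F a A" and "\<alpha> \<ge> 0"
  shows "continuous_on {w. symmetric_mat (snd w)} (\<lambda>w. Fp F \<alpha> (fst w) (snd w))"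
proof -
  define L where "L = A * CARD('n)"
  have "L \<ge> 0" using F by (auto simp: L_def structural_F_def)
  have "L-lipschitz_on (Collect symmetric_mat) F"
    using structural_F_lipschitz[OF F] \<open>L \<ge> 0\<close>
    by (intro lipschitz_onI) (auto simp: dist_norm dist_real_def L_def)
  then have contF: "continuous_on (Collect symmetric_mat) F" by (rule lipschitz_on_continuous_on)
  have pow: "continuous_on S (\<lambda>w. abs_pow (fst w $ i) (\<alpha> / 2))" for i and S :: "((real^'n) \<times> (real^'n^'n)) set"
    by (rule continuous_on_compose2[OF continuous_on_abs_pow[of "\<alpha> / 2" UNIV]])
      (use \<open>\<alpha> \<ge> 0\<close> in \<open>auto intro!: continuous_intros\<close>)
  have "continuous_on {w :: (real^'n) \<times> (real^'n^'n). symmetric_mat (snd w)}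
      (\<lambda>w. Theta \<alpha> (fst w) ** snd w ** Theta \<alpha> (fst w))"
    unfolding Theta_conj by (intro continuous_on_vec_lambda continuous_on_mult pow continuous_intros)
  then show ?thesis unfolding Fp_def
    by (rule continuous_on_compose2[OF contF]) (auto intro: symmetric_mat_Theta_conj)
qed

section \<open>Test functions\<close>

definition quadratic :: "real \<Rightarrow> real^'n \<Rightarrow> real^'n^'n \<Rightarrow> real^'n \<Rightarrow> real^'n \<Rightarrow> real" where
  "quadratic c p X x y = c + p \<bullet> (y - x) + ((y - x) \<bullet> (X *v (y - x))) / 2"

lemma C2_with_quadratic:
  assumes "symmetric_mat X"
  shows "C2_with (quadratic c p X x) (\<lambda>y. p + X *v (y - x)) (\<lambda>y. X) S"
  unfolding C2_with_def
proof (intro conjI ballI)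
  fix y
  have X: "((\<lambda>y. X *v (y - x)) has_derivative (\<lambda>h. X *v h)) (at y)"
    by (rule bounded_linear.has_derivative[OF matrix_vector_mul_bounded_linear]) (auto intro!: derivative_eq_intros)
  show "((\<lambda>y. p + X *v (y - x)) has_derivative (\<lambda>h. X *v h)) (at y)"
    using X by (auto intro!: derivative_eq_intros)
  have swap: "h \<bullet> (X *v (y - x)) = (y - x) \<bullet> (X *v h)" for h
    using symmetric_mat_inner[OF assms] by (metis inner_commute)
  show "(quadratic c p X x has_derivative (\<lambda>h. (p + X *v (y - x)) \<bullet> h)) (at y)"
    unfolding quadratic_def
    by (rule has_derivative_eq_rhs, (rule derivative_intros X)+,
      auto simp: fun_eq_iff symmetric_mat_inner[OF assms] inner_add_left, rule swap)
qed (rule continuous_on_const)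

lemma C2_with_compose:
  assumes P: "C2_with P g H S"
    and \<phi>: "\<And>x. x \<in> S \<Longrightarrow> (\<phi> has_real_derivative \<phi>1 (P x)) (at (P x))"
    and \<phi>1: "\<And>x. x \<in> S \<Longrightarrow> (\<phi>1 has_real_derivative \<phi>2 (P x)) (at (P x))"
    and \<phi>2: "continuous_on (P ` S) \<phi>2"
  shows "C2_with (\<lambda>x. \<phi> (P x)) (\<lambda>x. \<phi>1 (P x) *\<^sub>R g x)
    (\<lambda>x. \<phi>1 (P x) *\<^sub>R H x + \<phi>2 (P x) *\<^sub>R outer_mat (g x) (g x)) S"
proof -
  have dP: "(P has_derivative (\<lambda>h. g x \<bullet> h)) (at x)" and dg: "(g has_derivative (\<lambda>h. H x *v h)) (at x)"
    if "x \<in> S" for x using P that by (auto simp: C2_with_def)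
  have cP: "continuous_on S P" and cg: "continuous_on S g" and cH: "continuous_on S H"
    using P dP dg by (auto simp: C2_with_def intro!: continuous_at_imp_continuous_on has_derivative_continuous)
  have d\<phi>: "((\<lambda>x. \<phi> (P x)) has_derivative (\<lambda>h. \<phi>1 (P x) * (g x \<bullet> h))) (at x)" if "x \<in> S" for x
    using has_derivative_compose[OF dP[OF that]] \<phi>[OF that] unfolding has_field_derivative_def by blast
  have d\<phi>1: "((\<lambda>x. \<phi>1 (P x)) has_derivative (\<lambda>h. \<phi>2 (P x) * (g x \<bullet> h))) (at x)" if "x \<in> S" for x
    using has_derivative_compose[OF dP[OF that]] \<phi>1[OF that] unfolding has_field_derivative_def by blast
  have c\<phi>1: "continuous_on S (\<lambda>x. \<phi>1 (P x))"
    using d\<phi>1 by (auto intro!: continuous_at_imp_continuous_on has_derivative_continuous)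
  have c\<phi>2: "continuous_on S (\<lambda>x. \<phi>2 (P x))"
    using continuous_on_compose[OF cP \<phi>2] by (simp add: o_def)
  show ?thesis
    unfolding C2_with_def
  proof (intro conjI ballI)
    fix x assume x: "x \<in> S"
    show "((\<lambda>x. \<phi> (P x)) has_derivative (\<lambda>h. (\<phi>1 (P x) *\<^sub>R g x) \<bullet> h)) (at x)"
      using d\<phi>[OF x] by simp
    show "((\<lambda>x. \<phi>1 (P x) *\<^sub>R g x) has_derivative
        (\<lambda>h. (\<phi>1 (P x) *\<^sub>R H x + \<phi>2 (P x) *\<^sub>R outer_mat (g x) (g x)) *v h)) (at x)"
      by (rule has_derivative_eq_rhs[OF has_derivative_scaleR[OF d\<phi>1[OF x] dg[OF x]]])
        (auto simp: fun_eq_iff matrix_vector_mult_add_rdistrib scaleR_matrix_vector_assoc[symmetric]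
          outer_mat_vector_mult)
  next
    show "continuous_on S (\<lambda>x. \<phi>1 (P x) *\<^sub>R H x + \<phi>2 (P x) *\<^sub>R outer_mat (g x) (g x))"
      unfolding outer_mat_def by (intro continuous_intros cP cg cH c\<phi>1 c\<phi>2)
  qed
qed

lemma C2_with_diff:
  assumes "C2_with P g H S" "C2_with P' g' H' S"
  shows "C2_with (\<lambda>x. P x - P' x) (\<lambda>x. g x - g' x) (\<lambda>x. H x - H' x) S"
  unfolding C2_with_def
proof (intro conjI ballI)
  fix x assume "x \<in> S"
  then show "((\<lambda>x. P x - P' x) has_derivative (\<lambda>h. (g x - g' x) \<bullet> h)) (at x)"
    "((\<lambda>x. g x - g' x) has_derivative (\<lambda>h. (H x - H' x) *v h)) (at x)"
    using assms unfolding C2_with_def inner_diff_left matrix_vector_mult_diff_rdistrib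
    by (auto intro: has_derivative_diff)
next
  show "continuous_on S (\<lambda>x. H x - H' x)"
    using assms unfolding C2_with_def by (auto intro: continuous_on_diff)
qed

text \<open>A small step along \<open>- g\<close> lowers \<open>\<phi>\<close> with slope nearly
  \<open>norm g\<close>; \<open>f\<close> stays below \<open>\<phi>\<close> up to a constant but can
  fall with slope at most \<open>C\<close>.\<close>

lemma Lipschitz_touching_gradient_bound:
  fixes f :: "'a::euclidean_space \<Rightarrow> real"
  assumes lip: "\<And>y. y \<in> ball x r \<Longrightarrow> \<bar>f y - f x\<bar> \<le> C * norm (y - x)" and "r > 0"
    and \<phi>: "(\<phi> has_derivative (\<lambda>h. g \<bullet> h)) (at x)"
    and touch: "\<And>y. y \<in> ball x r \<Longrightarrow> f y - \<phi> y \<le> f x - \<phi> x"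
  shows "norm g \<le> C"
proof (cases "g = 0")
  case True
  \<comment> \<open>Only \<open>0 \<le> C\<close> remains, which any second point of the ball
    shows.\<close>
  obtain b :: 'a where b: "norm b = r / 2" using vector_choose_size[of "r / 2"] \<open>r > 0\<close> by auto
  then have "0 \<le> C * (r / 2)"
    using lip[of "x + b"] \<open>r > 0\<close> by (auto simp: dist_norm intro: order_trans[OF abs_ge_zero])
  then show ?thesis using True \<open>r > 0\<close> by (simp add: zero_le_mult_iff)
next
  case False
  show ?thesis
  proof (rule field_le_epsilon)
    fix e :: real assume "e > 0"
    then obtain s where s: "s > 0"
      "\<And>y. norm (y - x) < s \<Longrightarrow> norm (\<phi> y - \<phi> x - g \<bullet> (y - x)) \<le> e * norm (y - x)"
      using \<phi> by (auto simp: has_derivative_at_alt)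
    define t where "t = min s r / 2"
    have t: "t > 0" "t < s" "t < r" using s(1) \<open>r > 0\<close> by (auto simp: t_def)
    define h where "h = - ((t / norm g) *\<^sub>R g)"
    have h: "norm h = t" "g \<bullet> h = - (t * norm g)"
      using False t by (auto simp: h_def power2_norm_eq_inner[symmetric] power2_eq_square)
    have "x + h \<in> ball x r" using h(1) t by (simp add: dist_norm)
    then have "- (C * t) \<le> f (x + h) - f x" "f (x + h) - f x \<le> \<phi> (x + h) - \<phi> x"
      using lip[of "x + h"] touch[of "x + h"] h(1) by (auto simp: abs_le_iff)
    moreover have "\<phi> (x + h) - \<phi> x \<le> e * t - t * norm g"
      using s(2)[of "x + h"] h t by (auto simp: abs_le_iff)
    ultimately have "t * norm g \<le> t * (C + e)" by (simp add: algebra_simps)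
    then show "norm g \<le> C + e" using t(1) by simp
  qed
qed

section \<open>Comparison with a strict subsolution\<close>

text \<open>Touching is by an exact quadratic polynomial, which is itself a \<open>C^2\<close> test
  function; remainders of order \<open>o(|h|^2)\<close> are absorbed by enlarging the matrix in
  \<open>superjet_if_expansion\<close>.\<close>

definition superjet :: "(real^'n \<Rightarrow> real) \<Rightarrow> (real^'n) set \<Rightarrow> real^'n \<Rightarrow> ((real^'n) \<times> (real^'n^'n)) set" where
  "superjet u \<Omega> x = {(p, X). symmetric_mat X \<and>
     (\<exists>r>0. ball x r \<subseteq> \<Omega> \<and> (\<forall>y\<in>ball x r. u y \<le> quadratic (u x) p X x y))}"

definition subjet :: "(real^'n \<Rightarrow> real) \<Rightarrow> (real^'n) set \<Rightarrow> real^'n \<Rightarrow> ((real^'n) \<times> (real^'n^'n)) set" where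
  "subjet v \<Omega> x = {(p, X). symmetric_mat X \<and>
     (\<exists>r>0. ball x r \<subseteq> \<Omega> \<and> (\<forall>y\<in>ball x r. quadratic (v x) p X x y \<le> v y))}"

text \<open>Otherwise, for \<open>k\<close> growing and \<open>\<theta>\<close> tending to 0,
  exceptional pairs would converge to one point \<open>l\<close> of the diagonal with
  \<open>z l - v l \<ge> S\<close>. The boundary condition puts \<open>l\<close> inside \<Omega>,
  where continuity of \<open>g\<close> gives a contradiction. All near-maximisers are treated,
  because the tilt \<open>q\<close> displaces the maximum.\<close>

lemma near_maximum_localization:
  fixes z v :: "'a::euclidean_space \<Rightarrow> real" and g :: "'a \<Rightarrow> 'b::metric_space"
  assumes \<Omega>: "open \<Omega>" "bounded \<Omega>" and z: "usc_on (closure \<Omega>) z" and v: "lsc_on (closure \<Omega>) v"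
    and bdry: "\<And>x. x \<in> frontier \<Omega> \<Longrightarrow> z x - v x < S"
    and g: "continuous_on \<Omega> g" and "e > 0"
  obtains k \<theta> where "k > 0" "\<theta> > 0"
    "\<And>x y. x \<in> closure \<Omega> \<Longrightarrow> y \<in> closure \<Omega> \<Longrightarrow> S - \<theta> \<le> z x - v y - k / 4 * (norm (x - y))\<^sup>2
      \<Longrightarrow> x \<in> \<Omega> \<and> y \<in> \<Omega> \<and> dist (g x) (g y) < e"
proof -
  define Q where "Q = closure \<Omega>"
  have Q: "compact Q" using \<Omega> by (simp add: Q_def compact_closure)
  have "\<exists>k>0. \<exists>\<theta>>0. \<forall>x\<in>Q. \<forall>y\<in>Q. S - \<theta> \<le> z x - v y - k / 4 * (norm (x - y))\<^sup>2
      \<longrightarrow> x \<in> \<Omega> \<and> y \<in> \<Omega> \<and> dist (g x) (g y) < e"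
  proof (rule ccontr)
    assume no: "\<not> ?thesis"
    have "\<exists>x y. x \<in> Q \<and> y \<in> Q \<and>
        S - inverse (real (Suc n)) \<le> z x - v y - (4 * real (Suc n)) / 4 * (norm (x - y))\<^sup>2 \<and>
        \<not> (x \<in> \<Omega> \<and> y \<in> \<Omega> \<and> dist (g x) (g y) < e)" for n
    proof (rule ccontr)
      assume "\<not> ?thesis"
      then have "\<exists>k>0. \<exists>\<theta>>0. \<forall>x\<in>Q. \<forall>y\<in>Q. S - \<theta> \<le> z x - v y - k / 4 * (norm (x - y))\<^sup>2
          \<longrightarrow> x \<in> \<Omega> \<and> y \<in> \<Omega> \<and> dist (g x) (g y) < e"
        by (intro exI[of _ "4 * real (Suc n)"] exI[of _ "inverse (real (Suc n))"] conjI) (auto simp del: of_nat_Suc)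
      then show False using no by contradiction
    qed
    then obtain x y where x: "\<And>n. x n \<in> Q" and y: "\<And>n. y n \<in> Q"
      and near: "\<And>n. S - inverse (real (Suc n)) \<le> z (x n) - v (y n) - (4 * real (Suc n)) / 4 * (norm (x n - y n))\<^sup>2"
      and bad: "\<And>n. \<not> (x n \<in> \<Omega> \<and> y n \<in> \<Omega> \<and> dist (g (x n)) (g (y n)) < e)"
      by metis
    have quarter: "4 * t / 4 = t" for t :: real by simp
    note near = near[unfolded quarter]
    have "Q \<noteq> {}" using x by auto
    obtain z0 where z0: "\<And>x. x \<in> Q \<Longrightarrow> z x \<le> z z0"
      using usc_on_attains_sup[OF Q \<open>Q \<noteq> {}\<close>, of z] z unfolding Q_def by metis
    obtain v0 where v0: "\<And>x. x \<in> Q \<Longrightarrow> - v x \<le> - v v0"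
      using usc_on_attains_sup[OF Q \<open>Q \<noteq> {}\<close> usc_on_uminus] v unfolding Q_def by metis
    define K where "K = z z0 - v v0 - S + 1"
    have "(norm (x n - y n))\<^sup>2 \<le> K * inverse (real (Suc n))" for n
    proof -
      have "inverse (real (Suc n)) \<le> 1" by (simp add: field_simps)
      then have "real (Suc n) * (norm (x n - y n))\<^sup>2 \<le> K"
        using near[of n] z0[OF x[of n]] v0[OF y[of n]] unfolding K_def by linarith
      then show ?thesis by (simp add: field_simps)
    qed
    moreover have "(\<lambda>n. K * inverse (real (Suc n))) \<longlonglongrightarrow> 0"
      using tendsto_mult_right_zero[OF LIMSEQ_inverse_real_of_nat] by blast
    ultimately have "(\<lambda>n. (norm (x n - y n))\<^sup>2) \<longlonglongrightarrow> 0"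
      by (intro tendsto_sandwich[OF _ _ tendsto_const, of _ "\<lambda>n. (norm (x n - y n))\<^sup>2"]) auto
    then have "(\<lambda>n. sqrt ((norm (x n - y n))\<^sup>2)) \<longlonglongrightarrow> sqrt 0" by (rule tendsto_real_sqrt)
    then have xy0: "(\<lambda>n. x n - y n) \<longlonglongrightarrow> 0" by (simp add: tendsto_norm_zero_iff)
    obtain l r where l: "l \<in> Q" and r: "strict_mono r" and xl: "(x \<circ> r) \<longlonglongrightarrow> l"
      using Q x unfolding compact_def by metis
    have "(\<lambda>n. (x \<circ> r) n - (x (r n) - y (r n))) \<longlonglongrightarrow> l - 0"
      by (intro tendsto_diff xl LIMSEQ_subseq_LIMSEQ[OF xy0 r, unfolded o_def])
    then have yl: "(y \<circ> r) \<longlonglongrightarrow> l" by (simp add: o_def)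
    have "S \<le> z l - v l"
    proof (rule field_le_epsilon)
      fix e0 :: real assume "e0 > 0"
      then have e3: "e0 / 3 > 0" by simp
      obtain d1 where d1: "d1 > 0" "\<And>w. w \<in> Q \<Longrightarrow> dist w l < d1 \<Longrightarrow> z w < z l + e0 / 3"
        using z l e3 unfolding usc_on_def Q_def by blast
      obtain d2 where d2: "d2 > 0" "\<And>w. w \<in> Q \<Longrightarrow> dist w l < d2 \<Longrightarrow> v l - e0 / 3 < v w"
        using v l e3 unfolding lsc_on_def Q_def by blast
      have "\<forall>\<^sub>F n in sequentially. dist ((x \<circ> r) n) l < d1" using xl d1(1) by (rule tendstoD)
      moreover have "\<forall>\<^sub>F n in sequentially. dist ((y \<circ> r) n) l < d2" using yl d2(1) by (rule tendstoD)
      moreover have "\<forall>\<^sub>F n in sequentially. inverse (real (Suc n)) < e0 / 3"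
        using order_tendstoD(2)[OF LIMSEQ_inverse_real_of_nat e3] .
      ultimately have "\<forall>\<^sub>F n in sequentially. S \<le> z l - v l + e0"
      proof eventually_elim
        case (elim n)
        have "inverse (real (Suc (r n))) \<le> inverse (real (Suc n))"
          using seq_suble[OF r, of n] by (simp add: field_simps)
        moreover have "S - inverse (real (Suc (r n))) \<le> z (x (r n)) - v (y (r n))"
          using near[of "r n"]
            mult_nonneg_nonneg[OF of_nat_0_le_iff[of "Suc (r n)"] zero_le_power2[of "norm (x (r n) - y (r n))"]]
          by linarith
        ultimately show ?case using d1(2)[OF x, of "r n"] d2(2)[OF y, of "r n"] elim unfolding o_def by linarith
      qed
      then show "S \<le> z l - v l + e0" by simp
    qed
    then have "l \<notin> frontier \<Omega>" using bdry[of l] by auto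
    then have "l \<in> \<Omega>" using l \<Omega>(1) by (auto simp: Q_def frontier_def interior_open)
    have cont: "isCont g l" using g \<Omega>(1) \<open>l \<in> \<Omega>\<close> by (simp add: continuous_on_eq_continuous_at)
    have "\<forall>\<^sub>F n in sequentially. (x \<circ> r) n \<in> \<Omega>" "\<forall>\<^sub>F n in sequentially. (y \<circ> r) n \<in> \<Omega>"
      using topological_tendstoD[OF xl \<Omega>(1) \<open>l \<in> \<Omega>\<close>] topological_tendstoD[OF yl \<Omega>(1) \<open>l \<in> \<Omega>\<close>] .
    moreover have "(\<lambda>n. dist (g ((x \<circ> r) n)) (g ((y \<circ> r) n))) \<longlonglongrightarrow> dist (g l) (g l)"
      by (intro tendsto_dist isCont_tendsto_compose[OF cont] xl yl)
    then have "\<forall>\<^sub>F n in sequentially. dist (g ((x \<circ> r) n)) (g ((y \<circ> r) n)) < e"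
      using \<open>e > 0\<close> order_tendstoD(2) by fastforce
    ultimately have "\<forall>\<^sub>F n in sequentially. False"
      by eventually_elim (use bad in auto)
    then show False by simp
  qed
  then show ?thesis using that unfolding Q_def by blast
qed

text \<open>Only the quadratic form of \<open>D\<close> enters the expansions, and the symmetric
  part has the same form; no symmetry of the derivative of \<open>G\<close> has been
  established.\<close>

lemma symmetric_part_of_linear:
  fixes D :: "real^'n \<Rightarrow> real^'n"
  assumes D: "linear D" and le: "\<And>h. norm (D h) \<le> L * norm h"
  obtains X where "symmetric_mat X" "\<And>h. h \<bullet> (X *v h) = D h \<bullet> h"
    "norm X \<le> L * (CARD('n) * CARD('n))"
proof -
  define M where "M = matrix D"
  have M: "M *v h = D h" for h using D by (simp add: M_def matrix_works)
  define X where "X = (1 / 2) *\<^sub>R (M + transpose M)"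
  have entry: "\<bar>M $ i $ j\<bar> \<le> L" for i j
  proof -
    have "\<bar>M $ i $ j\<bar> = \<bar>D (axis j 1) $ i\<bar>" by (simp add: M_def matrix_def)
    also have "\<dots> \<le> norm (D (axis j 1))" by (rule component_le_norm_cart)
    finally show ?thesis using le[of "axis j 1"] by simp
  qed
  show ?thesis
  proof (rule that[of X])
    show "symmetric_mat X" by (simp add: symmetric_mat_iff X_def transpose_def)
    show "h \<bullet> (X *v h) = D h \<bullet> h" for h
    proof -
      have "h \<bullet> (transpose M *v h) = (M *v h) \<bullet> h"
        by (metis dot_lmul_matrix inner_commute transpose_matrix_vector)
      then show ?thesis
        by (simp add: X_def scaleR_matrix_vector_assoc[symmetric] matrix_vector_mult_add_rdistrib M
            inner_add_right inner_commute)
    qed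
    have "\<bar>X $ i $ j\<bar> \<le> L" for i j
      using entry[of i j] entry[of j i] by (simp add: X_def transpose_def abs_le_iff)
    then have row: "norm (X $ i) \<le> CARD('n) * L" for i
      using norm_le_l1_cart[of "X $ i"] sum_bounded_above[of UNIV "\<lambda>j. \<bar>X $ i $ j\<bar>" L] by force
    have "norm X \<le> (\<Sum>i\<in>UNIV. norm (X $ i))" unfolding norm_vec_def by (rule L2_set_le_sum) auto
    also have "\<dots> \<le> CARD('n) * (CARD('n) * L)"
      using sum_bounded_above[of UNIV "\<lambda>i. norm (X $ i)" "CARD('n) * L"] row by simp
    finally show "norm X \<le> L * (CARD('n) * CARD('n))" by (simp add: mult_ac)
  qed
qed

lemma closed_symmetric_mat: "closed (Collect (symmetric_mat :: real^'n^'n \<Rightarrow> bool))"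
proof -
  have "Collect (symmetric_mat :: real^'n^'n \<Rightarrow> bool) = (\<Inter>i. \<Inter>j. {M. M $ i $ j = M $ j $ i})"
    by (auto simp: symmetric_mat_iff)
  moreover have "closed {M :: real^'n^'n. M $ i $ j = M $ j $ i}" for i j
    by (intro closed_Collect_eq continuous_intros)
  ultimately show ?thesis by (metis (no_types, lifting) closed_INT)
qed

lemma uniformly_continuous_Fp:
  fixes F :: "real^'n^'n \<Rightarrow> real"
  assumes F: "structural_F F a A" and "\<alpha> \<ge> 0" "e > 0"
  obtains d where "d > 0"
    "\<And>p q X Y. norm p \<le> R \<Longrightarrow> norm q \<le> R \<Longrightarrow> symmetric_mat X \<Longrightarrow> symmetric_mat Y \<Longrightarrow> norm X \<le> M \<Longrightarrow> norm Y \<le> M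
      \<Longrightarrow> norm (p - q) + norm (X - Y) < d \<Longrightarrow> \<bar>Fp F \<alpha> p X - Fp F \<alpha> q Y\<bar> < e"
proof -
  define K where "K = cball (0::real^'n) R \<times> (cball (0::real^'n^'n) M \<inter> Collect symmetric_mat)"
  have "compact K"
    unfolding K_def by (intro compact_Times compact_Int_closed closed_symmetric_mat) auto
  moreover have "continuous_on K (\<lambda>w. Fp F \<alpha> (fst w) (snd w))"
    by (rule continuous_on_subset[OF continuous_on_Fp[OF F \<open>\<alpha> \<ge> 0\<close>]]) (auto simp: K_def)
  ultimately have "uniformly_continuous_on K (\<lambda>w. Fp F \<alpha> (fst w) (snd w))"
    by (rule compact_uniformly_continuous[rotated])
  then obtain d where d: "d > 0"
    "\<And>w w'. w \<in> K \<Longrightarrow> w' \<in> K \<Longrightarrow> dist w' w < d \<Longrightarrow> dist (Fp F \<alpha> (fst w') (snd w')) (Fp F \<alpha> (fst w) (snd w)) < e"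
    using \<open>e > 0\<close> unfolding uniformly_continuous_on_def by metis
  show ?thesis
  proof (rule that[OF d(1)])
    fix p q :: "real^'n" and X Y :: "real^'n^'n"
    assume *: "norm p \<le> R" "norm q \<le> R" "symmetric_mat X" "symmetric_mat Y" "norm X \<le> M" "norm Y \<le> M"
      "norm (p - q) + norm (X - Y) < d"
    have "dist (p, X) (q, Y) \<le> norm (p - q) + norm (X - Y)"
      unfolding dist_norm using norm_Pair_le[of "p - q" "X - Y"] by simp
    then show "\<bar>Fp F \<alpha> p X - Fp F \<alpha> q Y\<bar> < e"
      using d(2)[of "(q, Y)" "(p, X)"] * by (auto simp: K_def dist_real_def)
  qed
qed

text \<open>The factor \<open>1 / 2\<close> in \<open>quadratic\<close> turns the remainder
  \<open>e * (norm h)\<^sup>2\<close> into \<open>2 * e\<close> times the identity.\<close>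

lemma superjet_if_expansion:
  assumes "open \<Omega>" "x \<in> \<Omega>" "symmetric_mat X"
    and expand: "\<And>e. e > 0 \<Longrightarrow> \<exists>r>0. \<forall>h. norm h < r \<longrightarrow> x + h \<in> closure \<Omega> \<longrightarrow>
        u (x + h) \<le> u x + p \<bullet> h + (h \<bullet> (X *v h)) / 2 + e * (norm h)\<^sup>2"
    and "e > 0"
  shows "(p, X + (2 * e) *\<^sub>R mat 1) \<in> superjet u \<Omega> x"
proof -
  obtain r0 where r0: "r0 > 0" "ball x r0 \<subseteq> \<Omega>" using assms(1,2) openE by blast
  obtain r where r: "r > 0" "\<And>h. norm h < r \<Longrightarrow> x + h \<in> closure \<Omega> \<Longrightarrow>
      u (x + h) \<le> u x + p \<bullet> h + (h \<bullet> (X *v h)) / 2 + e * (norm h)\<^sup>2"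
    using expand[OF \<open>e > 0\<close>] by blast
  have "u y \<le> quadratic (u x) p (X + (2 * e) *\<^sub>R mat 1) x y" if "y \<in> ball x (min r r0)" for y
  proof -
    have "norm (y - x) < r" "y \<in> closure \<Omega>"
      using that r0(2) closure_subset[of \<Omega>] by (auto simp: dist_norm norm_minus_commute)
    then have "u y \<le> u x + p \<bullet> (y - x) + ((y - x) \<bullet> (X *v (y - x))) / 2 + e * (norm (y - x))\<^sup>2"
      using r(2)[of "y - x"] by simp
    also have "\<dots> = quadratic (u x) p (X + (2 * e) *\<^sub>R mat 1) x y"
      by (simp add: quadratic_def matrix_vector_mult_add_rdistrib scaleR_matrix_vector_assoc[symmetric]
          inner_add_right power2_norm_eq_inner)
    finally show ?thesis .
  qed
  moreover have "ball x (min r r0) \<subseteq> \<Omega>" using r0(2) by auto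
  moreover have "symmetric_mat (X + (2 * e) *\<^sub>R mat 1)"
    using assms(3) by (auto simp: symmetric_mat_iff mat_def)
  ultimately show ?thesis
    using r(1) r0(1) by (auto simp: superjet_def intro!: exI[of _ "min r r0"])
qed

lemma uminus_matrix_vector_mult: "(- X) *v x = - (X *v x)" for X :: "real^'n^'m"
  using matrix_vector_mult_diff_rdistrib[of 0 X x] by simp

lemma subjet_iff_superjet_uminus: "(p, X) \<in> subjet v \<Omega> x \<longleftrightarrow> (- p, - X) \<in> superjet (\<lambda>x. - v x) \<Omega> x"
proof -
  have "quadratic (- v x) (- p) (- X) x y = - quadratic (v x) p X x y" for y
    by (simp add: quadratic_def uminus_matrix_vector_mult)
  then show ?thesis by (simp add: subjet_def superjet_def symmetric_mat_iff)
qed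

text \<open>The margin \<open>\<mu>\<close> is spent in quarters: one on the oscillation of
  \<open>b\<close> and \<open>f\<close>, one on the change of \<open>norm p powr \<beta>\<close>,
  one on the change of \<open>Fp\<close>; the last one gives the contradiction. Strictness is asked
  only for gradients up to \<open>R\<close>, and the boundary inequality only up to
  \<open>c\<close>, because a perturbed subsolution offers no more in general.\<close>

theorem comparison_of_strict_subsolution:
  fixes F :: "real^'n^'n \<Rightarrow> real" and z v b f :: "real^'n \<Rightarrow> real"
  assumes \<Omega>: "open \<Omega>" "bounded \<Omega>" and F: "structural_F F a A" and "\<alpha> \<ge> 0" "\<beta> > 0"
    and b: "continuous_on \<Omega> b" "\<And>x. x \<in> \<Omega> \<Longrightarrow> \<bar>b x\<bar> \<le> B" and f: "continuous_on \<Omega> f"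
    and z: "usc_on (closure \<Omega>) z" and v: "lsc_on (closure \<Omega>) v"
    and "\<mu> > 0" "C + 1 \<le> R"
    and strict: "\<And>x p X. x \<in> \<Omega> \<Longrightarrow> (p, X) \<in> superjet z \<Omega> x \<Longrightarrow> norm p \<le> R \<Longrightarrow>
        - Fp F \<alpha> p X + b x * norm p powr \<beta> \<le> f x - \<mu>"
    and super: "\<And>x p X. x \<in> \<Omega> \<Longrightarrow> (p, X) \<in> subjet v \<Omega> x \<Longrightarrow>
        f x \<le> - Fp F \<alpha> p X + b x * norm p powr \<beta>"
    and grad: "(\<forall>x\<in>\<Omega>. \<forall>(p, X) \<in> superjet z \<Omega> x. norm p \<le> C) \<or>
        (\<forall>x\<in>\<Omega>. \<forall>(p, X) \<in> subjet v \<Omega> x. norm p \<le> C)"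
    and bdry: "\<And>x. x \<in> frontier \<Omega> \<Longrightarrow> z x \<le> v x + c" and x1: "x1 \<in> \<Omega>"
  shows "z x1 \<le> v x1 + c"
proof (rule ccontr)
  assume contra: "\<not> ?thesis"
  define Q where "Q = closure \<Omega>"
  have Q: "compact Q" "Q \<noteq> {}" "x1 \<in> Q" using \<Omega> x1 closure_subset by (auto simp: Q_def compact_closure)
  obtain x0 where x0: "x0 \<in> Q" "\<And>y. y \<in> Q \<Longrightarrow> z y + - v y \<le> z x0 + - v x0"
    using usc_on_attains_sup[OF Q(1,2) usc_on_add[OF z[folded Q_def] usc_on_uminus[OF v[folded Q_def]]]] by metis
  define S where "S = z x0 - v x0"
  have "S > c" using x0(2)[OF Q(3)] contra by (simp add: S_def)
  obtain Bq where Bq: "Bq > 0" "\<And>x. x \<in> Q \<Longrightarrow> norm x \<le> Bq"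
    using compact_imp_bounded[OF Q(1)] by (auto simp: bounded_pos)
  define T where "T = R powr \<beta>"
  have "T \<ge> 0" by (simp add: T_def)
  have "B \<ge> 0" using b(2)[OF x1] by simp
  \<comment> \<open>The oscillation of \<open>b\<close> is multiplied by
    \<open>norm p powr \<beta> \<le> T\<close>, that of \<open>f\<close> by 1. The choice has to be
    independent of \<open>k\<close>.\<close>
  define e1 where "e1 = \<mu> / 4 / (T + 1)"
  have e1: "e1 > 0" using \<open>\<mu> > 0\<close> \<open>T \<ge> 0\<close> by (simp add: e1_def)
  have e1T: "e1 * T + e1 = \<mu> / 4"
  proof -
    have "e1 * (T + 1) = \<mu> / 4"
      using e1_def \<open>T \<ge> 0\<close> nonzero_eq_divide_eq[of "T + 1" e1 "\<mu> / 4"] by simp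
    then show ?thesis by (simp add: distrib_left)
  qed
  obtain k \<theta>0 where k: "k > 0" "\<theta>0 > 0" and
    local: "\<And>x y. x \<in> Q \<Longrightarrow> y \<in> Q \<Longrightarrow> S - \<theta>0 \<le> z x - v y - k / 4 * (norm (x - y))\<^sup>2
      \<Longrightarrow> x \<in> \<Omega> \<and> y \<in> \<Omega> \<and> dist (b x, f x) (b y, f y) < e1"
  proof (rule near_maximum_localization[OF \<Omega> z v _ continuous_on_Pair[OF b(1) f] e1])
    show "z x - v x < S" if "x \<in> frontier \<Omega>" for x using bdry[OF that] \<open>S > c\<close> by simp
  qed (auto simp: Q_def)
  define M0 where "M0 = 9 * k * (CARD('n) * CARD('n))"
  define J where "J = norm (mat 1 :: real^'n^'n)"
  obtain d1 where d1: "d1 > 0"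
    "\<And>p q X Y. norm p \<le> R \<Longrightarrow> norm q \<le> R \<Longrightarrow> symmetric_mat X \<Longrightarrow> symmetric_mat Y \<Longrightarrow>
      norm X \<le> M0 + 1 \<Longrightarrow> norm Y \<le> M0 + 1 \<Longrightarrow> norm (p - q) + norm (X - Y) < d1 \<Longrightarrow>
      \<bar>Fp F \<alpha> p X - Fp F \<alpha> q Y\<bar> < \<mu> / 4"
    using uniformly_continuous_Fp[OF F \<open>\<alpha> \<ge> 0\<close>, of "\<mu> / 4" R "M0 + 1"] \<open>\<mu> > 0\<close> by (metis divide_pos_pos zero_less_numeral)
  have "continuous_on (cball (0::real^'n) R) (\<lambda>p. norm p powr \<beta>)"
    using \<open>\<beta> > 0\<close> by (intro continuous_on_powr' continuous_intros) auto
  then have "uniformly_continuous_on (cball (0::real^'n) R) (\<lambda>p. norm p powr \<beta>)"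
    by (rule compact_uniformly_continuous) simp
  moreover have "\<mu> / 4 / (B + 1) > 0" using \<open>\<mu> > 0\<close> \<open>B \<ge> 0\<close> by simp
  ultimately obtain d2 where d2: "d2 > 0"
    "\<And>p q :: real^'n. norm p \<le> R \<Longrightarrow> norm q \<le> R \<Longrightarrow> norm (p - q) < d2 \<Longrightarrow>
      \<bar>norm p powr \<beta> - norm q powr \<beta>\<bar> < \<mu> / 4 / (B + 1)"
    unfolding uniformly_continuous_on_def dist_norm by (force simp: norm_minus_commute)
  \<comment> \<open>The entries serve, in order, the gradient bound of the second jet, the modulus
    of \<open>Fp\<close>, the modulus of the power, and the localisation: the tilt changes the
    doubled function by at most \<open>\<theta> * Bq\<close> at each of the two pairs
    compared.\<close>
  define \<theta> where "\<theta> = min (min 1 (d1 / 2)) (min d2 (\<theta>0 / (2 * Bq)))"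
  have "\<theta> \<le> \<theta>0 / (2 * Bq)" by (simp add: \<theta>_def)
  then have "\<theta> * (2 * Bq) \<le> \<theta>0" using Bq(1) by (simp add: pos_le_divide_eq)
  moreover have "\<theta> > 0" using d1(1) d2(1) k(2) Bq(1) by (simp add: \<theta>_def)
  moreover have "\<theta> \<le> 1" "\<theta> \<le> d1 / 2" "\<theta> \<le> d2" by (auto simp: \<theta>_def)
  ultimately have \<theta>: "\<theta> > 0" "\<theta> \<le> 1" "\<theta> \<le> d1 / 2" "\<theta> \<le> d2" "\<theta> * (2 * Bq) \<le> \<theta>0"
    by auto
  obtain x y p q D where xy: "x \<in> Q" "y \<in> Q" and q: "norm q < \<theta>" and D: "linear D" "\<And>h. norm (D h) \<le> 9 * k * norm h"
    and up: "\<And>e. e > 0 \<Longrightarrow> \<exists>r>0. \<forall>h. norm h < r \<longrightarrow> x + h \<in> Q \<longrightarrow>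
        z (x + h) \<le> z x + p \<bullet> h + (D h \<bullet> h) / 2 + e * (norm h)\<^sup>2"
    and low: "\<And>e. e > 0 \<Longrightarrow> \<exists>r>0. \<forall>h. norm h < r \<longrightarrow> y + h \<in> Q \<longrightarrow>
        v (y + h) \<ge> v y + (p - q) \<bullet> h + (D h \<bullet> h) / 2 - e * (norm h)\<^sup>2"
    and max: "\<And>x' y'. x' \<in> Q \<Longrightarrow> y' \<in> Q \<Longrightarrow>
        z x' - v y' - k / 4 * (norm (x' - y'))\<^sup>2 - q \<bullet> (x' + y') / 2
        \<le> z x - v y - k / 4 * (norm (x - y))\<^sup>2 - q \<bullet> (x + y) / 2"
    using theorem_on_sums[OF Q(1,2) z[folded Q_def] v[folded Q_def] k(1) \<theta>(1)] by metis
  have qb: "\<bar>q \<bullet> (x' + y') / 2\<bar> \<le> \<theta> * Bq" if "x' \<in> Q" "y' \<in> Q" for x' y'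
  proof -
    have "norm (x' + y') \<le> 2 * Bq" using norm_triangle_ineq[of x' y'] Bq(2)[OF that(1)] Bq(2)[OF that(2)] by simp
    then have "norm q * norm (x' + y') \<le> \<theta> * (2 * Bq)" using q \<theta>(1) by (intro mult_mono) auto
    then show ?thesis using Cauchy_Schwarz_ineq2[of q "x' + y'"] by simp
  qed
  have "S - \<theta>0 \<le> z x - v y - k / 4 * (norm (x - y))\<^sup>2"
    using max[OF x0(1) x0(1)] qb[OF x0(1) x0(1)] qb[OF xy] \<theta>(5) by (simp add: S_def abs_le_iff)
  from local[OF xy this] have x: "x \<in> \<Omega>" and y: "y \<in> \<Omega>" and near: "dist (b x, f x) (b y, f y) < e1" by auto
  have near_b: "\<bar>b x - b y\<bar> < e1" and near_f: "\<bar>f x - f y\<bar> < e1"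
    using near dist_fst_le[of "(b x, f x)" "(b y, f y)"] dist_snd_le[of "(b x, f x)" "(b y, f y)"]
    by (auto simp: dist_real_def)
  obtain X where X: "symmetric_mat X" "\<And>h. h \<bullet> (X *v h) = D h \<bullet> h" "norm X \<le> M0"
    using symmetric_part_of_linear[OF D] unfolding M0_def by metis
  \<comment> \<open>The two jet matrices are \<open>X\<close> plus and minus
    \<open>2 * \<eta>\<close> times the identity; their distance must stay below
    \<open>d1 / 2\<close> and each shift below 1.\<close>
  define \<eta> where "\<eta> = min 1 (d1 / 2) / 8 / (J + 1)"
  have "J \<ge> 0" by (simp add: J_def)
  have \<eta>: "\<eta> > 0" using d1(1) \<open>J \<ge> 0\<close> by (simp add: \<eta>_def)
  have \<eta>J: "4 * \<eta> * J < min 1 (d1 / 2)"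
  proof -
    have "\<eta> * (J + 1) = min 1 (d1 / 2) / 8"
      using \<eta>_def \<open>J \<ge> 0\<close> nonzero_eq_divide_eq[of "J + 1" \<eta> "min 1 (d1 / 2) / 8"] by simp
    then have "4 * \<eta> * (J + 1) = min 1 (d1 / 2) / 2" by (simp only: mult.assoc)
    moreover have "0 < min 1 (d1 / 2)" using d1(1) by simp
    ultimately show ?thesis using \<eta> unfolding distrib_left mult_1_right by linarith
  qed
  define X1 X2 where "X1 = X + (2 * \<eta>) *\<^sub>R mat 1" and "X2 = X - (2 * \<eta>) *\<^sub>R mat 1"
  have jet1: "(p, X1) \<in> superjet z \<Omega> x"
    unfolding X1_def
  proof (rule superjet_if_expansion[OF \<Omega>(1) x X(1) _ \<eta>])
    show "\<exists>r>0. \<forall>h. norm h < r \<longrightarrow> x + h \<in> closure \<Omega> \<longrightarrow>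
        z (x + h) \<le> z x + p \<bullet> h + (h \<bullet> (X *v h)) / 2 + e * (norm h)\<^sup>2" if "e > 0" for e
      using up[OF that] unfolding X(2) Q_def .
  qed
  have "(- (p - q), - X + (2 * \<eta>) *\<^sub>R mat 1) \<in> superjet (\<lambda>x. - v x) \<Omega> y"
  proof (rule superjet_if_expansion[OF \<Omega>(1) y _ _ \<eta>])
    show "symmetric_mat (- X)" using X(1) by (simp add: symmetric_mat_iff)
    show "\<exists>r>0. \<forall>h. norm h < r \<longrightarrow> y + h \<in> closure \<Omega> \<longrightarrow>
        - v (y + h) \<le> - v y + - (p - q) \<bullet> h + h \<bullet> (- X *v h) / 2 + e * (norm h)\<^sup>2" if e: "e > 0" for e
    proof -
      obtain r where r: "r > 0" "\<And>h. norm h < r \<Longrightarrow> y + h \<in> Q \<Longrightarrow>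
          v (y + h) \<ge> v y + (p - q) \<bullet> h + (D h \<bullet> h) / 2 - e * (norm h)\<^sup>2"
        using low[OF e] by blast
      have "- v (y + h) \<le> - v y + - (p - q) \<bullet> h + h \<bullet> (- X *v h) / 2 + e * (norm h)\<^sup>2"
        if "norm h < r" "y + h \<in> Q" for h
      proof -
        have "h \<bullet> (- X *v h) = - (D h \<bullet> h)" by (simp add: uminus_matrix_vector_mult X(2))
        then show ?thesis using r(2)[OF that] by (simp add: inner_diff_left)
      qed
      then show ?thesis using r(1) unfolding Q_def by blast
    qed
  qed
  then have jet2: "(p - q, X2) \<in> subjet v \<Omega> y"
    unfolding subjet_iff_superjet_uminus X2_def by (simp add: algebra_simps)
  \<comment> \<open>Either bound extends to the other gradient at the cost of
    \<open>norm q < 1\<close>.\<close>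
  have "norm p \<le> C \<or> norm (p - q) \<le> C" using grad jet1 jet2 x y by auto
  then have pR: "norm p \<le> R" "norm (p - q) \<le> R"
    using norm_triangle_ineq4[of p q] norm_triangle_ineq[of "p - q" q] q \<theta>(2) \<open>C + 1 \<le> R\<close> by auto
  have sym: "symmetric_mat X1" "symmetric_mat X2" using X(1) by (auto simp: X1_def X2_def symmetric_mat_iff mat_def)
  have nI: "norm ((2 * \<eta>) *\<^sub>R (mat 1 :: real^'n^'n)) \<le> 1" using \<eta>J \<eta> by (simp add: J_def[symmetric])
  have nX: "norm X1 \<le> M0 + 1" "norm X2 \<le> M0 + 1"
    unfolding X1_def X2_def
    using norm_triangle_ineq[of X "(2 * \<eta>) *\<^sub>R mat 1"] norm_triangle_ineq4[of X "(2 * \<eta>) *\<^sub>R mat 1"] nI X(3) by linarith+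
  have "X1 - X2 = (4 * \<eta>) *\<^sub>R mat 1" by (simp add: X1_def X2_def scaleR_left_distrib[symmetric])
  then have "norm (X1 - X2) < d1 / 2" using \<eta>J \<eta> by (simp add: J_def[symmetric])
  moreover have "norm (p - (p - q)) < d1 / 2" using q \<theta>(3) by simp
  ultimately have Fd: "\<bar>Fp F \<alpha> p X1 - Fp F \<alpha> (p - q) X2\<bar> < \<mu> / 4"
    using d1(2)[OF pR sym nX] by simp
  define s t where "s = norm p powr \<beta>" and "t = norm (p - q) powr \<beta>"
  have "\<bar>s - t\<bar> \<le> \<mu> / 4 / (B + 1)"
    using d2(2)[OF pR] q \<theta>(4) by (simp add: s_def t_def)
  then have "\<bar>b y\<bar> * \<bar>s - t\<bar> \<le> (B + 1) * (\<mu> / 4 / (B + 1))"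
    using b(2)[OF y] \<open>B \<ge> 0\<close> by (intro mult_mono) auto
  also have "\<dots> = \<mu> / 4" using \<open>B \<ge> 0\<close>
    by (metis add_nonneg_eq_0_iff nonzero_mult_div_cancel_left times_divide_eq_right zero_le_one zero_neq_one)
  finally have bst: "\<bar>b y * (t - s)\<bar> \<le> \<mu> / 4" by (simp add: abs_mult abs_minus_commute)
  have "s \<le> T" unfolding s_def T_def using pR(1) \<open>\<beta> > 0\<close> by (intro powr_mono2) auto
  then have "\<bar>b x - b y\<bar> * s \<le> e1 * T" using near_b by (intro mult_mono) (auto simp: s_def)
  then have "\<bar>(b y - b x) * s\<bar> \<le> e1 * T" by (simp add: abs_mult s_def abs_minus_commute)
  moreover have "b y * t - b x * s = b y * (t - s) + (b y - b x) * s" by (simp add: algebra_simps)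
  moreover have "- Fp F \<alpha> p X1 + b x * s \<le> f x - \<mu>" using strict[OF x jet1 pR(1)] by (simp add: s_def)
  moreover have "f y \<le> - Fp F \<alpha> (p - q) X2 + b y * t" using super[OF y jet2] by (simp add: t_def)
  ultimately show False using Fd bst near_f e1T \<open>\<mu> > 0\<close> by linarith
qed

section \<open>Perturbing the subsolution\<close>

lemma superjet_gradient_bound:
  assumes lip: "C-lipschitz_on \<Omega> u" and x: "x \<in> \<Omega>" and jet: "(p, X) \<in> superjet u \<Omega> x"
  shows "norm p \<le> C"
proof -
  obtain r where r: "r > 0" "ball x r \<subseteq> \<Omega>" "\<And>y. y \<in> ball x r \<Longrightarrow> u y \<le> quadratic (u x) p X x y"
    and X: "symmetric_mat X" using jet by (auto simp: superjet_def)
  show ?thesis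
  proof (rule Lipschitz_touching_gradient_bound[OF _ r(1)])
    show "\<bar>u y - u x\<bar> \<le> C * norm (y - x)" if "y \<in> ball x r" for y
      using lipschitz_onD[OF lip, of y x] that r(2) x by (auto simp: dist_norm dist_real_def)
    show "(quadratic (u x) p X x has_derivative (\<bullet>) p) (at x)"
      using C2_with_quadratic[OF X, of "u x" p x "{x}"] by (simp add: C2_with_def)
    show "u y - quadratic (u x) p X x y \<le> u x - quadratic (u x) p X x x" if "y \<in> ball x r" for y
      using r(3)[OF that] by (simp add: quadratic_def)
  qed
qed

lemma subjet_gradient_bound:
  assumes "C-lipschitz_on \<Omega> v" "x \<in> \<Omega>" "(p, X) \<in> subjet v \<Omega> x"
  shows "norm p \<le> C"
  using superjet_gradient_bound[of C \<Omega> "\<lambda>x. - v x" x "- p" "- X"] assms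
  by (simp add: subjet_iff_superjet_uminus lipschitz_on_def dist_real_def abs_minus_commute)

lemma visc_super_subjet:
  assumes super: "visc_super F \<alpha> \<beta> b f \<Omega> v" and x: "x \<in> \<Omega>" and jet: "(p, X) \<in> subjet v \<Omega> x"
  shows "f x \<le> - Fp F \<alpha> p X + b x * norm p powr \<beta>"
proof -
  obtain r where r: "r > 0" "ball x r \<subseteq> \<Omega>" "\<And>y. y \<in> ball x r \<Longrightarrow> quadratic (v x) p X x y \<le> v y"
    and X: "symmetric_mat X" using jet by (auto simp: subjet_def)
  have "\<forall>y\<in>ball x r. v y - quadratic (v x) p X x y \<ge> v x - quadratic (v x) p X x x"
    using r(3) by (auto simp: quadratic_def)
  with super[unfolded visc_super_def] x r(1,2) C2_with_quadratic[OF X, of "v x" p x "ball x r"]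
  have "- Fp F \<alpha> (p + X *v (x - x)) X + b x * norm (p + X *v (x - x)) powr \<beta> \<ge> f x" by blast
  then show ?thesis by simp
qed

lemma visc_sub_touching:
  assumes sub: "visc_sub F \<alpha> \<beta> b f \<Omega> u" and x: "x \<in> \<Omega>" and r: "r > 0" "ball x r \<subseteq> \<Omega>"
    and "C2_with \<phi> g H (ball x r)" "\<And>y. y \<in> ball x r \<Longrightarrow> u y - \<phi> y \<le> u x - \<phi> x"
  shows "- Fp F \<alpha> (g x) (H x) + b x * norm (g x) powr \<beta> \<le> f x"
  using assms unfolding visc_sub_def by blast

lemma powr_diff_le:
  fixes s t :: real
  assumes "0 \<le> s" "s \<le> t" "t \<le> M" "\<beta> \<ge> 1"
  shows "t powr \<beta> - s powr \<beta> \<le> \<beta> * M powr (\<beta> - 1) * (t - s)"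
proof (cases "s = t")
  case False
  then have "s < t" using assms by simp
  moreover have "continuous_on {s..t} (\<lambda>x. x powr \<beta>)"
    using assms by (intro continuous_on_powr' continuous_intros) auto
  moreover have d: "((\<lambda>x. x powr \<beta>) has_real_derivative \<beta> * x powr (\<beta> - 1)) (at x)" if "s < x" for x
    using that assms by (auto intro!: derivative_eq_intros)
  ultimately obtain \<xi> l where \<xi>: "s < \<xi>" "\<xi> < t" "((\<lambda>x. x powr \<beta>) has_real_derivative l) (at \<xi>)"
    "t powr \<beta> - s powr \<beta> = (t - s) * l"
    using MVT[of s t "\<lambda>x. x powr \<beta>"] by (metis real_differentiable_def)
  then have "l = \<beta> * \<xi> powr (\<beta> - 1)" using DERIV_unique d by blast
  moreover have "\<beta> * \<xi> powr (\<beta> - 1) \<le> \<beta> * M powr (\<beta> - 1)"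
    using \<xi> assms by (intro mult_left_mono powr_mono2) auto
  ultimately have "(t - s) * l \<le> (t - s) * (\<beta> * M powr (\<beta> - 1))"
    using \<open>s < t\<close> by (intro mult_left_mono) auto
  then show ?thesis using \<xi>(4) by (simp add: mult.commute)
qed simp

lemma abs_powr_diff_le:
  fixes s t :: real
  assumes "0 \<le> s" "0 \<le> t" "s \<le> M" "t \<le> M" "\<beta> \<ge> 1"
  shows "\<bar>s powr \<beta> - t powr \<beta>\<bar> \<le> \<beta> * M powr (\<beta> - 1) * \<bar>s - t\<bar>"
proof (cases "s \<le> t")
  case True
  then show ?thesis using powr_diff_le[of s t M \<beta>] powr_mono2[of \<beta> s t] assms by simp
next
  case False
  then show ?thesis using powr_diff_le[of t s M \<beta>] powr_mono2[of \<beta> t s] assms by simp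
qed

lemma Fp_zero: "Fp F 0 p M = F M"
proof -
  have "Theta 0 p ** M ** Theta 0 p = M" unfolding Theta_conj by (simp add: abs_pow_def vec_eq_iff)
  then show ?thesis by (simp add: Fp_def)
qed

lemma structural_F_outer:
  assumes F: "structural_F F a A" and X: "symmetric_mat X" and "\<kappa> \<ge> 0"
  shows "F (X - \<kappa> *\<^sub>R outer_mat w w) + a * \<kappa> * (w \<bullet> w) \<le> F X"
proof -
  define N where "N = \<kappa> *\<^sub>R outer_mat w w"
  have "symmetric_mat N" "symmetric_mat (X - N)"
    using X symmetric_mat_outer[of w] by (auto simp: N_def symmetric_mat_iff)
  moreover have "psd_mat N"
    using psd_mat_outer[of w] \<open>\<kappa> \<ge> 0\<close> by (simp add: N_def psd_mat_def scaleR_matrix_vector_assoc[symmetric])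
  ultimately have "a * trace N \<le> F (X - N + N) - F (X - N)"
    using F unfolding structural_F_def by blast
  moreover have "trace N = \<kappa> * (w \<bullet> w)"
    by (simp add: N_def trace_outer[symmetric] trace_def sum_distrib_left)
  ultimately show ?thesis by (simp add: N_def mult.assoc)
qed

section \<open>The case \<alpha> = 0\<close>

lemma comparison_nondegenerate:
  fixes F :: "real^'n^'n \<Rightarrow> real" and u v b f :: "real^'n \<Rightarrow> real"
  assumes \<Omega>: "open \<Omega>" "bounded \<Omega>" and F: "structural_F F a A" and "\<beta> > 1"
    and b: "continuous_on \<Omega> b" "\<And>x. x \<in> \<Omega> \<Longrightarrow> \<bar>b x\<bar> \<le> B" and f: "continuous_on \<Omega> f"
    and sub: "visc_sub F 0 \<beta> b f \<Omega> u" and super: "visc_super F 0 \<beta> b f \<Omega> v"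
    and u: "usc_on (closure \<Omega>) u" and v: "lsc_on (closure \<Omega>) v"
    and lip: "C-lipschitz_on \<Omega> u \<or> C-lipschitz_on \<Omega> v"
    and bdry: "\<And>x. x \<in> frontier \<Omega> \<Longrightarrow> u x \<le> v x" and x1: "x1 \<in> \<Omega>"
  shows "u x1 \<le> v x1"
proof -
  have "a > 0" using F by (simp add: structural_F_def)
  have "C \<ge> 0" using lip lipschitz_on_nonneg by blast
  have "B \<ge> 0" using b(2)[OF x1] by simp
  \<comment> \<open>One unit is for the gradient of the perturbation, the other for the tilt
    \<open>q\<close>.\<close>
  define R where "R = C + 2"
  define L where "L = B * (\<beta> * (R + 1) powr (\<beta> - 1))"
  \<comment> \<open>A perturbation with gradient \<open>t *\<^sub>R e\<close> has the second
    derivative \<open>t * lam\<close> along \<open>e\<close>, so ellipticity yields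
    \<open>a * lam * t = L * t + t\<close>. The part \<open>L * t\<close> pays for the change of
    \<open>b x * norm p powr \<beta>\<close>, whose two arguments lie in the ball of radius
    \<open>R + 1\<close>; the surplus \<open>t\<close> is the strictness.\<close>
  define lam where "lam = (L + 1) / a"
  have "L \<ge> 0" using \<open>B \<ge> 0\<close> \<open>\<beta> > 1\<close> by (simp add: L_def)
  then have "lam > 0" and alam: "a * lam = L + 1" using \<open>a > 0\<close> by (auto simp: lam_def)
  obtain e :: "real^'n" where e: "norm e = 1" using vector_choose_size[of 1] by auto
  obtain D where D: "\<And>x. x \<in> closure \<Omega> \<Longrightarrow> norm x \<le> D"
    using bounded_closure[OF \<Omega>(2)] by (auto simp: bounded_iff)
  have eD: "\<bar>e \<bullet> x\<bar> \<le> D" if "x \<in> closure \<Omega>" for x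
    using Cauchy_Schwarz_ineq2[of e x] D[OF that] e by simp
  \<comment> \<open>The second condition keeps the gradient of the perturbation at norm at most
    1.\<close>
  have main: "u x1 \<le> v x1 + \<epsilon> * exp (lam * D)" if \<epsilon>: "\<epsilon> > 0" "\<epsilon> * lam * exp (lam * D) \<le> 1" for \<epsilon>
  proof -
    define E where "E = (\<lambda>x. exp (lam * (e \<bullet> x)))"
    define z where "z = (\<lambda>x. u x + \<epsilon> * E x)"
    \<comment> \<open>A lower bound on the closure of \<Omega> for the slope
      \<open>\<epsilon> * lam * E x\<close>, and hence for the surplus left over by
      \<open>lam\<close>.\<close>
    define \<mu> where "\<mu> = \<epsilon> * lam * exp (- (lam * D))"
    have "\<mu> > 0" using \<epsilon> \<open>lam > 0\<close> by (simp add: \<mu>_def)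
    have E_bounds: "exp (- (lam * D)) \<le> E x" "E x \<le> exp (lam * D)" if "x \<in> closure \<Omega>" for x
      using eD[OF that] mult_left_mono[of "e \<bullet> x" D lam] mult_left_mono[of "- D" "e \<bullet> x" lam] \<open>lam > 0\<close>
      by (auto simp: E_def abs_le_iff)
    have E1: "\<epsilon> * lam * E x \<le> 1" "\<mu> \<le> \<epsilon> * lam * E x" "0 \<le> \<epsilon> * lam * E x" if "x \<in> closure \<Omega>" for x
    proof -
      have "\<epsilon> * lam * E x \<le> \<epsilon> * lam * exp (lam * D)"
        using E_bounds(2)[OF that] \<epsilon> \<open>lam > 0\<close> by (intro mult_left_mono) auto
      then show "\<epsilon> * lam * E x \<le> 1" using \<epsilon>(2) by linarith
      show "\<mu> \<le> \<epsilon> * lam * E x"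
        unfolding \<mu>_def using E_bounds(1)[OF that] \<epsilon> \<open>lam > 0\<close> by (intro mult_left_mono) auto
      show "0 \<le> \<epsilon> * lam * E x" using \<epsilon> \<open>lam > 0\<close> by (simp add: E_def)
    qed
    have E_C2: "C2_with (\<lambda>x. \<epsilon> * E x) (\<lambda>x. (\<epsilon> * lam * E x) *\<^sub>R e) (\<lambda>x. (\<epsilon> * lam\<^sup>2 * E x) *\<^sub>R outer_mat e e) S" for S
    proof -
      have q: "quadratic 0 e 0 0 = (\<lambda>x. e \<bullet> x)" by (auto simp: quadratic_def)
      have "C2_with (\<lambda>x. e \<bullet> x) (\<lambda>y. e) (\<lambda>y. 0) S"
        using C2_with_quadratic[of 0 0 e 0 S] by (simp add: q symmetric_mat_iff)
      moreover have "((\<lambda>s. \<epsilon> * exp (lam * s)) has_real_derivative \<epsilon> * lam * exp (lam * s)) (at s)" for s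
        by (auto intro!: derivative_eq_intros)
      moreover have "((\<lambda>s. \<epsilon> * lam * exp (lam * s)) has_real_derivative \<epsilon> * lam\<^sup>2 * exp (lam * s)) (at s)" for s
        by (auto intro!: derivative_eq_intros simp: power2_eq_square)
      moreover have "continuous_on ((\<lambda>x. e \<bullet> x) ` S) (\<lambda>s. \<epsilon> * lam\<^sup>2 * exp (lam * s))"
        by (intro continuous_intros)
      ultimately have "C2_with (\<lambda>x. \<epsilon> * exp (lam * (e \<bullet> x))) (\<lambda>x. (\<epsilon> * lam * exp (lam * (e \<bullet> x))) *\<^sub>R e)
          (\<lambda>x. (\<epsilon> * lam * exp (lam * (e \<bullet> x))) *\<^sub>R 0 + (\<epsilon> * lam\<^sup>2 * exp (lam * (e \<bullet> x))) *\<^sub>R outer_mat e e) S"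
        by (rule C2_with_compose)
      then show ?thesis by (simp add: E_def)
    qed
    have touch: "\<exists>r>0. ball x r \<subseteq> \<Omega> \<and> symmetric_mat X \<and>
        C2_with (\<lambda>y. quadratic (z x) p X x y - \<epsilon> * E y) (\<lambda>y. p + X *v (y - x) - (\<epsilon> * lam * E y) *\<^sub>R e)
          (\<lambda>y. X - (\<epsilon> * lam\<^sup>2 * E y) *\<^sub>R outer_mat e e) (ball x r) \<and>
        (\<forall>y\<in>ball x r. u y - (quadratic (z x) p X x y - \<epsilon> * E y) \<le> u x - (quadratic (z x) p X x x - \<epsilon> * E x))"
      if jet: "(p, X) \<in> superjet z \<Omega> x" for x p X
    proof -
      obtain r where r: "r > 0" "ball x r \<subseteq> \<Omega>" "\<And>y. y \<in> ball x r \<Longrightarrow> z y \<le> quadratic (z x) p X x y"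
        and X: "symmetric_mat X" using jet by (auto simp: superjet_def)
      have "u y - (quadratic (z x) p X x y - \<epsilon> * E y) \<le> u x - (quadratic (z x) p X x x - \<epsilon> * E x)"
        if "y \<in> ball x r" for y
        using r(3)[OF that] by (simp add: z_def quadratic_def)
      moreover have "C2_with (\<lambda>y. quadratic (z x) p X x y - \<epsilon> * E y) (\<lambda>y. p + X *v (y - x) - (\<epsilon> * lam * E y) *\<^sub>R e)
          (\<lambda>y. X - (\<epsilon> * lam\<^sup>2 * E y) *\<^sub>R outer_mat e e) (ball x r)"
        by (rule C2_with_diff[OF C2_with_quadratic[OF X] E_C2])
      ultimately show ?thesis using r(1,2) X by blast
    qed
    have "z x1 \<le> v x1 + \<epsilon> * exp (lam * D)"
    proof (rule comparison_of_strict_subsolution[OF \<Omega> F order_refl _ b f _ v \<open>\<mu> > 0\<close> _ _ _ _ _ x1])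
      show "0 < \<beta>" using \<open>\<beta> > 1\<close> by simp
      show "usc_on (closure \<Omega>) z"
        unfolding z_def E_def by (intro usc_on_add u usc_on_continuous continuous_intros)
      show "(C + 1) + 1 \<le> R" by (simp add: R_def)
      show "z x \<le> v x + \<epsilon> * exp (lam * D)" if "x \<in> frontier \<Omega>" for x
      proof -
        have "x \<in> closure \<Omega>" using that by (simp add: frontier_def)
        from mult_left_mono[OF E_bounds(2)[OF this], of \<epsilon>] show ?thesis
          using bdry[OF that] \<epsilon>(1) unfolding z_def by linarith
      qed
      show "f x \<le> - Fp F 0 p X + b x * norm p powr \<beta>" if "x \<in> \<Omega>" "(p, X) \<in> subjet v \<Omega> x" for x p X
        using visc_super_subjet[OF super that] .
      show "- Fp F 0 p X + b x * norm p powr \<beta> \<le> f x - \<mu>"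
        if x: "x \<in> \<Omega>" and jet: "(p, X) \<in> superjet z \<Omega> x" and p: "norm p \<le> R" for x p X
      proof -
        define t where "t = \<epsilon> * lam * E x"
        have xc: "x \<in> closure \<Omega>" using x closure_subset by blast
        obtain r where r: "r > 0" "ball x r \<subseteq> \<Omega>" and X: "symmetric_mat X" and
          C2: "C2_with (\<lambda>y. quadratic (z x) p X x y - \<epsilon> * E y) (\<lambda>y. p + X *v (y - x) - (\<epsilon> * lam * E y) *\<^sub>R e)
          (\<lambda>y. X - (\<epsilon> * lam\<^sup>2 * E y) *\<^sub>R outer_mat e e) (ball x r)" and
          le: "\<And>y. y \<in> ball x r \<Longrightarrow> u y - (quadratic (z x) p X x y - \<epsilon> * E y) \<le> u x - (quadratic (z x) p X x x - \<epsilon> * E x)"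
          using touch[OF jet] by blast
        have s: "- F (X - (t * lam) *\<^sub>R outer_mat e e) + b x * norm (p - t *\<^sub>R e) powr \<beta> \<le> f x"
          using visc_sub_touching[OF sub x r C2 le] by (simp add: Fp_zero t_def power2_eq_square mult_ac)
        have t: "0 \<le> t" "t \<le> 1" "\<mu> \<le> t" using E1[OF xc] by (auto simp: t_def)
        have "F (X - (t * lam) *\<^sub>R outer_mat e e) + a * (t * lam) * (e \<bullet> e) \<le> F X"
          using t(1) \<open>lam > 0\<close> by (intro structural_F_outer[OF F X]) simp
        moreover have "e \<bullet> e = 1" using e by (simp add: norm_eq_1)
        moreover have "a * (t * lam) = t * (a * lam)" by simp
        ultimately have F1: "F (X - (t * lam) *\<^sub>R outer_mat e e) + (L * t + t) \<le> F X"
          unfolding alam by (simp add: algebra_simps)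
        have n: "\<bar>norm p - norm (p - t *\<^sub>R e)\<bar> \<le> t"
          using norm_triangle_ineq3[of p "p - t *\<^sub>R e"] t(1) e by simp
        have "\<bar>norm p powr \<beta> - norm (p - t *\<^sub>R e) powr \<beta>\<bar> \<le> \<beta> * (R + 1) powr (\<beta> - 1) * \<bar>norm p - norm (p - t *\<^sub>R e)\<bar>"
          using p n t \<open>\<beta> > 1\<close> by (intro abs_powr_diff_le) auto
        also have "\<dots> \<le> \<beta> * (R + 1) powr (\<beta> - 1) * t" using n \<open>\<beta> > 1\<close> by (intro mult_left_mono) auto
        finally have "\<bar>b x\<bar> * \<bar>norm p powr \<beta> - norm (p - t *\<^sub>R e) powr \<beta>\<bar> \<le> B * (\<beta> * (R + 1) powr (\<beta> - 1) * t)"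
          using b(2)[OF x] \<open>B \<ge> 0\<close> by (intro mult_mono) auto
        then have "\<bar>b x * (norm p powr \<beta> - norm (p - t *\<^sub>R e) powr \<beta>)\<bar> \<le> L * t"
          by (simp add: L_def abs_mult mult.assoc)
        then have "b x * norm p powr \<beta> - b x * norm (p - t *\<^sub>R e) powr \<beta> \<le> L * t"
          by (simp add: right_diff_distrib)
        then show ?thesis using s F1 t(3) by (simp add: Fp_zero)
      qed
      show "(\<forall>x\<in>\<Omega>. \<forall>(p, X)\<in>superjet z \<Omega> x. norm p \<le> C + 1) \<or> (\<forall>x\<in>\<Omega>. \<forall>(p, X)\<in>subjet v \<Omega> x. norm p \<le> C + 1)"
        using lip
      proof
        assume lip: "C-lipschitz_on \<Omega> v"
        then show ?thesis using subjet_gradient_bound[OF lip] by fastforce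
      next
        assume lip: "C-lipschitz_on \<Omega> u"
        have "norm p \<le> C + 1" if x: "x \<in> \<Omega>" and jet: "(p, X) \<in> superjet z \<Omega> x" for x p X
        proof -
          define t where "t = \<epsilon> * lam * E x"
          have xc: "x \<in> closure \<Omega>" using x closure_subset by blast
          obtain r where r: "r > 0" "ball x r \<subseteq> \<Omega>" and
            C2: "C2_with (\<lambda>y. quadratic (z x) p X x y - \<epsilon> * E y) (\<lambda>y. p + X *v (y - x) - (\<epsilon> * lam * E y) *\<^sub>R e)
            (\<lambda>y. X - (\<epsilon> * lam\<^sup>2 * E y) *\<^sub>R outer_mat e e) (ball x r)" and
            le: "\<And>y. y \<in> ball x r \<Longrightarrow> u y - (quadratic (z x) p X x y - \<epsilon> * E y) \<le> u x - (quadratic (z x) p X x x - \<epsilon> * E x)"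
            using touch[OF jet] by blast
          have "norm (p + X *v (x - x) - (\<epsilon> * lam * E x) *\<^sub>R e) \<le> C"
          proof (rule Lipschitz_touching_gradient_bound[where f = u and
                \<phi> = "\<lambda>y. quadratic (z x) p X x y - \<epsilon> * E y", OF _ r(1)])
            show "u y - (quadratic (z x) p X x y - \<epsilon> * E y) \<le> u x - (quadratic (z x) p X x x - \<epsilon> * E x)"
              if "y \<in> ball x r" for y using le[OF that] .
            show "\<bar>u y - u x\<bar> \<le> C * norm (y - x)" if "y \<in> ball x r" for y
              using lipschitz_onD[OF lip, of y x] that r(2) x by (auto simp: dist_norm dist_real_def)
            show "((\<lambda>y. quadratic (z x) p X x y - \<epsilon> * E y) has_derivative
                (\<bullet>) (p + X *v (x - x) - (\<epsilon> * lam * E x) *\<^sub>R e)) (at x)"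
              using C2 r(1) unfolding C2_with_def by (meson centre_in_ball)
          qed
          then have "norm (p - t *\<^sub>R e) \<le> C" by (simp add: t_def)
          moreover have "norm (t *\<^sub>R e) \<le> 1" using E1[OF xc] e by (simp add: t_def abs_mult)
          ultimately show ?thesis using norm_triangle_sub[of p "t *\<^sub>R e"] by simp
        qed
        then show ?thesis by auto
      qed
    qed
    moreover have "u x1 \<le> z x1" using \<epsilon>(1) by (simp add: z_def E_def)
    ultimately show ?thesis by simp
  qed
  show ?thesis
  proof (rule field_le_epsilon)
    fix d :: real assume "d > 0"
    define \<epsilon> where "\<epsilon> = min (d / exp (lam * D)) (1 / (lam * exp (lam * D)))"
    have "\<epsilon> > 0" using \<open>d > 0\<close> \<open>lam > 0\<close> by (simp add: \<epsilon>_def)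
    have "\<epsilon> \<le> d / exp (lam * D)" "\<epsilon> \<le> 1 / (lam * exp (lam * D))" by (auto simp: \<epsilon>_def)
    then have "\<epsilon> * exp (lam * D) \<le> d" "\<epsilon> * lam * exp (lam * D) \<le> 1"
      using \<open>lam > 0\<close> by (auto simp: pos_le_divide_eq mult.assoc)
    then show "u x1 \<le> v x1 + d" using main[OF \<open>\<epsilon> > 0\<close>] by simp
  qed
qed

section \<open>The case \<alpha> > 0\<close>

lemma usc_on_mono_compose:
  fixes u :: "'a::metric_space \<Rightarrow> real" and \<psi> :: "real \<Rightarrow> real"
  assumes u: "usc_on S u" and I: "\<And>x. x \<in> S \<Longrightarrow> u x \<in> I"
    and mono: "\<And>s t. s \<in> I \<Longrightarrow> t \<in> I \<Longrightarrow> s \<le> t \<Longrightarrow> \<psi> s \<le> \<psi> t" and cont: "continuous_on I \<psi>"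
  shows "usc_on S (\<lambda>x. \<psi> (u x))"
  unfolding usc_on_def
proof (intro ballI allI impI)
  fix x e assume x: "x \<in> S" and e: "(e::real) > 0"
  obtain d where d: "d > 0" "\<And>s. s \<in> I \<Longrightarrow> dist s (u x) < d \<Longrightarrow> dist (\<psi> s) (\<psi> (u x)) < e"
    using cont I[OF x] e unfolding continuous_on_iff by blast
  obtain r where r: "r > 0" "\<And>y. y \<in> S \<Longrightarrow> dist y x < r \<Longrightarrow> u y < u x + d"
    using u x d(1) unfolding usc_on_def by blast
  have "\<psi> (u y) < \<psi> (u x) + e" if y: "y \<in> S" "dist y x < r" for y
  proof (cases "u y \<le> u x")
    case True
    then show ?thesis using mono[OF I[OF y(1)] I[OF x]] e by simp
  next
    case False
    then have "dist (u y) (u x) < d" using r(2)[OF y] by (simp add: dist_real_def)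
    then show ?thesis using d(2)[OF I[OF y(1)]] by (simp add: dist_real_def)
  qed
  then show "\<exists>d>0. \<forall>y\<in>S. dist y x < d \<longrightarrow> \<psi> (u y) < \<psi> (u x) + e" using r(1) by blast
qed

text \<open>This is \<open>Theta \<alpha> p *v p\<close>: conjugation with
  \<open>Theta \<alpha> p\<close> turns \<open>outer_mat p p\<close> into the outer square of this
  vector.\<close>

definition theta_vec :: "real \<Rightarrow> real^'n \<Rightarrow> real^'n" where
  "theta_vec \<alpha> p = (\<chi> i. abs_pow (p $ i) (\<alpha> / 2) * p $ i)"

text \<open>Each factor \<open>Theta\<close> contributes \<open>\<tau> powr (\<alpha> / 2)\<close>,
  and the matrix one more factor \<open>\<tau>\<close>.\<close>

lemma Theta_conj_scaled:
  assumes "\<alpha> > 0" "\<tau> > 0"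
  shows "Theta \<alpha> (\<tau> *\<^sub>R p) ** (\<tau> *\<^sub>R X - (\<tau> * \<kappa>) *\<^sub>R outer_mat p p) ** Theta \<alpha> (\<tau> *\<^sub>R p) =
    \<tau> powr (\<alpha> + 1) *\<^sub>R (Theta \<alpha> p ** X ** Theta \<alpha> p - \<kappa> *\<^sub>R outer_mat (theta_vec \<alpha> p) (theta_vec \<alpha> p))"
proof -
  have pow: "abs_pow (\<tau> * s) (\<alpha> / 2) = \<tau> powr (\<alpha> / 2) * abs_pow s (\<alpha> / 2)" for s
    using assms by (simp add: abs_pow_def abs_mult powr_mult)
  have \<tau>: "\<tau> powr (\<alpha> + 1) = \<tau> powr (\<alpha> / 2) * \<tau> powr (\<alpha> / 2) * \<tau>"
    using assms by (simp add: powr_add[symmetric] powr_mult_base mult.commute[of _ \<tau>] add.commute)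
  show ?thesis
    unfolding Theta_conj \<tau>
    by (simp add: vec_eq_iff pow outer_mat_def theta_vec_def algebra_simps)
qed

text \<open>The right hand side is the sum of all
  \<open>\<bar>p $ i\<bar> powr (\<alpha> + 2)\<close>, and some component is at least the average
  \<open>norm p / CARD('n)\<close>. So the term produced by the change of unknown controls the full
  gradient, although single entries of \<open>Theta\<close> may vanish.\<close>

lemma theta_vec_coercive:
  fixes p :: "real^'n"
  assumes "\<alpha> \<ge> 0"
  shows "(norm p / CARD('n)) powr (\<alpha> + 2) \<le> theta_vec \<alpha> p \<bullet> theta_vec \<alpha> p"
proof -
  obtain i where i: "norm p / CARD('n) \<le> \<bar>p $ i\<bar>"
  proof (rule ccontr)
    assume "\<not> thesis"
    then have "\<bar>p $ i\<bar> < norm p / CARD('n)" for i using that by (meson not_le)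
    then have "(\<Sum>i\<in>UNIV. \<bar>p $ i\<bar>) < (\<Sum>i\<in>(UNIV::'n set). norm p / CARD('n))"
      by (intro sum_strict_mono) auto
    then show False using norm_le_l1_cart[of p] by simp
  qed
  have "(norm p / CARD('n)) powr (\<alpha> + 2) \<le> \<bar>p $ i\<bar> powr (\<alpha> + 2)"
    using i assms by (intro powr_mono2) auto
  also have "\<dots> = theta_vec \<alpha> p $ i * theta_vec \<alpha> p $ i"
  proof (cases "p $ i = 0 \<or> \<alpha> = 0")
    case True
    then show ?thesis by (auto simp: theta_vec_def abs_pow_def power2_eq_square[symmetric])
  next
    case False
    have "\<bar>p $ i\<bar> powr (\<alpha> + 2) = \<bar>p $ i\<bar> powr (\<alpha> / 2 + \<alpha> / 2) * \<bar>p $ i\<bar> powr 2"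
      by (simp add: powr_add)
    also have "\<dots> = (\<bar>p $ i\<bar> powr (\<alpha> / 2) * \<bar>p $ i\<bar> powr (\<alpha> / 2)) * (p $ i)\<^sup>2"
      unfolding powr_add by simp
    finally show ?thesis using False by (simp add: theta_vec_def abs_pow_def power2_eq_square)
  qed
  also have "\<dots> \<le> theta_vec \<alpha> p \<bullet> theta_vec \<alpha> p"
    unfolding inner_vec_def
    using member_le_sum[of i UNIV "\<lambda>i. theta_vec \<alpha> p $ i * theta_vec \<alpha> p $ i"] by simp
  finally show ?thesis .
qed

text \<open>Up to the radius \<open>\<rho>\<close> the left hand side is below \<open>m / 2\<close>.
  Beyond it, \<open>\<beta> \<le> \<alpha> + 2\<close> lets a constant multiple of
  \<open>norm p powr (\<alpha> + 2)\<close> dominate \<open>norm p powr \<beta>\<close>. Writing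
  \<open>B + 1\<close> avoids division by zero.\<close>

lemma gradient_term_absorption:
  fixes a B m \<alpha> \<beta> :: real
  assumes "a > 0" "B \<ge> 0" "m > 0" "\<alpha> \<ge> 0" "0 < \<beta>" "\<beta> \<le> \<alpha> + 2"
  obtains K where "K > 0"
    "\<And>p :: real^'n. B * norm p powr \<beta> \<le> m / 2 + a * K * (theta_vec \<alpha> p \<bullet> theta_vec \<alpha> p)"
proof -
  define n where "n = real CARD('n)"
  have "n > 0" by (simp add: n_def)
  define \<rho> where "\<rho> = (m / 2 / (B + 1)) powr (1 / \<beta>)"
  have "\<rho> > 0" using assms by (simp add: \<rho>_def)
  have \<rho>: "\<rho> powr \<beta> = m / 2 / (B + 1)" using assms by (simp add: \<rho>_def powr_powr)
  define K where "K = (B + 1) * \<rho> powr (\<beta> - \<alpha> - 2) * n powr (\<alpha> + 2) / a"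
  have "K > 0" using assms \<open>\<rho> > 0\<close> \<open>n > 0\<close> by (simp add: K_def)
  have "B * norm p powr \<beta> \<le> m / 2 + a * K * (theta_vec \<alpha> p \<bullet> theta_vec \<alpha> p)" for p :: "real^'n"
  proof (cases "norm p \<le> \<rho>")
    case True
    then have "norm p powr \<beta> \<le> m / 2 / (B + 1)" using \<rho> assms by (metis norm_ge_zero powr_mono2 less_imp_le)
    then have "(B + 1) * norm p powr \<beta> \<le> m / 2" using assms by (simp add: pos_le_divide_eq algebra_simps)
    moreover have "B * norm p powr \<beta> \<le> (B + 1) * norm p powr \<beta>" by (intro mult_right_mono) auto
    moreover have "0 \<le> a * K * (theta_vec \<alpha> p \<bullet> theta_vec \<alpha> p)" using \<open>K > 0\<close> assms by simp
    ultimately show ?thesis by linarith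
  next
    case False
    then have "norm p > 0" using \<open>\<rho> > 0\<close> by linarith
    have "norm p powr \<beta> = norm p powr (\<beta> - \<alpha> - 2) * norm p powr (\<alpha> + 2)"
      by (simp add: powr_add[symmetric])
    also have "\<dots> \<le> \<rho> powr (\<beta> - \<alpha> - 2) * norm p powr (\<alpha> + 2)"
      using False \<open>\<rho> > 0\<close> assms by (intro mult_right_mono powr_mono2') auto
    also have "norm p powr (\<alpha> + 2) = n powr (\<alpha> + 2) * (norm p / n) powr (\<alpha> + 2)"
      using \<open>n > 0\<close> \<open>norm p > 0\<close> by (simp add: powr_mult[symmetric])
    also have "\<rho> powr (\<beta> - \<alpha> - 2) * (n powr (\<alpha> + 2) * (norm p / n) powr (\<alpha> + 2))
        \<le> \<rho> powr (\<beta> - \<alpha> - 2) * (n powr (\<alpha> + 2) * (theta_vec \<alpha> p \<bullet> theta_vec \<alpha> p))"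
      using theta_vec_coercive[OF \<open>\<alpha> \<ge> 0\<close>, of p] by (intro mult_left_mono) (auto simp: n_def)
    finally have "(B + 1) * norm p powr \<beta> \<le> (B + 1) * (\<rho> powr (\<beta> - \<alpha> - 2) * (n powr (\<alpha> + 2) * (theta_vec \<alpha> p \<bullet> theta_vec \<alpha> p)))"
      using assms by (intro mult_left_mono) auto
    also have "\<dots> = a * K * (theta_vec \<alpha> p \<bullet> theta_vec \<alpha> p)" using \<open>a > 0\<close> by (simp add: K_def)
    finally have "(B + 1) * norm p powr \<beta> \<le> a * K * (theta_vec \<alpha> p \<bullet> theta_vec \<alpha> p)" .
    moreover have "B * norm p powr \<beta> \<le> (B + 1) * norm p powr \<beta>" by (intro mult_right_mono) auto
    ultimately show ?thesis using \<open>m > 0\<close> by linarith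
  qed
  then show ?thesis using that \<open>K > 0\<close> by blast
qed

text \<open>Here \<open>u = - ln (exp (- K z) + \<delta>) / K\<close> and \<open>\<tau> = du/dz\<close>, so that \<open>d\<^sup>2u/dz\<^sup>2 = - K \<tau> (1 - \<tau>)\<close>: the jet
  \<open>(p, X)\<close> of \<open>z\<close> becomes the jet of \<open>u\<close> in the last assumption.\<close>
lemma transformed_inequality:
  fixes F :: "real^'n^'n \<Rightarrow> real" and p :: "real^'n"
  assumes F: "structural_F F a A" and X: "symmetric_mat X"
    and exps: "\<alpha> > 0" "\<alpha> + 1 < \<beta>" "\<beta> \<le> \<alpha> + 2" and "K > 0" "m > 0"
    and \<tau>: "0 < \<tau>" "\<tau> < 1" and \<sigma>: "\<sigma> \<le> 1 - \<tau>" and fx: "fx \<le> - m" and bx: "\<bar>bx\<bar> \<le> B"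
    and absorb: "B * norm p powr \<beta> \<le> m / 2 + a * K * (theta_vec \<alpha> p \<bullet> theta_vec \<alpha> p)"
    and ineq: "- Fp F \<alpha> (\<tau> *\<^sub>R p) (\<tau> *\<^sub>R X - (\<tau> * (K * (1 - \<tau>))) *\<^sub>R outer_mat p p)
        + bx * norm (\<tau> *\<^sub>R p) powr \<beta> \<le> fx"
  shows "- Fp F \<alpha> p X + bx * norm p powr \<beta> \<le> fx - \<sigma> * m / 2"
proof -
  define w where "w = theta_vec \<alpha> p"
  define \<kappa> where "\<kappa> = K * (1 - \<tau>)"
  define Y where "Y = Theta \<alpha> p ** X ** Theta \<alpha> p"
  define G where "G = F (Y - \<kappa> *\<^sub>R outer_mat w w)"
  define P where "P = norm p powr \<beta>"
  have "\<kappa> \<ge> 0" using \<tau> \<open>K > 0\<close> by (simp add: \<kappa>_def)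
  have Y: "symmetric_mat Y" unfolding Y_def by (rule symmetric_mat_Theta_conj[OF X])
  have "symmetric_mat (Y - \<kappa> *\<^sub>R outer_mat w w)"
    using Y symmetric_mat_outer[of w] by (simp add: symmetric_mat_iff)
  then have hom: "F (\<tau> powr (\<alpha> + 1) *\<^sub>R (Y - \<kappa> *\<^sub>R outer_mat w w)) = \<tau> powr (\<alpha> + 1) * G"
    using F \<tau>(1) unfolding structural_F_def G_def by simp
  have "P \<ge> 0" by (simp add: P_def)
  have npow: "norm (\<tau> *\<^sub>R p) powr \<beta> = \<tau> powr \<beta> * P"
    using \<tau> by (simp add: P_def powr_mult)
  have main: "- (\<tau> powr (\<alpha> + 1) * G) + bx * (\<tau> powr \<beta> * P) \<le> fx"
    using ineq unfolding Fp_def \<kappa>_def[symmetric] Theta_conj_scaled[OF \<open>\<alpha> > 0\<close> \<tau>(1)] Y_def[symmetric]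
      w_def[symmetric] hom npow .
  \<comment> \<open>Multiplying by \<open>T\<close> normalises the second-order term. The gradient
    term keeps the factor \<open>\<gamma>\<close>, and the two bounds on \<beta> say exactly that
    \<open>\<tau> \<le> \<gamma> \<le> 1\<close>.\<close>
  define T where "T = \<tau> powr (- (\<alpha> + 1))"
  define \<gamma> where "\<gamma> = \<tau> powr (\<beta> - \<alpha> - 1)"
  have T1: "T * \<tau> powr (\<alpha> + 1) = 1" "T * \<tau> powr \<beta> = \<gamma>"
    using \<tau>(1) by (auto simp: T_def \<gamma>_def powr_add[symmetric] algebra_simps)
  have "T > 0" using \<tau>(1) by (simp add: T_def)
  have "T * (- (\<tau> powr (\<alpha> + 1) * G) + bx * (\<tau> powr \<beta> * P)) \<le> T * fx"
    using main \<open>T > 0\<close> by (intro mult_left_mono) auto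
  also have "T * (- (\<tau> powr (\<alpha> + 1) * G) + bx * (\<tau> powr \<beta> * P)) =
      - (T * \<tau> powr (\<alpha> + 1)) * G + bx * ((T * \<tau> powr \<beta>) * P)" by (simp add: algebra_simps)
  finally have G: "- G + bx * (\<gamma> * P) \<le> T * fx" unfolding T1 by simp
  \<comment> \<open>Since \<open>T\<close> is at least \<open>1 / \<tau>\<close>, and hence at least
    \<open>2 - \<tau>\<close>, multiplication by \<open>T\<close> lowers the negative right hand
    side by at least \<open>(1 - \<tau>) * m\<close>.\<close>
  have "\<tau> powr (\<alpha> + 1) \<le> \<tau> powr 1" using \<tau> exps by (intro powr_mono') auto
  then have "T * \<tau> powr (\<alpha> + 1) \<le> T * \<tau>" using \<open>T > 0\<close> \<tau> by simp
  then have "1 \<le> T * \<tau>" by (simp add: T1)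
  moreover have "\<tau> * (2 - \<tau>) \<le> 1" using zero_le_power2[of "1 - \<tau>"] by (simp add: power2_eq_square algebra_simps)
  ultimately have "\<tau> * (2 - \<tau>) \<le> \<tau> * T" by (simp add: mult.commute)
  then have T2: "1 + (1 - \<tau>) \<le> T" using \<tau>(1) by simp
  have "T * fx \<le> (1 + (1 - \<tau>)) * fx" using T2 fx \<open>m > 0\<close> by (intro mult_right_mono_neg) auto
  also have "\<dots> \<le> fx - (1 - \<tau>) * m"
    using mult_left_mono[OF fx, of "1 - \<tau>"] \<tau> by (simp add: algebra_simps)
  finally have Tf: "T * fx \<le> fx - (1 - \<tau>) * m" .
  have "\<tau> powr 1 \<le> \<gamma>" "\<gamma> \<le> \<tau> powr 0" unfolding \<gamma>_def using \<tau> exps by (intro powr_mono'; simp)+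
  then have \<gamma>: "\<tau> \<le> \<gamma>" "\<gamma> \<le> 1" using \<tau> by auto
  have "bx * ((1 - \<gamma>) * P) \<le> B * ((1 - \<tau>) * P)"
    using bx \<gamma> \<open>P \<ge> 0\<close> by (intro mult_mono) auto
  also have "\<dots> = (1 - \<tau>) * (B * P)" by simp
  also have "\<dots> \<le> (1 - \<tau>) * (m / 2 + a * K * (w \<bullet> w))"
    using absorb \<tau> unfolding P_def w_def by (intro mult_left_mono) auto
  finally have bP: "bx * P - bx * (\<gamma> * P) \<le> (1 - \<tau>) * m / 2 + a * \<kappa> * (w \<bullet> w)"
    by (simp add: \<kappa>_def algebra_simps)
  have FY: "G + a * \<kappa> * (w \<bullet> w) \<le> F Y" unfolding G_def by (rule structural_F_outer[OF F Y \<open>\<kappa> \<ge> 0\<close>])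
  \<comment> \<open>Ellipticity cancels the term with \<open>w \<bullet> w\<close>; half of the gain
    \<open>(1 - \<tau>) * m\<close> goes to the gradient term, and the other half is the
    margin.\<close>
  have "\<sigma> * m \<le> (1 - \<tau>) * m" using \<sigma> \<open>m > 0\<close> by (intro mult_right_mono) auto
  moreover have "Fp F \<alpha> p X = F Y" by (simp add: Fp_def Y_def)
  ultimately show ?thesis using G Tf bP FY unfolding P_def[symmetric] by linarith
qed

lemma comparison_degenerate:
  fixes F :: "real^'n^'n \<Rightarrow> real" and u v b f :: "real^'n \<Rightarrow> real"
  assumes \<Omega>: "open \<Omega>" "bounded \<Omega>" and F: "structural_F F a A"
    and exps: "\<alpha> > 0" "\<alpha> + 1 < \<beta>" "\<beta> \<le> \<alpha> + 2"
    and b: "continuous_on \<Omega> b" "\<And>x. x \<in> \<Omega> \<Longrightarrow> \<bar>b x\<bar> \<le> B" and f: "continuous_on \<Omega> f"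
    and "m > 0" and fm: "\<And>x. x \<in> \<Omega> \<Longrightarrow> f x \<le> - m"
    and sub: "visc_sub F \<alpha> \<beta> b f \<Omega> u" and super: "visc_super F \<alpha> \<beta> b f \<Omega> v"
    and u: "usc_on (closure \<Omega>) u" and v: "lsc_on (closure \<Omega>) v"
    and M: "\<And>x. x \<in> closure \<Omega> \<Longrightarrow> \<bar>u x\<bar> \<le> M"
    and lip: "C-lipschitz_on \<Omega> u \<or> C-lipschitz_on \<Omega> v"
    and bdry: "\<And>x. x \<in> frontier \<Omega> \<Longrightarrow> u x \<le> v x" and x1: "x1 \<in> \<Omega>"
  shows "u x1 \<le> v x1"
proof -
  have "a > 0" using F by (simp add: structural_F_def)
  have "C \<ge> 0" using lip lipschitz_on_nonneg by blast
  have "B \<ge> 0" using b(2)[OF x1] by simp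
  obtain K where K: "K > 0"
    "\<And>p :: real^'n. B * norm p powr \<beta> \<le> m / 2 + a * K * (theta_vec \<alpha> p \<bullet> theta_vec \<alpha> p)"
    using gradient_term_absorption[OF \<open>a > 0\<close> \<open>B \<ge> 0\<close> \<open>m > 0\<close>, of \<alpha> \<beta>] exps
    by (smt (verit, best))
  have main: "u x1 \<le> v x1 + err" if "err > 0" for err
  proof -
    \<comment> \<open>The first entry leaves at least half of \<open>exp (- (K * u x))\<close>, so
      the slope is at least \<open>1 / 2\<close>; the second keeps \<open>z\<close> below
      \<open>u + err\<close>.\<close>
    define \<delta> where "\<delta> = min (exp (- (K * M)) / 2) (exp (- (K * M)) * (1 - exp (- (K * err))))"
    have "\<delta> > 0" using \<open>err > 0\<close> K(1) by (simp add: \<delta>_def)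
    define \<psi> where "\<psi> = (\<lambda>s. - (ln (exp (- (K * s)) - \<delta>) / K))"
    \<comment> \<open>The inverse of \<open>\<psi>\<close>, smooth and increasing on the whole line,
      while \<open>\<psi>\<close> has a singularity. A test function \<open>P\<close> for
      \<open>z\<close> can thus be turned into the test function \<open>\<Phi> \<circ> P\<close> for
      \<open>u\<close>.\<close>
    define \<Phi> where "\<Phi> = (\<lambda>s. - (ln (exp (- (K * s)) + \<delta>) / K))"
    define \<Phi>1 where "\<Phi>1 = (\<lambda>s. exp (- (K * s)) / (exp (- (K * s)) + \<delta>))"
    define \<Phi>2 where "\<Phi>2 = (\<lambda>s. - (K * \<delta> * exp (- (K * s))) / (exp (- (K * s)) + \<delta>)\<^sup>2)"
    define z where "z = (\<lambda>x. \<psi> (u x))"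
    have pos: "exp (- (K * s)) + \<delta> > 0" for s using \<open>\<delta> > 0\<close> by (simp add: add_pos_pos)
    have \<Phi>_deriv: "(\<Phi> has_real_derivative \<Phi>1 s) (at s)" for s
      unfolding \<Phi>_def \<Phi>1_def using pos[of s] K(1) by (auto intro!: derivative_eq_intros)
    have \<Phi>1_deriv: "(\<Phi>1 has_real_derivative \<Phi>2 s) (at s)" for s
      unfolding \<Phi>1_def \<Phi>2_def using pos[of s]
      by (auto intro!: derivative_eq_intros simp: power2_eq_square field_simps)
    have \<Phi>2_cont: "continuous_on S \<Phi>2" for S
      unfolding \<Phi>2_def using pos by (intro continuous_intros) (simp add: less_imp_neq[symmetric])
    have \<Phi>_mono: "\<Phi> s \<le> \<Phi> t" if "s \<le> t" for s t
      using that K(1) pos by (simp add: \<Phi>_def divide_right_mono)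
    have eM: "exp (- (K * M)) \<le> exp (- (K * s))" if "s \<le> M" for s using that K(1) by simp
    have \<delta>1: "\<delta> \<le> exp (- (K * s)) / 2" if "s \<le> M" for s
    proof -
      have "\<delta> \<le> exp (- (K * M)) / 2" by (simp add: \<delta>_def)
      then show ?thesis using eM[OF that] by linarith
    qed
    have arg: "exp (- (K * s)) - \<delta> > 0" if "s \<le> M" for s
      using \<delta>1[OF that] exp_gt_zero[of "- (K * s)"] by linarith
    have exp_\<psi>: "exp (- (K * \<psi> s)) = exp (- (K * s)) - \<delta>" if "s \<le> M" for s
      using arg[OF that] K(1) by (simp add: \<psi>_def)
    have \<Phi>\<psi>: "\<Phi> (\<psi> s) = s" if "s \<le> M" for s
      using exp_\<psi>[OF that] K(1) by (simp add: \<Phi>_def)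
    have \<psi>_ge: "s \<le> \<psi> s" if "s \<le> M" for s
    proof -
      have "exp (- (K * \<psi> s)) \<le> exp (- (K * s))" using exp_\<psi>[OF that] \<open>\<delta> > 0\<close> by simp
      then show ?thesis using K(1) by simp
    qed
    have \<psi>_le: "\<psi> s \<le> s + err" if "s \<le> M" for s
    proof -
      have "\<delta> \<le> exp (- (K * M)) * (1 - exp (- (K * err)))" by (simp add: \<delta>_def)
      also have "\<dots> \<le> exp (- (K * s)) * (1 - exp (- (K * err)))"
        using eM[OF that] K(1) \<open>err > 0\<close> by (intro mult_right_mono) auto
      finally have "exp (- (K * s)) * exp (- (K * err)) \<le> exp (- (K * \<psi> s))"
        using exp_\<psi>[OF that] by (simp add: algebra_simps)
      then have "exp (- (K * (s + err))) \<le> exp (- (K * \<psi> s))"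
        by (simp add: exp_add[symmetric] algebra_simps)
      then show ?thesis using K(1) by simp
    qed
    have uM: "u x \<le> M" if "x \<in> closure \<Omega>" for x using M[OF that] by simp
    define \<tau> where "\<tau> = (\<lambda>x. \<Phi>1 (z x))"
    \<comment> \<open>A lower bound for \<open>1 - \<tau> x = \<delta> * exp (K * u x)\<close>; here
      the lower bound of \<open>u\<close> is used.\<close>
    define \<sigma> where "\<sigma> = \<delta> * exp (- (K * M))"
    have \<tau>_eq: "\<tau> x = 1 - \<delta> * exp (K * u x)" if "x \<in> closure \<Omega>" for x
    proof -
      have "\<tau> x = (exp (- (K * u x)) - \<delta>) / exp (- (K * u x))"
        unfolding \<tau>_def \<Phi>1_def z_def exp_\<psi>[OF uM[OF that]] by simp
      then show ?thesis by (simp add: exp_minus divide_inverse left_diff_distrib)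
    qed
    have \<tau>: "1 / 2 \<le> \<tau> x" "\<sigma> \<le> 1 - \<tau> x" "\<tau> x < 1" if "x \<in> closure \<Omega>" for x
    proof -
      have "\<delta> * exp (K * u x) \<le> exp (- (K * u x)) / 2 * exp (K * u x)"
        using \<delta>1[OF uM[OF that]] by (intro mult_right_mono) auto
      also have "\<dots> = 1 / 2" by (simp add: exp_minus)
      finally show "1 / 2 \<le> \<tau> x" using \<tau>_eq[OF that] by simp
      have "- (K * M) \<le> K * u x" using M[OF that] mult_left_mono[of "- M" "u x" K] K(1) by (simp add: abs_le_iff)
      then show "\<sigma> \<le> 1 - \<tau> x" using \<tau>_eq[OF that] \<open>\<delta> > 0\<close> by (simp add: \<sigma>_def)
      show "\<tau> x < 1" using \<tau>_eq[OF that] \<open>\<delta> > 0\<close> by simp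
    qed
    have \<Phi>2_eq: "\<Phi>2 (z x) = - (\<tau> x * (K * (1 - \<tau> x)))" for x
    proof -
      define w where "w = exp (- (K * z x))"
      have "w + \<delta> > 0" using pos[of "z x"] by (simp add: w_def)
      then have "1 - w / (w + \<delta>) = \<delta> / (w + \<delta>)" by (simp add: field_simps)
      then show ?thesis unfolding \<tau>_def \<Phi>1_def \<Phi>2_def w_def[symmetric] by (simp add: power2_eq_square)
    qed
    have touch: "\<exists>r>0. \<exists>g H. ball x r \<subseteq> \<Omega> \<and> symmetric_mat X \<and>
        C2_with (\<lambda>y. \<Phi> (quadratic (z x) p X x y)) g H (ball x r) \<and> g x = \<tau> x *\<^sub>R p \<and>
        H x = \<tau> x *\<^sub>R X - (\<tau> x * (K * (1 - \<tau> x))) *\<^sub>R outer_mat p p \<and>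
        (\<forall>y\<in>ball x r. u y - \<Phi> (quadratic (z x) p X x y) \<le> u x - \<Phi> (quadratic (z x) p X x x))"
      if x: "x \<in> \<Omega>" and jet: "(p, X) \<in> superjet z \<Omega> x" for x p X
    proof -
      define P where "P = quadratic (z x) p X x"
      obtain r where r: "r > 0" "ball x r \<subseteq> \<Omega>" "\<And>y. y \<in> ball x r \<Longrightarrow> z y \<le> P y"
        and X: "symmetric_mat X" using jet by (auto simp: superjet_def P_def)
      have Px: "P x = z x" by (simp add: P_def quadratic_def)
      have uz: "u y = \<Phi> (z y)" if "y \<in> \<Omega>" for y
        using \<Phi>\<psi>[OF uM[of y]] that closure_subset[of \<Omega>] by (auto simp: z_def)
      have "u y - \<Phi> (P y) \<le> u x - \<Phi> (P x)" if "y \<in> ball x r" for y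
        using \<Phi>_mono[OF r(3)[OF that]] uz[of y] uz[OF x] r(2) that by (auto simp: Px)
      moreover define g where "g = (\<lambda>y. \<Phi>1 (P y) *\<^sub>R (p + X *v (y - x)))"
      define H where "H = (\<lambda>y. \<Phi>1 (P y) *\<^sub>R X + \<Phi>2 (P y) *\<^sub>R outer_mat (p + X *v (y - x)) (p + X *v (y - x)))"
      have "C2_with (\<lambda>y. \<Phi> (P y)) g H (ball x r)"
        unfolding P_def g_def H_def
        by (rule C2_with_compose[OF C2_with_quadratic[OF X] \<Phi>_deriv \<Phi>1_deriv \<Phi>2_cont])
      moreover have "g x = \<tau> x *\<^sub>R p" by (simp add: g_def Px \<tau>_def)
      moreover have "H x = \<tau> x *\<^sub>R X - (\<tau> x * (K * (1 - \<tau> x))) *\<^sub>R outer_mat p p"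
        using \<Phi>2_eq[of x] by (simp add: H_def Px) (simp add: \<tau>_def)
      ultimately show ?thesis using r(1,2) X unfolding P_def by blast
    qed
    have "z x1 \<le> v x1 + err"
    proof (rule comparison_of_strict_subsolution[OF \<Omega> F _ _ b f _ v _ _ _ _ _ _ x1])
      show "0 \<le> \<alpha>" "0 < \<beta>" using exps by auto
      show "0 < \<sigma> * m / 2" using \<open>\<delta> > 0\<close> \<open>m > 0\<close> by (simp add: \<sigma>_def)
      show "usc_on (closure \<Omega>) z"
        unfolding z_def
      proof (rule usc_on_mono_compose[OF u, of "{..M}"])
        show "u x \<in> {..M}" if "x \<in> closure \<Omega>" for x using uM[OF that] by simp
        show "\<psi> s \<le> \<psi> t" if "s \<in> {..M}" "t \<in> {..M}" "s \<le> t" for s t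
        proof -
          have "ln (exp (- (K * t)) - \<delta>) \<le> ln (exp (- (K * s)) - \<delta>)"
            using arg[of t] that K(1) by (intro ln_mono) auto
          then show ?thesis using K(1) by (simp add: \<psi>_def divide_right_mono)
        qed
        show "continuous_on {..M} \<psi>"
          unfolding \<psi>_def using arg K(1) by (intro continuous_intros) (auto simp: less_imp_neq[symmetric])
      qed
      \<comment> \<open>A superjet gradient \<open>p\<close> of \<open>z\<close> corresponds to
        \<open>\<tau> x *\<^sub>R p\<close> for \<open>u\<close>, so the slope bound
        \<open>1 / 2\<close> at most doubles the Lipschitz constant.\<close>
      show "2 * C + 1 \<le> 2 * C + 1" by simp
      show "z x \<le> v x + err" if "x \<in> frontier \<Omega>" for x
        using \<psi>_le[OF uM[of x]] bdry[OF that] that by (simp add: z_def frontier_def)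
      show "f x \<le> - Fp F \<alpha> p X + b x * norm p powr \<beta>" if "x \<in> \<Omega>" "(p, X) \<in> subjet v \<Omega> x" for x p X
        using visc_super_subjet[OF super that] .
      show "- Fp F \<alpha> p X + b x * norm p powr \<beta> \<le> f x - \<sigma> * m / 2"
        if x: "x \<in> \<Omega>" and jet: "(p, X) \<in> superjet z \<Omega> x" for x p X
      proof -
        have xc: "x \<in> closure \<Omega>" using x closure_subset by blast
        obtain r g H where r: "r > 0" "ball x r \<subseteq> \<Omega>" and X: "symmetric_mat X"
          and C2: "C2_with (\<lambda>y. \<Phi> (quadratic (z x) p X x y)) g H (ball x r)"
          and gH: "g x = \<tau> x *\<^sub>R p" "H x = \<tau> x *\<^sub>R X - (\<tau> x * (K * (1 - \<tau> x))) *\<^sub>R outer_mat p p"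
          and le: "\<And>y. y \<in> ball x r \<Longrightarrow> u y - \<Phi> (quadratic (z x) p X x y) \<le> u x - \<Phi> (quadratic (z x) p X x x)"
          using touch[OF x jet] by blast
        have "- Fp F \<alpha> (\<tau> x *\<^sub>R p) (\<tau> x *\<^sub>R X - (\<tau> x * (K * (1 - \<tau> x))) *\<^sub>R outer_mat p p)
            + b x * norm (\<tau> x *\<^sub>R p) powr \<beta> \<le> f x"
          using visc_sub_touching[OF sub x r C2 le] unfolding gH .
        then show ?thesis
          using \<tau>[OF xc] by (intro transformed_inequality[OF F X exps K(1) \<open>m > 0\<close> _ _ _ fm[OF x] b(2)[OF x] K(2)]) auto
      qed
      show "(\<forall>x\<in>\<Omega>. \<forall>(p, X)\<in>superjet z \<Omega> x. norm p \<le> 2 * C) \<or> (\<forall>x\<in>\<Omega>. \<forall>(p, X)\<in>subjet v \<Omega> x. norm p \<le> 2 * C)"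
        using lip
      proof
        assume lip: "C-lipschitz_on \<Omega> v"
        then show ?thesis using subjet_gradient_bound[OF lip] \<open>C \<ge> 0\<close> by fastforce
      next
        assume lip: "C-lipschitz_on \<Omega> u"
        have "norm p \<le> 2 * C" if x: "x \<in> \<Omega>" and jet: "(p, X) \<in> superjet z \<Omega> x" for x p X
        proof -
          have xc: "x \<in> closure \<Omega>" using x closure_subset by blast
          obtain r g H where r: "r > 0" "ball x r \<subseteq> \<Omega>"
            and C2: "C2_with (\<lambda>y. \<Phi> (quadratic (z x) p X x y)) g H (ball x r)" and g: "g x = \<tau> x *\<^sub>R p"
            and le: "\<And>y. y \<in> ball x r \<Longrightarrow> u y - \<Phi> (quadratic (z x) p X x y) \<le> u x - \<Phi> (quadratic (z x) p X x x)"
            using touch[OF x jet] by blast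
          have "norm (\<tau> x *\<^sub>R p) \<le> C"
          proof (rule Lipschitz_touching_gradient_bound[where f = u and
                \<phi> = "\<lambda>y. \<Phi> (quadratic (z x) p X x y)", OF _ r(1)])
            show "\<bar>u y - u x\<bar> \<le> C * norm (y - x)" if "y \<in> ball x r" for y
              using lipschitz_onD[OF lip, of y x] that r(2) x by (auto simp: dist_norm dist_real_def)
            show "((\<lambda>y. \<Phi> (quadratic (z x) p X x y)) has_derivative (\<bullet>) (\<tau> x *\<^sub>R p)) (at x)"
              using C2 r(1) unfolding C2_with_def g[symmetric] by (meson centre_in_ball)
            show "u y - \<Phi> (quadratic (z x) p X x y) \<le> u x - \<Phi> (quadratic (z x) p X x x)"
              if "y \<in> ball x r" for y using le[OF that] .
          qed
          then have "\<tau> x * norm p \<le> C" using \<tau>(1)[OF xc] by simp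
          moreover have "1 / 2 * norm p \<le> \<tau> x * norm p" using \<tau>(1)[OF xc] by (intro mult_right_mono) auto
          ultimately show ?thesis by simp
        qed
        then show ?thesis by auto
      qed
    qed
    moreover have "u x1 \<le> z x1" using \<psi>_ge[OF uM[of x1]] x1 closure_subset[of \<Omega>] by (auto simp: z_def)
    ultimately show ?thesis by simp
  qed
  then show ?thesis by (rule field_le_epsilon)
qed

theorem theorem6p1:
  fixes F :: "real^'n^'n \<Rightarrow> real" and a A \<alpha> \<beta> :: real
    and \<Omega> :: "(real^'n) set" and b f u v :: "real^'n \<Rightarrow> real"
  assumes dom: "C2_domain \<Omega>" "bounded \<Omega>"
    and F: "structural_F F a A"
    and alpha: "\<alpha> \<ge> 0"
    and beta: "\<alpha> + 1 < \<beta>" "\<beta> \<le> \<alpha> + 2"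
    and b: "continuous_on \<Omega> b" "bounded (b ` \<Omega>)"
    and f: "continuous_on \<Omega> f"
    and fm: "\<alpha> = 0 \<or> (\<alpha> \<noteq> 0 \<and> (\<exists>m>0. \<forall>x\<in>\<Omega>. f x \<le> - m))"
    and sub: "visc_sub F \<alpha> \<beta> b f \<Omega> u"
    and super: "visc_super F \<alpha> \<beta> b f \<Omega> v"
    and usc: "usc_on (closure \<Omega>) u"
    and lsc: "lsc_on (closure \<Omega>) v"
    and lip: "(\<exists>C. C-lipschitz_on \<Omega> u) \<or> (\<exists>C. C-lipschitz_on \<Omega> v)"
    and bdd: "bounded (u ` closure \<Omega>)" "bounded (v ` closure \<Omega>)"
    and bdry: "\<forall>x\<in>frontier \<Omega>. u x \<le> v x"
  shows "\<forall>x\<in>\<Omega>. u x \<le> v x"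
proof
  fix x assume x: "x \<in> \<Omega>"
  have "open \<Omega>" using dom(1) by (simp add: C2_domain_def)
  obtain B where B: "\<And>x. x \<in> \<Omega> \<Longrightarrow> \<bar>b x\<bar> \<le> B" using b(2) by (auto simp: bounded_iff)
  obtain M where M: "\<And>x. x \<in> closure \<Omega> \<Longrightarrow> \<bar>u x\<bar> \<le> M" using bdd(1) by (auto simp: bounded_iff)
  obtain C where C: "C-lipschitz_on \<Omega> u \<or> C-lipschitz_on \<Omega> v" using lip by blast
  show "u x \<le> v x"
  proof (cases "\<alpha> = 0")
    case True
    then show ?thesis
      using comparison_nondegenerate[OF \<open>open \<Omega>\<close> dom(2) F _ b(1) B f _ _ usc lsc C _ x] beta sub super bdry by auto
  next
    case False
    then obtain m where "m > 0" "\<And>x. x \<in> \<Omega> \<Longrightarrow> f x \<le> - m" using fm by blast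
    then show ?thesis
      using comparison_degenerate[OF \<open>open \<Omega>\<close> dom(2) F _ beta b(1) B f _ _ sub super usc lsc M C _ x]
        False alpha bdry by auto
  qed
qed

end
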